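(* Let $M$ be a smooth manifold equipped with a measure $\mu$, let $\mathbf X=\{X_1,\dots,X_r\}$ be a Hörmander system on $M$, and let $s>0$. 1. $\gamma^s_{\mathbf X,L^\infty}(M)\subset\gamma^s_{\mathbf X,L^2}(M)$. 2. When the Sobolev embedding holds on $M$ for $\mathbf X$ (with some index $k\in\mathbb N$), any $\phi\in\gamma^s_{\mathbf X,L^2}(M)$ is smooth; furthermore, if $\phi$ has compact support then $\phi\in\gamma^s_{\mathbf X,L^\infty}(M)$.
   Context: Measures on manifolds are always assumed Borel and regular. A Hörmander system is a family of (smooth, globally defined) real-valued vector fields on $M$ such that at every $x\in M$ the real Lie algebra generated by the family coincides with the tangent space $T_x(M)$. For $a\in\mathbb N$, $T_a^r$ is the set of $a$-tuples $I=(i_1,\dots,i_a)$ of integers in $\{1,\dots,r\}$; $\alpha_{I,j}$ is the number of indices among $i_1,\dots,i_a$ equal to $j$; $|I|:=\alpha_{I,1}+\dots+\alpha_{I,r}=a$; $I!:=\alpha_{I,1}!\cdots\alpha_{I,r}!$; $\mathbf X_I:=X_{i_1}\cdots X_{i_a}$. For $a=0$, $T_0^r=\{\emptyset\}$ and $\mathbf X_\emptyset$ is the identity ($|\emptyset|=0$, $\emptyset!=1$). Derivatives of $L^2$ functions are understood in the sense of distributions. $\gamma^s_{\mathbf X,L^\infty}(M)$ is the space of smooth compactly supported $\phi$ on $M$ for which there exist $A,C>0$ with $|\mathbf X_I\phi(x)|\le CA^{|I|}(I!)^s$ for all $a\in\mathbb N_0$, $I\in T_a^r$, $x\in M$. $\gamma^s_{\mathbf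 X,L^2}(M)$ is the space of $\phi\in L^2(M)$ for which there exist $A,C>0$ with $\|\mathbf X_I\phi\|_{L^2(M)}\le CA^{|I|}(I!)^s$ for all $a\in\mathbb N_0$, $I\in T_a^r$. The Sobolev embedding holds on $M$ for $\mathbf X$ with index $k\in\mathbb N$ when: if $f\in L^2(M)$ is such that all the norms $\|\mathbf X_If\|_{L^2}$ with $I\in T_a^r$, $a\le k$, are finite, then $f$ is continuous and bounded on $M$ and $\|f\|_{L^\infty(M)}\le C\sum_{a\le k}\sum_{I\in T_a^r}\|\mathbf X_If\|_{L^2(M)}$ for some constant $C>0$ independent of $f$. *)

theory Defs
  imports "HOL-Analysis.Analysis"
begin

section \<open>Smooth manifolds\<close>

fun C_k_on :: "nat \<Rightarrow> 'e::euclidean_space set \<Rightarrow> ('e \<Rightarrow> 'f::real_normed_vector) \<Rightarrow> bool" where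
  "C_k_on 0 S f \<longleftrightarrow> continuous_on S f"
| "C_k_on (Suc k) S f \<longleftrightarrow>
     (\<forall>x\<in>S. f differentiable (at x)) \<and> (\<forall>v. C_k_on k S (\<lambda>x. frechet_derivative f (at x) v))"

text \<open>Meaningful for open sets \<open>S\<close> only; it is never used for others.\<close>

definition C_inf_on :: "'e::euclidean_space set \<Rightarrow> ('e \<Rightarrow> 'f::real_normed_vector) \<Rightarrow> bool" where
  "C_inf_on S f \<longleftrightarrow> (\<forall>k. C_k_on k S f)"

text \<open>The underlying space of the manifold is the type \<open>'m\<close>; the model space is \<open>'e\<close>. A chart is
  a pair of its domain and its coordinate map, whose values off the domain are irrelevant.\<close>

type_synonym ('m, 'e) chart = "'m set \<times> ('m \<Rightarrow> 'e)"

definition chart_image :: "('m, 'e) chart \<Rightarrow> 'e set" where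
  "chart_image c = snd c ` fst c"

definition chart_inv :: "('m, 'e) chart \<Rightarrow> 'e \<Rightarrow> 'm" where
  "chart_inv c = inv_into (fst c) (snd c)"

definition smooth_manifold ::
  "('m::{t2_space, second_countable_topology}, 'e::euclidean_space) chart set \<Rightarrow> bool" where
  "smooth_manifold \<A> \<longleftrightarrow>
     (\<Union>c\<in>\<A>. fst c) = UNIV \<and>
     (\<forall>c\<in>\<A>. open (fst c) \<and> open (chart_image c) \<and>
        homeomorphism (fst c) (chart_image c) (snd c) (chart_inv c)) \<and>
     (\<forall>c\<in>\<A>. \<forall>d\<in>\<A>. C_inf_on (snd c ` (fst c \<inter> fst d)) (snd d \<circ> chart_inv c))"

definition smooth_on ::
  "('m::topological_space, 'e::euclidean_space) chart set \<Rightarrow> 'm set \<Rightarrow>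
   ('m \<Rightarrow> 'f::real_normed_vector) \<Rightarrow> bool" where
  "smooth_on \<A> W f \<longleftrightarrow> (\<forall>c\<in>\<A>. C_inf_on (snd c ` (fst c \<inter> W)) (f \<circ> chart_inv c))"

definition smooth_near ::
  "('m::topological_space, 'e::euclidean_space) chart set \<Rightarrow> 'm \<Rightarrow>
   ('m \<Rightarrow> 'f::real_normed_vector) \<Rightarrow> bool" where
  "smooth_near \<A> x f \<longleftrightarrow> (\<exists>W. open W \<and> x \<in> W \<and> smooth_on \<A> W f)"


section \<open>Vector fields and the Hoermander condition\<close>

text \<open>Tangent vectors at \<open>x\<close> are the derivations on functions that are smooth near \<open>x\<close>
  (the Leibniz rule forces them to depend on the germ only). They are given the value 0 on all other
  functions, so that equality of tangent vectors is equality in HOL.\<close>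

type_synonym 'm tvec = "('m \<Rightarrow> real) \<Rightarrow> real"

definition tangent_space ::
  "('m::topological_space, 'e::euclidean_space) chart set \<Rightarrow> 'm \<Rightarrow> 'm tvec set" where
  "tangent_space \<A> x = {v.
     (\<forall>f g. smooth_near \<A> x f \<longrightarrow> smooth_near \<A> x g \<longrightarrow>
        v (\<lambda>y. f y + g y) = v f + v g \<and>
        v (\<lambda>y. f y * g y) = f x * v g + g x * v f) \<and>
     (\<forall>c f. smooth_near \<A> x f \<longrightarrow> v (\<lambda>y. c * f y) = c * v f) \<and>
     (\<forall>f. \<not> smooth_near \<A> x f \<longrightarrow> v f = 0)}"

type_synonym 'm vfield = "'m \<Rightarrow> 'm tvec"

definition vfield_apply :: "'m vfield \<Rightarrow> ('m \<Rightarrow> real) \<Rightarrow> 'm \<Rightarrow> real" where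
  "vfield_apply X f = (\<lambda>x. X x f)"

definition smooth_vfield ::
  "('m::topological_space, 'e::euclidean_space) chart set \<Rightarrow> 'm vfield \<Rightarrow> bool" where
  "smooth_vfield \<A> X \<longleftrightarrow>
     (\<forall>x. X x \<in> tangent_space \<A> x) \<and>
     (\<forall>W f. open W \<longrightarrow> smooth_on \<A> W f \<longrightarrow> smooth_on \<A> W (vfield_apply X f))"

definition lie_bracket ::
  "('m::topological_space, 'e::euclidean_space) chart set \<Rightarrow> 'm vfield \<Rightarrow> 'm vfield \<Rightarrow> 'm vfield" where
  "lie_bracket \<A> X Y = (\<lambda>x f. if smooth_near \<A> x f
     then X x (vfield_apply Y f) - Y x (vfield_apply X f) else 0)"

inductive_set lie_generated ::
  "('m::topological_space, 'e::euclidean_space) chart set \<Rightarrow> 'm vfield set \<Rightarrow> 'm vfield set"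
  for \<A> :: "('m, 'e) chart set" and \<X> :: "'m vfield set" where
  gen: "X \<in> \<X> \<Longrightarrow> X \<in> lie_generated \<A> \<X>"
| zero: "(\<lambda>x f. 0) \<in> lie_generated \<A> \<X>"
| add: "X \<in> lie_generated \<A> \<X> \<Longrightarrow> Y \<in> lie_generated \<A> \<X> \<Longrightarrow>
          (\<lambda>x f. X x f + Y x f) \<in> lie_generated \<A> \<X>"
| scale: "X \<in> lie_generated \<A> \<X> \<Longrightarrow> (\<lambda>x f. (c::real) * X x f) \<in> lie_generated \<A> \<X>"
| bracket: "X \<in> lie_generated \<A> \<X> \<Longrightarrow> Y \<in> lie_generated \<A> \<X> \<Longrightarrow>
          lie_bracket \<A> X Y \<in> lie_generated \<A> \<X>"

text \<open>The system \<open>X\<^sub>1, \<dots>, X\<^sub>r\<close> is the restriction of \<open>X\<close> to \<open>{1..r}\<close>.\<close>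

definition hoermander_system ::
  "('m::topological_space, 'e::euclidean_space) chart set \<Rightarrow> nat \<Rightarrow> (nat \<Rightarrow> 'm vfield) \<Rightarrow> bool" where
  "hoermander_system \<A> r X \<longleftrightarrow>
     (\<forall>i\<in>{1..r}. smooth_vfield \<A> (X i)) \<and>
     (\<forall>x. {Z x | Z. Z \<in> lie_generated \<A> (X ` {1..r})} = tangent_space \<A> x)"


section \<open>Multi-indices and iterated derivatives\<close>

definition tuples :: "nat \<Rightarrow> nat \<Rightarrow> nat list set" where
  "tuples r a = {I. length I = a \<and> set I \<subseteq> {1..r}}"

definition tuple_fact :: "nat \<Rightarrow> nat list \<Rightarrow> real" where
  "tuple_fact r I = (\<Prod>j=1..r. fact (count_list I j))"

definition capply :: "'m vfield \<Rightarrow> ('m \<Rightarrow> complex) \<Rightarrow> 'm \<Rightarrow> complex" where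
  "capply X f = (\<lambda>x. Complex (vfield_apply X (Re \<circ> f) x) (vfield_apply X (Im \<circ> f) x))"

definition iter_deriv ::
  "(nat \<Rightarrow> 'm vfield) \<Rightarrow> nat list \<Rightarrow> ('m \<Rightarrow> complex) \<Rightarrow> 'm \<Rightarrow> complex" where
  "iter_deriv X I f = foldr (\<lambda>i. capply (X i)) I f"


section \<open>Measures, null sets and distributional derivatives\<close>

definition regular_borel :: "'m::t2_space measure \<Rightarrow> bool" where
  "regular_borel \<mu> \<longleftrightarrow>
     sets \<mu> = sets borel \<and>
     (\<forall>K. compact K \<longrightarrow> emeasure \<mu> K < \<infinity>) \<and>
     (\<forall>B\<in>sets \<mu>. emeasure \<mu> B = (INF U\<in>{U. open U \<and> B \<subseteq> U}. emeasure \<mu> U)) \<and>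
     (\<forall>U. open U \<longrightarrow> emeasure \<mu> U = (SUP K\<in>{K. compact K \<and> K \<subseteq> U}. emeasure \<mu> K))"

definition in_L2 :: "'m measure \<Rightarrow> ('m \<Rightarrow> complex) \<Rightarrow> bool" where
  "in_L2 \<mu> f \<longleftrightarrow> f \<in> borel_measurable \<mu> \<and> integrable \<mu> (\<lambda>x. (cmod (f x))\<^sup>2)"

definition L2_norm :: "'m measure \<Rightarrow> ('m \<Rightarrow> complex) \<Rightarrow> real" where
  "L2_norm \<mu> f = sqrt (\<integral>x. (cmod (f x))\<^sup>2 \<partial>\<mu>)"

text \<open>No relation between \<open>\<mu>\<close> and the smooth structure is assumed. Elements of \<open>L\<^sup>2\<close> also act as
  distributions, hence ``almost everywhere'' is taken with respect to \<open>\<mu>\<close> and to Lebesgue measure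
  in the charts. If \<open>\<mu>\<close> has a positive smooth density, the two conditions are equivalent.\<close>

definition ae_on_manifold ::
  "('m, 'e::euclidean_space) chart set \<Rightarrow> 'm measure \<Rightarrow> ('m \<Rightarrow> bool) \<Rightarrow> bool" where
  "ae_on_manifold \<A> \<mu> P \<longleftrightarrow>
     (AE x in \<mu>. P x) \<and>
     (\<forall>c\<in>\<A>. AE y in lborel. y \<in> chart_image c \<longrightarrow> P (chart_inv c y))"

definition support :: "('a::topological_space \<Rightarrow> 'b::zero) \<Rightarrow> 'a set" where
  "support f = closure {x. f x \<noteq> 0}"

text \<open>Support of an almost-everywhere class of functions.\<close>

definition ae_support ::
  "('m::topological_space, 'e::euclidean_space) chart set \<Rightarrow> 'm measure \<Rightarrow>
   ('m \<Rightarrow> complex) \<Rightarrow> 'm set" where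
  "ae_support \<A> \<mu> f = - \<Union>{W. open W \<and> ae_on_manifold \<A> \<mu> (\<lambda>x. x \<in> W \<longrightarrow> f x = 0)}"

definition locally_integrable ::
  "('m, 'e::euclidean_space) chart set \<Rightarrow> ('m \<Rightarrow> complex) \<Rightarrow> bool" where
  "locally_integrable \<A> f \<longleftrightarrow>
     (\<forall>c\<in>\<A>. \<forall>K. compact K \<and> K \<subseteq> chart_image c \<longrightarrow>
        set_integrable lborel K (f \<circ> chart_inv c))"

definition test_function :: "'e::euclidean_space set \<Rightarrow> ('e \<Rightarrow> real) \<Rightarrow> bool" where
  "test_function S \<eta> \<longleftrightarrow> C_inf_on UNIV \<eta> \<and> compact (support \<eta>) \<and> support \<eta> \<subseteq> S"

text \<open>Formal transpose of \<open>X = \<Sum>\<^sub>b a\<^sub>b \<partial>\<^sub>b\<close> with respect to Lebesgue measure in the chart \<open>c\<close>,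
  where \<open>a\<^sub>b = X (c \<bullet> b)\<close>; it sends \<open>\<eta>\<close> to \<open>- \<Sum>\<^sub>b \<partial>\<^sub>b (a\<^sub>b \<eta>)\<close>. Off the image of the chart the
  coefficients are meaningless, but there \<open>\<eta>\<close> vanishes.\<close>

definition transpose_in_chart ::
  "('m, 'e::euclidean_space) chart \<Rightarrow> 'm vfield \<Rightarrow> ('e \<Rightarrow> real) \<Rightarrow> 'e \<Rightarrow> real" where
  "transpose_in_chart c X \<eta> = (\<lambda>y. - (\<Sum>b\<in>Basis. frechet_derivative
     (\<lambda>z. X (chart_inv c z) (\<lambda>p. snd c p \<bullet> b) * \<eta> z) (at y) b))"

text \<open>\<open>g\<close> represents the distribution \<open>X\<^sub>I f\<close>. Distributions on \<open>M\<close> are tested against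
  compactly supported smooth densities \<open>\<eta> dy\<close> in the charts, so that no reference measure is
  involved. Note that \<open>fold\<close> applies the transpose of the first (outermost) field of \<open>I\<close> first.\<close>

definition distr_deriv ::
  "('m, 'e::euclidean_space) chart set \<Rightarrow> (nat \<Rightarrow> 'm vfield) \<Rightarrow> nat list \<Rightarrow>
   ('m \<Rightarrow> complex) \<Rightarrow> ('m \<Rightarrow> complex) \<Rightarrow> bool" where
  "distr_deriv \<A> X I f g \<longleftrightarrow>
     locally_integrable \<A> f \<and> locally_integrable \<A> g \<and>
     (\<forall>c\<in>\<A>. \<forall>\<eta>. test_function (chart_image c) \<eta> \<longrightarrow>
        (\<integral>y. g (chart_inv c y) * complex_of_real (\<eta> y) \<partial>lborel) =
        (\<integral>y. f (chart_inv c y) *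
            complex_of_real (fold (\<lambda>i. transpose_in_chart c (X i)) I \<eta> y) \<partial>lborel))"


section \<open>Gevrey spaces and the Sobolev embedding\<close>

definition gevrey_Linf ::
  "('m::topological_space, 'e::euclidean_space) chart set \<Rightarrow> nat \<Rightarrow> (nat \<Rightarrow> 'm vfield) \<Rightarrow> real \<Rightarrow>
   ('m \<Rightarrow> complex) set" where
  "gevrey_Linf \<A> r X s = {\<phi>. smooth_on \<A> UNIV \<phi> \<and> compact (support \<phi>) \<and>
     (\<exists>A>0. \<exists>C>0. \<forall>a. \<forall>I\<in>tuples r a. \<forall>x.
        cmod (iter_deriv X I \<phi> x) \<le> C * A ^ a * tuple_fact r I powr s)}"

text \<open>In the next two definitions \<open>g I\<close> stands for the distributional derivative \<open>X\<^sub>I f\<close>,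
  required to be a function in \<open>L\<^sup>2\<close>.\<close>

definition gevrey_L2 ::
  "('m, 'e::euclidean_space) chart set \<Rightarrow> 'm measure \<Rightarrow> nat \<Rightarrow> (nat \<Rightarrow> 'm vfield) \<Rightarrow> real \<Rightarrow>
   ('m \<Rightarrow> complex) set" where
  "gevrey_L2 \<A> \<mu> r X s = {\<phi>. \<exists>g. g [] = \<phi> \<and>
     (\<forall>a. \<forall>I\<in>tuples r a. in_L2 \<mu> (g I) \<and> distr_deriv \<A> X I \<phi> (g I)) \<and>
     (\<exists>A>0. \<exists>C>0. \<forall>a. \<forall>I\<in>tuples r a.
        L2_norm \<mu> (g I) \<le> C * A ^ a * tuple_fact r I powr s)}"

definition sobolev_embedding ::
  "('m::topological_space, 'e::euclidean_space) chart set \<Rightarrow> 'm measure \<Rightarrow> nat \<Rightarrow>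
   (nat \<Rightarrow> 'm vfield) \<Rightarrow> nat \<Rightarrow> bool" where
  "sobolev_embedding \<A> \<mu> r X k \<longleftrightarrow>
     (\<exists>C>0. \<forall>f g. g [] = f \<longrightarrow>
        (\<forall>a\<le>k. \<forall>I\<in>tuples r a. in_L2 \<mu> (g I) \<and> distr_deriv \<A> X I f (g I)) \<longrightarrow>
        (\<exists>h. continuous_on UNIV h \<and> bounded (range h) \<and> ae_on_manifold \<A> \<mu> (\<lambda>x. f x = h x) \<and>
           (SUP x. cmod (h x)) \<le> C * (\<Sum>a\<le>k. \<Sum>I\<in>tuples r a. L2_norm \<mu> (g I))))"

end

theory Submission
  imports Defs
begin

text \<open>For smooth functions, classical and distributional derivatives along smooth fields agree by
  integration by parts in charts, and for compactly supported ones the \<open>L\<^sup>2\<close> norm is bounded by a multiple of the supremum norm.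

  Conversely, the Sobolev embedding applied to each \<open>X\<^sub>I \<phi>\<close> replaces it by a bounded continuous function
  \<open>h\<^sub>I\<close>, with \<open>h\<^bsub>iI\<^esub> = X\<^sub>i h\<^sub>I\<close> weakly. Weak differentiability along fields passes to their brackets, so
  by the Hoermander condition \<open>h\<close> is weakly differentiable along fields \<open>Z\<^sub>b\<close> that equal the coordinate
  directions at a given point. Inverting this frame near the point, the weak partial derivatives are
  smooth combinations of the \<open>Z\<^sub>b h\<close>, which belong to the same class of continuous functions; hence
  \<open>h\<close> is \<open>C\<^sup>1\<close> and, inductively, smooth. The quantitative part is \<open>(J I)! \<le> 2\<^bsup>|J| + |I|\<^esup> J! I!\<close>, which
  absorbs the \<open>|J| \<le> k\<close> additional derivatives of the embedding into the constants.\<close>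

section \<open>Calculus of smooth functions\<close>

text \<open>The measure enters through norms and null sets only: distributions are tested against
  smooth densities in charts, so the adjoint of a field is its transpose for Lebesgue measure and no
  density of \<mu> is ever differentiated. The obstacle in the second half is that \<open>h\<close>
  is merely continuous, while brackets involve second derivatives. Identities between fields are
  therefore moved onto test functions by duality, and the induction is carried by a whole vector
  space of continuous functions stable under weak derivatives: a bracket sends a member to a
  difference of members, and the gradient of a member is locally a smooth combination of members.
  Tangent vectors are abstract derivations, so Hadamard's lemma is what recovers them from their
  values on coordinates. The factor 2 in the factorial estimate bounds the binomial coefficients
  index by index; raised to the power \<open>s\<close>, it turns the radius \<open>A\<close> into
  \<open>A * 2 powr s\<close>.\<close>

lemma C_k_on_cong:
  assumes "open S" and "\<And>x. x \<in> S \<Longrightarrow> f x = g x"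
  shows "C_k_on k S f \<longleftrightarrow> C_k_on k S g"
proof -
  have *: "C_k_on k S g" if "C_k_on k S f" "\<And>x. x \<in> S \<Longrightarrow> f x = g x" for k and f g :: "'a \<Rightarrow> 'b"
    using that
  proof (induction k arbitrary: f g)
    case 0
    then show ?case using continuous_on_cong by fastforce
  next
    case (Suc k)
    have d: "(g has_derivative frechet_derivative f (at x)) (at x)" if "x \<in> S" for x
      using Suc.prems that \<open>open S\<close>
      by (auto intro: has_derivative_transform_within_open simp: frechet_derivative_works)
    then have "frechet_derivative g (at x) = frechet_derivative f (at x)" if "x \<in> S" for x
      using that frechet_derivative_at by metis
    then have "C_k_on k S (\<lambda>x. frechet_derivative g (at x) v)" for v
      using Suc.IH[of "\<lambda>x. frechet_derivative f (at x) v" "\<lambda>x. frechet_derivative g (at x) v"] Suc.prems(1)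
      by simp
    with d show ?case by (auto simp: differentiable_def)
  qed
  show ?thesis using *[of k f g] *[of k g f] assms(2) by metis
qed

lemma C_inf_on_cong:
  assumes "open S" and "\<And>x. x \<in> S \<Longrightarrow> f x = g x"
  shows "C_inf_on S f \<longleftrightarrow> C_inf_on S g"
  by (simp add: C_inf_on_def C_k_on_cong[of S f g, OF assms])

text \<open>\<open>C_k_on\<close> speaks of \<open>frechet_derivative\<close>, which is defined by
  choice. On an open set the derivative is unique, so any explicit candidate \<open>f'\<close> may
  be used in its place; every closure property below goes through this rule.\<close>

lemma C_k_on_SucI:
  assumes "open S" and "\<And>x. x \<in> S \<Longrightarrow> (f has_derivative f' x) (at x)"
    and "\<And>v. C_k_on k S (\<lambda>x. f' x v)"
  shows "C_k_on (Suc k) S f"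
proof -
  have "frechet_derivative f (at x) = f' x" if "x \<in> S" for x
    using frechet_derivative_at assms(2) that by metis
  then have "C_k_on k S (\<lambda>x. frechet_derivative f (at x) v)" for v
    using C_k_on_cong[OF assms(1), of "\<lambda>x. frechet_derivative f (at x) v" "\<lambda>x. f' x v" k] assms(3) by simp
  with assms(2) show ?thesis by (auto simp: differentiable_def)
qed

lemma C_k_on_SucD:
  assumes "C_k_on (Suc k) S f"
  shows "C_k_on k S f"
  using assms
proof (induction k arbitrary: f)
  case 0
  then show ?case
    by (auto intro!: differentiable_imp_continuous_on simp: differentiable_on_def differentiable_at_withinI)
next
  case (Suc k)
  then show ?case by simp
qed

lemma C_k_on_mono:
  assumes "C_k_on k S f" and "T \<subseteq> S"
  shows "C_k_on k T f"
  using assms by (induction k arbitrary: f) (auto intro: continuous_on_subset)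

lemma C_inf_on_mono: "C_inf_on S f \<Longrightarrow> T \<subseteq> S \<Longrightarrow> C_inf_on T f"
  unfolding C_inf_on_def using C_k_on_mono by blast

text \<open>Continuity and differentiability at a point depend on a neighbourhood only. This permits
  gluing a product with a cut-off to the zero function, and proving regularity near one point at a
  time.\<close>

lemma C_k_on_local:
  assumes "\<And>x. x \<in> S \<Longrightarrow> \<exists>T. open T \<and> x \<in> T \<and> C_k_on k T f"
  shows "C_k_on k S f"
  using assms
proof (induction k arbitrary: f)
  case 0
  have "isCont f x" if "x \<in> S" for x
    using 0[OF that] by (auto simp: continuous_on_eq_continuous_at)
  then show ?case by (simp add: continuous_at_imp_continuous_on)
next
  case (Suc k)
  have "f differentiable (at x)" if "x \<in> S" for x
    using Suc.prems[OF that] by auto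
  moreover have "C_k_on k S (\<lambda>x. frechet_derivative f (at x) v)" for v
    by (rule Suc.IH) (use Suc.prems in fastforce)
  ultimately show ?case by simp
qed

lemma C_inf_on_local:
  assumes "\<And>x. x \<in> S \<Longrightarrow> \<exists>T. open T \<and> x \<in> T \<and> C_inf_on T f"
  shows "C_inf_on S f"
  unfolding C_inf_on_def using C_k_on_local assms unfolding C_inf_on_def by metis

lemma C_inf_on_Un:
  assumes "open S" "open T" "C_inf_on S f" "C_inf_on T f"
  shows "C_inf_on (S \<union> T) f"
  by (rule C_inf_on_local) (use assms in blast)

lemma C_inf_on_continuous: "C_inf_on S f \<Longrightarrow> continuous_on S f"
  unfolding C_inf_on_def using C_k_on.simps(1) by blast

lemma C_inf_on_has_derivative:
  assumes "C_inf_on S f" "x \<in> S"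
  shows "(f has_derivative frechet_derivative f (at x)) (at x)"
  using assms unfolding C_inf_on_def by (metis C_k_on.simps(2) frechet_derivative_works)

lemma C_inf_on_frechet_derivative:
  "C_inf_on S f \<Longrightarrow> C_inf_on S (\<lambda>x. frechet_derivative f (at x) v)"
  unfolding C_inf_on_def by (metis C_k_on.simps(2))

lemma C_k_on_const: "open S \<Longrightarrow> C_k_on k S (\<lambda>x. c)"
proof (induction k arbitrary: c)
  case (Suc k)
  then show ?case by (intro C_k_on_SucI[where f'="\<lambda>x v. 0"]) auto
qed simp

lemma C_inf_on_const: "open S \<Longrightarrow> C_inf_on S (\<lambda>x. c)"
  by (simp add: C_inf_on_def C_k_on_const)

lemma C_k_on_add:
  assumes "open S" "C_k_on k S f" "C_k_on k S g"
  shows "C_k_on k S (\<lambda>x. f x + g x)"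
  using assms(2,3)
proof (induction k arbitrary: f g)
  case 0
  then show ?case by (auto intro: continuous_intros)
next
  case (Suc k)
  then show ?case
    by (intro C_k_on_SucI[OF assms(1), where
          f'="\<lambda>x v. frechet_derivative f (at x) v + frechet_derivative g (at x) v"])
       (auto intro!: has_derivative_add simp: frechet_derivative_works)
qed

lemma C_inf_on_add: "open S \<Longrightarrow> C_inf_on S f \<Longrightarrow> C_inf_on S g \<Longrightarrow> C_inf_on S (\<lambda>x. f x + g x)"
  by (simp add: C_inf_on_def C_k_on_add)

lemma C_k_on_sum:
  assumes "open S" "\<And>i. i \<in> I \<Longrightarrow> C_k_on k S (f i)"
  shows "C_k_on k S (\<lambda>x. \<Sum>i\<in>I. f i x)"
  using assms(2)
  by (induction I rule: infinite_finite_induct) (auto intro: C_k_on_const C_k_on_add assms(1))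

lemma C_inf_on_sum:
  "open S \<Longrightarrow> (\<And>i. i \<in> I \<Longrightarrow> C_inf_on S (f i)) \<Longrightarrow> C_inf_on S (\<lambda>x. \<Sum>i\<in>I. f i x)"
  by (simp add: C_inf_on_def C_k_on_sum)

lemma C_k_on_bounded_linear:
  assumes "open S" "bounded_linear L" "C_k_on k S f"
  shows "C_k_on k S (\<lambda>x. L (f x))"
  using assms(3)
proof (induction k arbitrary: f)
  case 0
  then show ?case by (auto intro: bounded_linear.continuous_on[OF assms(2)])
next
  case (Suc k)
  then show ?case
    by (intro C_k_on_SucI[OF assms(1), where f'="\<lambda>x v. L (frechet_derivative f (at x) v)"])
       (auto intro!: bounded_linear.has_derivative[OF assms(2)] simp: frechet_derivative_works)
qed

lemma C_inf_on_bounded_linear: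
  "open S \<Longrightarrow> bounded_linear L \<Longrightarrow> C_inf_on S f \<Longrightarrow> C_inf_on S (\<lambda>x. L (f x))"
  by (simp add: C_inf_on_def C_k_on_bounded_linear)

lemma C_k_on_scaleR:
  assumes "open S" "C_k_on k S f" "C_k_on k S g"
  shows "C_k_on k S (\<lambda>x. f x *\<^sub>R g x)"
  using assms(2,3)
proof (induction k arbitrary: f g)
  case 0
  then show ?case by (auto intro: continuous_intros)
next
  case (Suc k)
  \<comment> \<open>The product rule leaves one factor undifferentiated, and the induction
    hypothesis wants that factor in class \<open>k\<close>.\<close>
  note less = C_k_on_SucD[OF Suc.prems(1)] C_k_on_SucD[OF Suc.prems(2)]
  show ?case
  proof (rule C_k_on_SucI[OF assms(1), where
        f'="\<lambda>x v. f x *\<^sub>R frechet_derivative g (at x) v + frechet_derivative f (at x) v *\<^sub>R g x"])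
    show "((\<lambda>x. f x *\<^sub>R g x) has_derivative
        (\<lambda>v. f x *\<^sub>R frechet_derivative g (at x) v + frechet_derivative f (at x) v *\<^sub>R g x)) (at x)"
      if "x \<in> S" for x
      using Suc.prems that by (intro has_derivative_scaleR) (auto simp: frechet_derivative_works)
    show "C_k_on k S (\<lambda>x. f x *\<^sub>R frechet_derivative g (at x) v + frechet_derivative f (at x) v *\<^sub>R g x)" for v
      using Suc.prems less by (intro C_k_on_add[OF assms(1)] Suc.IH) auto
  qed
qed

lemma C_inf_on_scaleR:
  "open S \<Longrightarrow> C_inf_on S f \<Longrightarrow> C_inf_on S g \<Longrightarrow> C_inf_on S (\<lambda>x. f x *\<^sub>R g x)"
  by (simp add: C_inf_on_def C_k_on_scaleR)

lemma C_inf_on_mult: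
  fixes f g :: "'a::euclidean_space \<Rightarrow> real"
  shows "open S \<Longrightarrow> C_inf_on S f \<Longrightarrow> C_inf_on S g \<Longrightarrow> C_inf_on S (\<lambda>x. f x * g x)"
  using C_inf_on_scaleR[of S f g] by simp

lemma C_inf_on_diff:
  assumes "open S" "C_inf_on S f" "C_inf_on S g"
  shows "C_inf_on S (\<lambda>x. f x - g x)"
  using C_inf_on_add[OF assms(1,2) C_inf_on_bounded_linear[OF assms(1) bounded_linear_minus[OF bounded_linear_ident] assms(3)]]
  by simp

lemma C_inf_on_ident: "open S \<Longrightarrow> C_inf_on S (\<lambda>x. x)"
  unfolding C_inf_on_def
proof
  fix k assume "open S"
  then show "C_k_on k S (\<lambda>x. x)"
    by (cases k) (auto intro!: C_k_on_SucI[where f'="\<lambda>x v. v"] C_k_on_const simp del: C_k_on.simps(2))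
qed

lemma C_inf_on_inner_left:
  "open S \<Longrightarrow> C_inf_on S f \<Longrightarrow> C_inf_on S (\<lambda>x. f x \<bullet> b)"
  by (rule C_inf_on_bounded_linear) (auto intro: bounded_linear_inner_left)

lemma C_k_on_compose:
  fixes g :: "'a::euclidean_space \<Rightarrow> 'b::euclidean_space" and f :: "'b \<Rightarrow> 'c::real_normed_vector"
  assumes "open S" "open T" "C_k_on k T f" "C_k_on k S g" "g ` S \<subseteq> T"
  shows "C_k_on k S (f \<circ> g)"
  using assms(3,4)
proof (induction k arbitrary: f)
  case 0
  then show ?case using assms(5) continuous_on_subset by (auto simp: comp_def intro: continuous_on_compose2)
next
  case (Suc k)
  let ?f' = "\<lambda>y. frechet_derivative f (at y)" and ?g' = "\<lambda>x. frechet_derivative g (at x)"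
  have df: "(f has_derivative ?f' (g x)) (at (g x))" if "x \<in> S" for x
    using Suc.prems(1) assms(5) that by (auto simp: frechet_derivative_works)
  \<comment> \<open>The direction \<open>?g' x v\<close> varies with \<open>x\<close>, so the
    induction hypothesis does not apply to \<open>?f' (g x) (?g' x v)\<close> directly. Expanding it
    in the basis leaves products of scalar coefficients with \<open>?f' (g x) b\<close> for fixed
    \<open>b\<close>, and these are compositions of class \<open>k\<close>.\<close>
  have exp: "?f' (g x) (?g' x v) = (\<Sum>b\<in>Basis. (?g' x v \<bullet> b) *\<^sub>R (?f' (g x) b))" if "x \<in> S" for x v
  proof -
    have l: "linear (?f' (g x))" using has_derivative_linear[OF df[OF that]] .
    have "?f' (g x) (?g' x v) = ?f' (g x) (\<Sum>b\<in>Basis. (?g' x v \<bullet> b) *\<^sub>R b)"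
      by (simp add: euclidean_representation)
    then show ?thesis by (simp add: linear_sum[OF l] linear_scale[OF l])
  qed
  show ?case
  proof (rule C_k_on_SucI[OF assms(1), where f'="\<lambda>x v. \<Sum>b\<in>Basis. (?g' x v \<bullet> b) *\<^sub>R (?f' (g x) b)"])
    show "(f \<circ> g has_derivative (\<lambda>v. \<Sum>b\<in>Basis. (?g' x v \<bullet> b) *\<^sub>R (?f' (g x) b))) (at x)"
      if "x \<in> S" for x
    proof -
      have "(g has_derivative ?g' x) (at x)"
        using Suc.prems(2) that by (auto simp: frechet_derivative_works)
      from diff_chain_at[OF this df[OF that]]
      show ?thesis using exp[OF that] by (simp add: comp_def)
    qed
    show "C_k_on k S (\<lambda>x. \<Sum>b\<in>Basis. (?g' x v \<bullet> b) *\<^sub>R (?f' (g x) b))" for v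
    proof (intro C_k_on_sum C_k_on_scaleR assms(1))
      fix b :: 'b assume "b \<in> Basis"
      show "C_k_on k S (\<lambda>x. ?g' x v \<bullet> b)"
        using Suc.prems(2) by (auto intro: C_k_on_bounded_linear[OF assms(1) bounded_linear_inner_left])
      have "C_k_on k S ((\<lambda>y. ?f' y b) \<circ> g)"
        using Suc.prems C_k_on_SucD by (intro Suc.IH) auto
      then show "C_k_on k S (\<lambda>x. ?f' (g x) b)" by (simp add: comp_def)
    qed
  qed
qed

lemma C_inf_on_compose:
  "open S \<Longrightarrow> open T \<Longrightarrow> C_inf_on T f \<Longrightarrow> C_inf_on S g \<Longrightarrow> g ` S \<subseteq> T \<Longrightarrow> C_inf_on S (f \<circ> g)"
  by (simp add: C_inf_on_def C_k_on_compose[of S T _ f g])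

section \<open>Integrals along segments and Hadamard's lemma\<close>

lemma segment_in_ball:
  fixes p :: "'a::real_normed_vector" and t :: real
  assumes "y \<in> ball p \<rho>" "t \<in> {0..1}"
  shows "p + t *\<^sub>R (y - p) \<in> ball p \<rho>"
proof -
  have "norm (t *\<^sub>R (y - p)) \<le> norm (y - p)"
    using assms(2) mult_left_le_one_le[of "norm (y - p)" t] by simp
  moreover have "norm (y - p) < \<rho>" using assms(1) by (simp add: dist_norm norm_minus_commute)
  ultimately have "norm (t *\<^sub>R (y - p)) < \<rho>" by linarith
  then show ?thesis by (simp only: mem_ball dist_norm) simp
qed

text \<open>The Hadamard quotient: its smoothness needs all powers of \<open>t\<close>, since differentiating under
  the integral sign multiplies the integrand by \<open>t\<close>.\<close>

lemma C_k_on_segment_integral: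
  fixes F :: "'a::euclidean_space \<Rightarrow> real"
  assumes "C_inf_on (ball p \<rho>) F"
  shows "C_k_on k (ball p \<rho>) (\<lambda>y. integral {0..1} (\<lambda>t. t ^ n * F (p + t *\<^sub>R (y - p))))"
  using assms
proof (induction k arbitrary: F n)
  let ?B = "ball p \<rho>"
  have seg: "p + t *\<^sub>R (y - p) \<in> ?B" if "y \<in> ?B" "t \<in> {0..1}" for y and t :: real
    using segment_in_ball that .
  have cont: "continuous_on (?B \<times> cbox 0 1) (\<lambda>(y, t). t ^ n * F (p + t *\<^sub>R (y - p)))"
    if "C_inf_on ?B F" for F :: "'a \<Rightarrow> real" and n
  proof -
    have "continuous_on (?B \<times> cbox 0 1) (\<lambda>z. F (p + snd z *\<^sub>R (fst z - p)))"
      by (rule continuous_on_compose2[OF C_inf_on_continuous[OF that]])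
         (use seg in \<open>auto intro!: continuous_intros\<close>)
    then show ?thesis by (auto simp: split_beta intro!: continuous_intros)
  qed
  {
    case 0
    show ?case
      using integral_continuous_on_param[OF cont[OF 0]] by simp
  next
    case (Suc k)
    let ?F' = "\<lambda>y. frechet_derivative F (at y)"
    have dF: "(F has_derivative ?F' y) (at y)" if "y \<in> ?B" for y
      using C_inf_on_has_derivative[OF Suc.prems that] .
    \<comment> \<open>\<open>leibniz_rule\<close> asks for the parameter derivative as a continuous
      map into bounded linear functions, hence the \<open>Blinfun\<close>; its value is meaningful
      only while the argument stays in the ball.\<close>
    define fx where "fx y t = (t ^ Suc n) *\<^sub>R Blinfun (?F' (p + t *\<^sub>R (y - p)))" for y and t :: real
    have fx: "blinfun_apply (fx y t) v = t ^ Suc n * ?F' (p + t *\<^sub>R (y - p)) v"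
      if "y \<in> ?B" "t \<in> {0..1}" for y t v
    proof -
      have "bounded_linear (?F' (p + t *\<^sub>R (y - p)))"
        using dF[OF seg[OF that]] by (rule has_derivative_bounded_linear)
      then show ?thesis by (simp add: fx_def bounded_linear_Blinfun_apply blinfun.scaleR_left)
    qed
    have contfx: "continuous_on (?B \<times> cbox 0 1) (\<lambda>(y, t). fx y t)"
      unfolding split_beta
    proof (rule continuous_on_blinfun_componentwise)
      fix i :: 'a
      have "continuous_on (?B \<times> cbox 0 1) (\<lambda>(y, t). t ^ Suc n * ?F' (p + t *\<^sub>R (y - p)) i)"
        by (rule cont[OF C_inf_on_frechet_derivative[OF Suc.prems]])
      then show "continuous_on (?B \<times> cbox 0 1) (\<lambda>z. blinfun_apply (fx (fst z) (snd z)) i)"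
        by (rule continuous_on_eq) (auto simp: fx)
    qed
    have D: "((\<lambda>y. integral (cbox 0 1) (\<lambda>t. t ^ n * F (p + t *\<^sub>R (y - p)))) has_derivative
        integral (cbox 0 1) (fx y)) (at y)" if y: "y \<in> ?B" for y
    proof -
      have "((\<lambda>y. integral (cbox 0 1) (\<lambda>t. t ^ n * F (p + t *\<^sub>R (y - p)))) has_derivative
        integral (cbox 0 1) (fx y)) (at y within ?B)"
      proof (rule leibniz_rule[OF _ _ contfx y])
        fix z and t :: real assume z: "z \<in> ?B" and t: "t \<in> cbox 0 1"
        have "((\<lambda>y. p + t *\<^sub>R (y - p)) has_derivative (\<lambda>v. t *\<^sub>R v)) (at z)"
          by (auto intro!: derivative_eq_intros)
        from diff_chain_at[OF this dF[OF seg[OF z]]] t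
        have "((\<lambda>y. F (p + t *\<^sub>R (y - p))) has_derivative (\<lambda>v. ?F' (p + t *\<^sub>R (z - p)) (t *\<^sub>R v))) (at z)"
          by (simp add: comp_def)
        then have "((\<lambda>y. t ^ n * F (p + t *\<^sub>R (y - p))) has_derivative
            (\<lambda>v. t ^ n * ?F' (p + t *\<^sub>R (z - p)) (t *\<^sub>R v))) (at z)"
          by (rule has_derivative_mult_right)
        also have "(\<lambda>v. t ^ n * ?F' (p + t *\<^sub>R (z - p)) (t *\<^sub>R v)) = blinfun_apply (fx z t)"
          using linear_scale[OF has_derivative_linear[OF dF[OF seg[OF z]]], of t] t z
          by (auto simp: fx)
        finally show "((\<lambda>y. t ^ n * F (p + t *\<^sub>R (y - p))) has_derivative blinfun_apply (fx z t)) (at z within ?B)"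
          by (rule has_derivative_at_withinI)
      next
        fix z assume z: "z \<in> ?B"
        have "continuous_on (cbox 0 1) (\<lambda>t. (\<lambda>(y, t). t ^ n * F (p + t *\<^sub>R (y - p))) (z, t))"
          by (rule continuous_on_compose2[OF cont[OF Suc.prems, of n]]) (use z in \<open>auto intro!: continuous_intros\<close>)
        then show "(\<lambda>t. t ^ n * F (p + t *\<^sub>R (z - p))) integrable_on cbox 0 1"
          by (simp add: integrable_continuous_interval)
      qed simp
      then show ?thesis using at_within_open[OF y open_ball] by simp
    qed
    show ?case
    proof (rule C_k_on_SucI[where f'="\<lambda>y v. integral (cbox 0 1) (fx y) v"])
      show "open ?B" by simp
      show "((\<lambda>y. integral {0..1} (\<lambda>t. t ^ n * F (p + t *\<^sub>R (y - p)))) has_derivative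
        blinfun_apply (integral (cbox 0 1) (fx y))) (at y)" if y: "y \<in> ?B" for y
        using D[OF that] by simp
      fix v
      have "blinfun_apply (integral (cbox 0 1) (fx y)) v
          = integral {0..1} (\<lambda>t. t ^ Suc n * ?F' (p + t *\<^sub>R (y - p)) v)" if y: "y \<in> ?B" for y
      proof -
        have "continuous_on (cbox 0 1) (\<lambda>t. (\<lambda>(y, t). fx y t) (y, t))"
          by (rule continuous_on_compose2[OF contfx]) (use y in \<open>auto intro!: continuous_intros\<close>)
        then have "fx y integrable_on cbox 0 1"
          using integrable_continuous_real[of 0 1 "fx y"] by simp
        from integral_linear[OF this blinfun.bounded_linear_left[of v]]
        have "blinfun_apply (integral (cbox 0 1) (fx y)) v = integral (cbox 0 1) (\<lambda>t. fx y t v)"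
          by (simp add: comp_def)
        also have "\<dots> = integral {0..1} (\<lambda>t. t ^ Suc n * ?F' (p + t *\<^sub>R (y - p)) v)"
          by (auto intro!: integral_cong simp: fx[OF y])
        finally show ?thesis .
      qed
      then show "C_k_on k ?B (\<lambda>y. blinfun_apply (integral (cbox 0 1) (fx y)) v)"
        using Suc.IH[OF C_inf_on_frechet_derivative[OF Suc.prems], where n="Suc n"]
        by (subst C_k_on_cong) auto
    qed
  }
qed

text \<open>The fundamental theorem of calculus along the segment from \<open>p\<close> to
  \<open>y\<close>, with the derivative in direction \<open>y - p\<close> expanded in coordinates:
  \<open>G b\<close> is the mean of the partial derivative over the segment. Each summand is a
  product with a factor vanishing at \<open>p\<close>, the shape on which a derivation can be
  evaluated by the Leibniz rule.\<close>

lemma hadamard: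
  fixes F :: "'a::euclidean_space \<Rightarrow> real"
  assumes "C_inf_on (ball p \<rho>) F" "0 < \<rho>"
  obtains G where "\<And>b. C_inf_on (ball p \<rho>) (G b)"
    and "\<And>b. G b p = frechet_derivative F (at p) b"
    and "\<And>y. y \<in> ball p \<rho> \<Longrightarrow> F y = F p + (\<Sum>b\<in>Basis. ((y - p) \<bullet> b) * G b y)"
proof
  let ?F' = "\<lambda>y. frechet_derivative F (at y)"
  let ?G = "\<lambda>b y. integral {0..1} (\<lambda>t::real. t ^ 0 * ?F' (p + t *\<^sub>R (y - p)) b)"
  show "C_inf_on (ball p \<rho>) (?G b)" for b
    using C_k_on_segment_integral[OF C_inf_on_frechet_derivative[OF assms(1)], where n=0]
    unfolding C_inf_on_def by blast
  show "?G b p = ?F' p b" for b by simp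
  fix y assume y: "y \<in> ball p \<rho>"
  have seg: "p + t *\<^sub>R (y - p) \<in> ball p \<rho>" if "t \<in> {0..1}" for t :: real
    using segment_in_ball y that .
  have dF: "(F has_derivative ?F' z) (at z)" if "z \<in> ball p \<rho>" for z
    using C_inf_on_has_derivative[OF assms(1) that] .
  have int: "(\<lambda>t. ?F' (p + t *\<^sub>R (y - p)) b) integrable_on {0..1}" for b
    by (intro integrable_continuous_interval
        continuous_on_compose2[OF C_inf_on_continuous[OF C_inf_on_frechet_derivative[OF assms(1), of b]]])
       (use seg in \<open>auto intro!: continuous_intros\<close>)
  have lin: "?F' (p + t *\<^sub>R (y - p)) (y - p) = (\<Sum>b\<in>Basis. ((y - p) \<bullet> b) * ?F' (p + t *\<^sub>R (y - p)) b)"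
    if "t \<in> {0..1}" for t :: real
  proof -
    have l: "linear (?F' (p + t *\<^sub>R (y - p)))" using has_derivative_linear[OF dF[OF seg[OF that]]] .
    have "?F' (p + t *\<^sub>R (y - p)) (y - p) = ?F' (p + t *\<^sub>R (y - p)) (\<Sum>b\<in>Basis. ((y - p) \<bullet> b) *\<^sub>R b)"
      by (simp add: euclidean_representation)
    then show ?thesis by (simp add: linear_sum[OF l] linear_scale[OF l])
  qed
  have "((\<lambda>t. ?F' (p + t *\<^sub>R (y - p)) (y - p)) has_integral F (p + 1 *\<^sub>R (y - p)) - F (p + 0 *\<^sub>R (y - p))) {0..1}"
  proof (rule fundamental_theorem_of_calculus)
    fix t :: real assume t: "t \<in> {0..1}"
    have "((\<lambda>t. p + t *\<^sub>R (y - p)) has_derivative (\<lambda>s. s *\<^sub>R (y - p))) (at t)"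
      by (auto intro!: derivative_eq_intros)
    from diff_chain_at[OF this dF[OF seg[OF t]]]
    have "((\<lambda>t. F (p + t *\<^sub>R (y - p))) has_derivative (\<lambda>s. s *\<^sub>R ?F' (p + t *\<^sub>R (y - p)) (y - p))) (at t)"
      using linear_scale[OF has_derivative_linear[OF dF[OF seg[OF t]]]] by (simp add: comp_def)
    then show "((\<lambda>t. F (p + t *\<^sub>R (y - p))) has_vector_derivative ?F' (p + t *\<^sub>R (y - p)) (y - p)) (at t within {0..1})"
      unfolding has_vector_derivative_def by (rule has_derivative_at_withinI)
  qed simp
  then have "F y - F p = integral {0..1} (\<lambda>t. ?F' (p + t *\<^sub>R (y - p)) (y - p))"
    by (simp add: integral_unique)
  also have "\<dots> = integral {0..1} (\<lambda>t. \<Sum>b\<in>Basis. ((y - p) \<bullet> b) * ?F' (p + t *\<^sub>R (y - p)) b)"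
    using lin by (rule integral_cong)
  also have "\<dots> = (\<Sum>b\<in>Basis. ((y - p) \<bullet> b) * ?G b y)"
    using int by (simp add: integral_sum integrable_on_mult_right)
  finally show "F y = F p + (\<Sum>b\<in>Basis. ((y - p) \<bullet> b) * ?G b y)" by simp
qed

section \<open>Test functions\<close>

text \<open>The classical smooth function exp(-1/t), continued by zero. The powers of
  \<open>t\<close> in the denominator make the family closed under differentiation up to linear
  combinations, so that one induction yields smoothness of all members.\<close>

definition flat :: "nat \<Rightarrow> real \<Rightarrow> real" where
  "flat n t = (if t > 0 then exp (- (1 / t)) / t ^ n else 0)"

text \<open>The exponential series bounds exp(1/t) from below by its term of order
  \<open>n + 2\<close>. A bound quadratic in \<open>t\<close> is what makes the difference quotient
  at 0 tend to 0.\<close>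

lemma flat_le_square:
  assumes "t > 0"
  shows "flat n t \<le> fact (n + 2) * t\<^sup>2"
proof -
  have "exp (- (1 / t)) \<le> fact m * t ^ m" for m
  proof -
    have "(\<Sum>k\<in>{m}. (1 / t) ^ k / fact k) \<le> (\<Sum>k. (1 / t) ^ k / fact k)"
      using assms summable_exp_generic[of "1 / t"]
      by (intro sum_le_suminf) (auto simp: divide_inverse ac_simps)
    then have "(1 / t) ^ m / fact m \<le> exp (1 / t)" by (simp add: exp_def divide_inverse ac_simps)
    then show ?thesis using assms by (simp add: exp_minus power_one_over field_simps)
  qed
  from this[of "n + 2"] have "exp (- (1 / t)) / t ^ n \<le> fact (n + 2) * t ^ (n + 2) / t ^ n"
    using assms by (rule divide_right_mono[OF _ less_imp_le[OF zero_less_power]])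
  also have "\<dots> = fact (n + 2) * t\<^sup>2" using assms by (simp add: power_add power2_eq_square)
  finally show ?thesis using assms by (simp add: flat_def)
qed

lemma flat_has_derivative:
  "(flat n has_real_derivative (flat (n + 2) t - real n * flat (n + 1) t)) (at t)"
proof (cases t "0 :: real" rule: linorder_cases)
  case less
  have "((\<lambda>_. 0) has_real_derivative (flat (n + 2) t - real n * flat (n + 1) t)) (at t)"
    using less by (simp add: flat_def)
  then show ?thesis
    by (rule has_field_derivative_transform_within_open[where S="{..<0}"]) (use less in \<open>auto simp: flat_def\<close>)
next
  case greater
  have "((\<lambda>t. exp (- (1 / t)) / t ^ n) has_real_derivative
      ((exp (- (1 / t)) * (1 / t\<^sup>2)) * t ^ n - exp (- (1 / t)) * (real n * t ^ (n - 1))) / (t ^ n)\<^sup>2) (at t)"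
    using greater by (auto intro!: derivative_eq_intros simp: power2_eq_square)
  moreover have "((exp (- (1 / t)) * (1 / t\<^sup>2)) * t ^ n - exp (- (1 / t)) * (real n * t ^ (n - 1))) / (t ^ n)\<^sup>2
      = flat (n + 2) t - real n * flat (n + 1) t"
    using greater by (cases n) (simp_all add: flat_def field_simps power2_eq_square)
  ultimately have "((\<lambda>t. exp (- (1 / t)) / t ^ n) has_real_derivative
      (flat (n + 2) t - real n * flat (n + 1) t)) (at t)" by simp
  then show ?thesis
    by (rule has_field_derivative_transform_within_open[where S="{0<..}"])
       (use greater in \<open>auto simp: flat_def\<close>)
next
  case equal
  have "((\<lambda>h. flat n h / h) \<longlongrightarrow> 0) (at 0)"
  proof (rule Lim_null_comparison)
    have "norm (flat n h / h) \<le> fact (n + 2) * \<bar>h\<bar>" if "h \<noteq> 0" for h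
    proof (cases "h > 0")
      case True
      have "flat n h / h \<le> fact (n + 2) * h\<^sup>2 / h"
        using True flat_le_square[OF True, of n] by (intro divide_right_mono) auto
      moreover have "0 \<le> flat n h / h" using True by (simp add: flat_def)
      ultimately show ?thesis using True by (simp add: power2_eq_square)
    next
      case False
      then have "norm (flat n h / h) = 0" by (simp add: flat_def)
      then show ?thesis by (simp only:) simp
    qed
    then show "\<forall>\<^sub>F h in at 0. norm (flat n h / h) \<le> fact (n + 2) * \<bar>h\<bar>"
      by (auto simp: eventually_at_filter)
    show "((\<lambda>h::real. fact (n + 2) * \<bar>h\<bar>) \<longlongrightarrow> 0) (at 0)"
      by (auto intro!: tendsto_eq_intros)
  qed
  then show ?thesis using equal by (simp add: DERIV_def flat_def)
qed

lemma flat_C_inf: "C_inf_on UNIV (flat n)"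
  unfolding C_inf_on_def
proof
  fix k show "C_k_on k UNIV (flat n)"
  proof (induction k arbitrary: n)
    case 0
    have "isCont (flat n) t" for t using flat_has_derivative DERIV_isCont by blast
    then show ?case by (simp add: continuous_at_imp_continuous_on)
  next
    case (Suc k)
    show ?case
    proof (rule C_k_on_SucI[where f'="\<lambda>t v. v *\<^sub>R (flat (n + 2) t + (- real n) *\<^sub>R flat (n + 1) t)"])
      show "(flat n has_derivative (\<lambda>v. v *\<^sub>R (flat (n + 2) t + - real n *\<^sub>R flat (n + 1) t))) (at t)" for t
        using flat_has_derivative[of n t] unfolding has_field_derivative_def
        by (rule has_derivative_eq_rhs) (auto simp: algebra_simps)
      show "C_k_on k UNIV (\<lambda>t. v *\<^sub>R (flat (n + 2) t + - real n *\<^sub>R flat (n + 1) t))" for v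
        using Suc.IH by (intro C_k_on_scaleR C_k_on_add C_k_on_const) auto
    qed simp
  qed
qed

lemma support_eq_0: "x \<notin> support f \<Longrightarrow> f x = 0"
  unfolding support_def using closure_subset[of "{x. f x \<noteq> 0}"] by blast

lemma support_subsetI: "closed K \<Longrightarrow> (\<And>x. x \<notin> K \<Longrightarrow> f x = 0) \<Longrightarrow> support f \<subseteq> K"
  unfolding support_def by (rule closure_minimal) auto

lemma closed_support: "closed (support f)"
  by (simp add: support_def)

lemma test_function_mono: "test_function S \<eta> \<Longrightarrow> S \<subseteq> T \<Longrightarrow> test_function T \<eta>"
  by (auto simp: test_function_def)

lemma test_functionI:
  assumes "C_inf_on UNIV \<eta>" "compact K" "K \<subseteq> S" "\<And>x. x \<notin> K \<Longrightarrow> \<eta> x = 0"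
  shows "test_function S \<eta>"
proof -
  have "support \<eta> \<subseteq> K" using assms by (intro support_subsetI compact_imp_closed)
  then show ?thesis
    using assms closed_support[of \<eta>] compact_Int_closed[of K "support \<eta>"] by (auto simp: test_function_def Int_absorb1)
qed

lemma test_function_continuous: "test_function S \<eta> \<Longrightarrow> continuous_on UNIV \<eta>"
  by (simp add: test_function_def C_inf_on_continuous)

lemma test_function_eq_0: "test_function S \<eta> \<Longrightarrow> y \<notin> S \<Longrightarrow> \<eta> y = 0"
  using support_eq_0 by (fastforce simp: test_function_def)

text \<open>The factor \<open>a\<close> may be arbitrary off \<open>S\<close>: the product is smooth
  on \<open>S\<close> and zero on the complement of the support, and these two open sets cover the
  space. Chart coefficients can thus be multiplied in without being extended.\<close>

lemma test_function_mult:
  assumes "open S" "C_inf_on S a" "test_function S \<eta>"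
  shows "test_function S (\<lambda>y. a y * \<eta> y)"
proof (rule test_functionI)
  have "C_inf_on S \<eta>" using assms(3) C_inf_on_mono by (auto simp: test_function_def)
  then have "C_inf_on S (\<lambda>y. a y * \<eta> y)" by (rule C_inf_on_mult[OF assms(1,2)])
  moreover have "C_inf_on (- support \<eta>) (\<lambda>y. a y * \<eta> y)"
    using C_inf_on_const[of "- support \<eta>" "0::real"] closed_support[of \<eta>]
    by (subst C_inf_on_cong[where g="\<lambda>_. 0"]) (auto simp: support_eq_0)
  ultimately have "C_inf_on (S \<union> - support \<eta>) (\<lambda>y. a y * \<eta> y)"
    using assms(1) closed_support[of \<eta>] by (intro C_inf_on_Un) auto
  moreover have "S \<union> - support \<eta> = UNIV" using assms(3) by (auto simp: test_function_def)
  ultimately show "C_inf_on UNIV (\<lambda>y. a y * \<eta> y)" by simp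
qed (use assms in \<open>auto simp: test_function_def support_eq_0\<close>)

lemma test_function_frechet_derivative:
  assumes "test_function S \<eta>"
  shows "test_function S (\<lambda>y. frechet_derivative \<eta> (at y) v)"
proof (rule test_functionI)
  show "C_inf_on UNIV (\<lambda>y. frechet_derivative \<eta> (at y) v)"
    using assms by (simp add: test_function_def C_inf_on_frechet_derivative)
  fix y assume y: "y \<notin> support \<eta>"
  have "((\<lambda>_. 0) has_derivative (\<lambda>_. 0)) (at y)" by simp
  then have "(\<eta> has_derivative (\<lambda>_. 0)) (at y)"
    by (rule has_derivative_transform_within_open[where s="- support \<eta>"])
       (use y closed_support[of \<eta>] in \<open>auto simp: support_eq_0\<close>)
  from frechet_derivative_at[OF this] show "frechet_derivative \<eta> (at y) v = 0" by metis
qed (use assms in \<open>auto simp: test_function_def\<close>)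

lemma test_function_add:
  assumes "test_function S \<eta>" "test_function S \<zeta>"
  shows "test_function S (\<lambda>y. \<eta> y + \<zeta> y)"
  by (rule test_functionI[where K="support \<eta> \<union> support \<zeta>"])
     (use assms in \<open>auto simp: test_function_def C_inf_on_add support_eq_0\<close>)

lemma test_function_zero: "test_function S (\<lambda>_. 0)"
  by (rule test_functionI[where K="{}"]) (auto simp: C_inf_on_const)

lemma test_function_sum:
  assumes "\<And>i. i \<in> I \<Longrightarrow> test_function S (\<eta> i)"
  shows "test_function S (\<lambda>y. \<Sum>i\<in>I. \<eta> i y)"
  using assms
  by (induction I rule: infinite_finite_induct) (auto intro: test_function_zero test_function_add)

lemma test_function_minus:
  assumes "test_function S \<eta>"
  shows "test_function S (\<lambda>y. - \<eta> y)"
  using test_function_mult[OF open_UNIV C_inf_on_const[OF open_UNIV, of "-1"] test_function_mono[OF assms]] assms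
  by (auto simp: test_function_def support_def)

lemma continuous_times_test:
  fixes u :: "'a::euclidean_space \<Rightarrow> 'b::real_normed_algebra_1"
  assumes "open S" "continuous_on S u" "test_function S \<eta>"
  shows "continuous_on UNIV (\<lambda>y. u y * of_real (\<eta> y))"
    and "support (\<lambda>y. u y * of_real (\<eta> y)) \<subseteq> support \<eta>"
    and "compact (support (\<lambda>y. u y * of_real (\<eta> y)))"
proof -
  have "continuous_on S (\<lambda>y. u y * of_real (\<eta> y))"
    using assms(2) continuous_on_subset[OF test_function_continuous[OF assms(3)], of S]
    by (auto intro!: continuous_intros)
  moreover have "continuous_on (- support \<eta>) (\<lambda>y. u y * of_real (\<eta> y))"
    by (subst continuous_on_cong[where g="\<lambda>_. 0"]) (auto simp: support_eq_0)
  ultimately have "continuous_on (S \<union> - support \<eta>) (\<lambda>y. u y * of_real (\<eta> y))"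
    using assms(1) closed_support[of \<eta>] by (intro continuous_on_open_Un) auto
  moreover have "S \<union> - support \<eta> = UNIV" using assms(3) by (auto simp: test_function_def)
  ultimately show "continuous_on UNIV (\<lambda>y. u y * of_real (\<eta> y))" by simp
  show sub: "support (\<lambda>y. u y * of_real (\<eta> y)) \<subseteq> support \<eta>"
    by (rule support_subsetI[OF closed_support]) (simp add: support_eq_0)
  show "compact (support (\<lambda>y. u y * of_real (\<eta> y)))"
    using compact_Int_closed[OF _ closed_support, of "support \<eta>" "\<lambda>y. u y * of_real (\<eta> y)"] sub assms(3)
    by (simp add: test_function_def Int_absorb1)
qed

section \<open>Integration against test functions\<close>

lemma integrable_compact_support:
  fixes f :: "'a::euclidean_space \<Rightarrow> 'b::{banach, second_countable_topology}"
  assumes "continuous_on UNIV f" "compact (support f)"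
  shows "integrable lborel f"
proof -
  have "integrable lborel (\<lambda>x. indicator (support f) x *\<^sub>R f x)"
    using assms continuous_on_subset by (intro borel_integrable_compact) auto
  also have "(\<lambda>x. indicator (support f) x *\<^sub>R f x) = f"
    by (auto simp: indicator_def support_eq_0)
  finally show ?thesis .
qed

lemma integral_compact_support:
  fixes f :: "'a::euclidean_space \<Rightarrow> 'b::euclidean_space"
  assumes "continuous_on UNIV f" "compact (support f)" "support f \<subseteq> cbox a b"
  shows "integral (cbox a b) f = (\<integral>x. f x \<partial>lborel)"
proof -
  have "integral (cbox a b) f = integral UNIV (\<lambda>x. if x \<in> cbox a b then f x else 0)"
    by (simp add: integral_restrict_UNIV)
  also have "(\<lambda>x. if x \<in> cbox a b then f x else 0) = f"
    using assms(3) support_eq_0[of _ f] by (intro ext) auto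
  finally show ?thesis by (simp add: integral_lborel integrable_compact_support assms)
qed

lemma integrable_times_test:
  fixes u :: "'a::euclidean_space \<Rightarrow> 'b::{real_normed_algebra_1, banach, second_countable_topology}"
  assumes "open S" "continuous_on S u" "test_function S \<eta>"
  shows "integrable lborel (\<lambda>y. u y * of_real (\<eta> y))"
  using continuous_times_test[OF assms] by (intro integrable_compact_support) auto

lemma integrable_times_test_real:
  fixes u :: "'a::euclidean_space \<Rightarrow> real"
  assumes "open S" "continuous_on S u" "test_function S \<eta>"
  shows "integrable lborel (\<lambda>y. u y * \<eta> y)"
  using integrable_times_test[OF assms] by simp

lemma test_function_integrable:
  assumes "test_function S \<eta>"
  shows "integrable lborel \<eta>"
  using assms integrable_compact_support[OF test_function_continuous[OF assms]] by (simp add: test_function_def)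

lemma bump_function:
  fixes p :: "'a::euclidean_space"
  assumes "0 < \<delta>"
  obtains \<eta> where "test_function UNIV \<eta>" "\<And>y. 0 \<le> \<eta> y" "support \<eta> \<subseteq> cball p \<delta>" "(\<integral>y. \<eta> y \<partial>lborel) = 1"
proof -
  \<comment> \<open>This is \<open>\<delta>\<^sup>2 - (norm (y - p))\<^sup>2\<close>, positive
    exactly on the open ball. In coordinates it is a polynomial, so its smoothness follows from the
    rules for sums and products.\<close>
  define q where "q y = \<delta>\<^sup>2 - (\<Sum>b\<in>Basis. ((y - p) \<bullet> b) * ((y - p) \<bullet> b))" for y
  have q: "q y = \<delta>\<^sup>2 - (norm (y - p))\<^sup>2" for y
    by (simp add: q_def dot_square_norm[symmetric] euclidean_inner[of "y - p" "y - p"])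
  define \<eta> where "\<eta> = flat 0 \<circ> q"
  have pos: "0 < q y \<longleftrightarrow> y \<in> ball p \<delta>" for y
    using assms power2_less_imp_less[of "norm (y - p)" \<delta>] power_strict_mono[of "norm (y - p)" \<delta> 2]
    by (auto simp: q dist_norm norm_minus_commute)
  have nz: "\<eta> y \<noteq> 0 \<longleftrightarrow> y \<in> ball p \<delta>" for y
    using pos[of y] by (auto simp: \<eta>_def flat_def)
  have "C_inf_on UNIV q"
    unfolding q_def
    by (intro C_inf_on_diff C_inf_on_sum C_inf_on_mult C_inf_on_inner_left C_inf_on_const C_inf_on_ident open_UNIV)
  then have smooth: "C_inf_on UNIV \<eta>"
    unfolding \<eta>_def by (intro C_inf_on_compose[OF _ _ flat_C_inf]) auto
  have z: "\<eta> y = 0" if "y \<notin> cball p \<delta>" for y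
    using nz[of y] that ball_subset_cball[of p \<delta>] by blast
  have tf: "test_function UNIV \<eta>"
    by (rule test_functionI[OF smooth compact_cball subset_UNIV z])
  have nonneg: "0 \<le> \<eta> y" for y by (simp add: \<eta>_def flat_def)
  have "(\<integral>y. \<eta> y \<partial>lborel) \<noteq> 0"
  proof
    assume "(\<integral>y. \<eta> y \<partial>lborel) = 0"
    then have "AE y in lborel. \<eta> y = 0"
      using integral_nonneg_eq_0_iff_AE[OF test_function_integrable[OF tf]] nonneg by simp
    then have "AE y in lborel. y \<notin> ball p \<delta>" by (rule AE_mp) (use nz in \<open>auto intro!: AE_I2\<close>)
    then have "ball p \<delta> \<in> null_sets lborel" by (subst AE_iff_null_sets) auto
    then show False using content_ball_pos[OF assms, of p] by (simp add: measure_def null_setsD1)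
  qed
  moreover have "0 \<le> (\<integral>y. \<eta> y \<partial>lborel)" using nonneg by simp
  ultimately have I: "0 < (\<integral>y. \<eta> y \<partial>lborel)" by linarith
  define c where "c = 1 / (\<integral>y. \<eta> y \<partial>lborel)"
  show ?thesis
  proof
    show "test_function UNIV (\<lambda>y. c * \<eta> y)"
      using tf by (intro test_function_mult C_inf_on_const open_UNIV)
    show "0 \<le> c * \<eta> y" for y using nonneg I by (simp add: c_def)
    show "support (\<lambda>y. c * \<eta> y) \<subseteq> cball p \<delta>"
      by (rule support_subsetI[OF closed_cball]) (simp add: z)
    show "(\<integral>y. c * \<eta> y \<partial>lborel) = 1" using I by (simp add: c_def)
  qed
qed

section \<open>Recovering values of a continuous function from averages\<close>

lemma integral_bump_approx:
  fixes u :: "'a::euclidean_space \<Rightarrow> real"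
  assumes "integrable lborel (\<lambda>y. u y * \<eta> y)" "integrable lborel \<eta>"
    and "\<And>y. 0 \<le> \<eta> y" "(\<integral>y. \<eta> y \<partial>lborel) = 1"
    and "\<And>y. \<eta> y \<noteq> 0 \<Longrightarrow> \<bar>u y - m\<bar> \<le> \<epsilon>"
  shows "\<bar>(\<integral>y. u y * \<eta> y \<partial>lborel) - m\<bar> \<le> \<epsilon>"
proof -
  have "(\<integral>y. u y * \<eta> y \<partial>lborel) - m = (\<integral>y. u y * \<eta> y - m * \<eta> y \<partial>lborel)"
    using assms(1,2,4) by simp
  also have "\<bar>\<dots>\<bar> \<le> (\<integral>y. \<bar>u y * \<eta> y - m * \<eta> y\<bar> \<partial>lborel)"
    using integral_norm_bound[of lborel "\<lambda>y. u y * \<eta> y - m * \<eta> y"] by simp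
  also have "\<dots> \<le> (\<integral>y. \<epsilon> * \<eta> y \<partial>lborel)"
  proof (rule integral_mono)
    fix y
    have "\<bar>u y * \<eta> y - m * \<eta> y\<bar> = \<bar>u y - m\<bar> * \<eta> y"
      using assms(3)[of y] by (simp add: left_diff_distrib[symmetric] abs_mult)
    then show "\<bar>u y * \<eta> y - m * \<eta> y\<bar> \<le> \<epsilon> * \<eta> y"
      using assms(3)[of y] assms(5)[of y] by (cases "\<eta> y = 0") (auto intro: mult_right_mono)
  qed (use assms in auto)
  finally show ?thesis using assms(4) by simp
qed

lemma continuous_bound_cball:
  fixes u :: "'a::metric_space \<Rightarrow> real"
  assumes "open S" "continuous_on S u" "y \<in> S" "0 < \<epsilon>"
  obtains \<delta> where "0 < \<delta>" "cball y \<delta> \<subseteq> S" "\<And>z. z \<in> cball y \<delta> \<Longrightarrow> \<bar>u z - u y\<bar> \<le> \<epsilon>"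
proof -
  obtain d where d: "0 < d" "cball y d \<subseteq> S" using assms by (meson open_contains_cball)
  have "isCont u y" using assms by (simp add: continuous_on_eq_continuous_at)
  then obtain d' where d': "0 < d'" "\<And>z. dist z y < d' \<Longrightarrow> dist (u z) (u y) < \<epsilon>"
    using assms(4) by (auto simp: continuous_at_eps_delta)
  show ?thesis
  proof
    show "0 < min d (d' / 2)" using d d' by simp
    show "cball y (min d (d' / 2)) \<subseteq> S" using d by auto
    show "\<bar>u z - u y\<bar> \<le> \<epsilon>" if "z \<in> cball y (min d (d' / 2))" for z
      using that d'(2)[of z] d'(1) by (simp add: dist_real_def dist_commute)
  qed
qed

text \<open>If \<open>u y\<close> were nonzero, a bump of integral 1 placed where \<open>u\<close>
  differs from \<open>u y\<close> by at most half of \<open>\<bar>u y\<bar>\<close> would give an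
  integral within that distance of \<open>u y\<close>, hence nonzero.\<close>

lemma fundamental_lemma:
  fixes u :: "'a::euclidean_space \<Rightarrow> real"
  assumes "open S" "continuous_on S u"
    and "\<And>\<eta>. test_function S \<eta> \<Longrightarrow> (\<integral>y. u y * \<eta> y \<partial>lborel) = 0"
    and "y \<in> S"
  shows "u y = 0"
proof (rule ccontr)
  assume "u y \<noteq> 0"
  then have "0 < \<bar>u y\<bar> / 2" by simp
  from continuous_bound_cball[OF assms(1,2,4) this] obtain \<delta> where
    \<delta>: "0 < \<delta>" "cball y \<delta> \<subseteq> S" "\<And>z. z \<in> cball y \<delta> \<Longrightarrow> \<bar>u z - u y\<bar> \<le> \<bar>u y\<bar> / 2" by blast
  from bump_function[OF \<delta>(1), of y] obtain \<eta> where
    \<eta>: "test_function UNIV \<eta>" "\<And>y. 0 \<le> \<eta> y" "support \<eta> \<subseteq> cball y \<delta>" "(\<integral>y. \<eta> y \<partial>lborel) = 1" by blast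
  have tf: "test_function S \<eta>" using \<eta>(1,3) \<delta>(2) by (auto simp: test_function_def)
  have "\<bar>(\<integral>y. u y * \<eta> y \<partial>lborel) - u y\<bar> \<le> \<bar>u y\<bar> / 2"
  proof (rule integral_bump_approx)
    show "\<bar>u z - u y\<bar> \<le> \<bar>u y\<bar> / 2" if "\<eta> z \<noteq> 0" for z
      using \<delta>(3)[of z] that support_eq_0[of z \<eta>] \<eta>(3) by blast
  qed (use \<eta> tf integrable_times_test_real[OF assms(1,2)] test_function_integrable in auto)
  with assms(3)[OF tf] \<open>u y \<noteq> 0\<close> show False by simp
qed

section \<open>Translations and differentiation under the integral sign\<close>

lemma integral_lborel_translate:
  fixes f :: "'a::euclidean_space \<Rightarrow> real"
  assumes "continuous_on UNIV f"
  shows "(\<integral>y. f (y + w) \<partial>lborel) = (\<integral>y. f y \<partial>lborel)"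
proof -
  have "(\<integral>y. f y \<partial>lborel) = (\<integral>y. f y \<partial>distr lborel borel ((+) w))"
    by (simp add: lborel_distr_plus)
  also have "\<dots> = (\<integral>y. f (w + y) \<partial>lborel)"
    using assms by (intro integral_distr) (auto intro: borel_measurable_continuous_onI)
  finally show ?thesis by (simp add: add.commute)
qed

lemma DERIV_line:
  fixes F :: "'a::real_normed_vector \<Rightarrow> real"
  assumes "(F has_derivative F') (at (y + t *\<^sub>R v))"
  shows "((\<lambda>t. F (y + t *\<^sub>R v)) has_real_derivative F' v) (at t)"
proof -
  have "((\<lambda>t. y + t *\<^sub>R v) has_derivative (\<lambda>s. s *\<^sub>R v)) (at t)"
    by (auto intro!: derivative_eq_intros)
  from diff_chain_at[OF this assms] show ?thesis
    using linear_scale[OF has_derivative_linear[OF assms]]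
    by (simp add: comp_def has_field_derivative_def mult_commute_abs)
qed

text \<open>The translation sits on \<open>\<eta>\<close> because \<open>u\<close> is merely
  continuous; over a compact box, joint continuity of the integrand's derivative justifies
  differentiating inside.\<close>

lemma leibniz_line:
  fixes u \<eta> :: "'a::euclidean_space \<Rightarrow> real"
  assumes "continuous_on (cbox a b) u" "C_inf_on UNIV \<eta>"
  shows "((\<lambda>t. integral (cbox a b) (\<lambda>y. u y * \<eta> (y + t *\<^sub>R v))) has_real_derivative
           integral (cbox a b) (\<lambda>y. u y * frechet_derivative \<eta> (at (y + t *\<^sub>R v)) v)) (at t)"
proof (rule leibniz_rule_field_derivative[where U=UNIV, simplified])
  have c: "continuous_on (UNIV \<times> cbox a b) (\<lambda>z. u (snd z) * \<zeta> (snd z + fst z *\<^sub>R v))"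
    if "C_inf_on UNIV \<zeta>" for \<zeta> :: "'a \<Rightarrow> real"
    by (intro continuous_intros continuous_on_compose2[OF assms(1)]
        continuous_on_compose2[OF C_inf_on_continuous[OF that]]) auto
  show "continuous_on (UNIV \<times> cbox a b) (\<lambda>(t, y). u y * frechet_derivative \<eta> (at (y + t *\<^sub>R v)) v)"
    using c[OF C_inf_on_frechet_derivative[OF assms(2)]] by (simp add: split_beta)
  show "(\<lambda>y. u y * \<eta> (y + t *\<^sub>R v)) integrable_on cbox a b" for t
    by (intro integrable_continuous continuous_intros assms(1)
        continuous_on_compose2[OF C_inf_on_continuous[OF assms(2)]]) auto
  show "((\<lambda>t. u y * \<eta> (y + t *\<^sub>R v)) has_real_derivative u y * frechet_derivative \<eta> (at (y + t *\<^sub>R v)) v) (at t)" for t y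
    by (intro DERIV_cmult DERIV_line C_inf_on_has_derivative[OF assms(2)]) simp
qed

text \<open>By translation invariance the integral of \<open>\<eta> (y + t *\<^sub>R v)\<close> does
  not depend on \<open>t\<close>; its derivative at \<open>t = 0\<close> is the integral in
  question. All integrations by parts rest on this.\<close>

lemma integral_test_derivative_eq_0:
  assumes "test_function S \<eta>"
  shows "(\<integral>y. frechet_derivative \<eta> (at y) v \<partial>lborel) = 0"
proof -
  have tf: "test_function UNIV \<eta>" using assms test_function_mono by blast
  obtain R where R: "\<And>y. y \<in> support \<eta> \<Longrightarrow> norm y \<le> R"
    using assms compact_imp_bounded by (fastforce simp: test_function_def bounded_iff)
  \<comment> \<open>One box that contains the supports of all translates with
    \<open>\<bar>t\<bar> < 1\<close>, so that integrals over the box and over the whole space agree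
    for those \<open>t\<close>.\<close>
  obtain a :: 'a where a: "cball 0 (R + norm v) \<subseteq> cbox (-a) a"
    using bounded_subset_cbox_symmetric bounded_cball by metis
  have sub: "support (\<lambda>y. \<zeta> (y + t *\<^sub>R v)) \<subseteq> cbox (-a) a"
    if "\<bar>t\<bar> < 1" "support \<zeta> \<subseteq> support \<eta>" for t and \<zeta> :: "'a \<Rightarrow> real"
  proof (rule support_subsetI)
    fix y assume "y \<notin> cbox (-a) a"
    then have "R + norm v < norm y" using a by force
    moreover have "norm (t *\<^sub>R v) \<le> norm v" using that(1) by (simp add: mult_left_le_one_le)
    ultimately have "R < norm (y + t *\<^sub>R v)"
      using norm_triangle_ineq4[of "y + t *\<^sub>R v" "t *\<^sub>R v"] by simp
    then show "\<zeta> (y + t *\<^sub>R v) = 0" using R that(2) by (intro support_eq_0) force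
  qed (rule closed_cbox)
  have eq: "integral (cbox (-a) a) (\<lambda>y. \<zeta> (y + t *\<^sub>R v)) = (\<integral>y. \<zeta> y \<partial>lborel)"
    if "\<bar>t\<bar> < 1" "support \<zeta> \<subseteq> support \<eta>" "continuous_on UNIV \<zeta>" for t and \<zeta> :: "'a \<Rightarrow> real"
  proof -
    have "integral (cbox (-a) a) (\<lambda>y. \<zeta> (y + t *\<^sub>R v)) = (\<integral>y. \<zeta> (y + t *\<^sub>R v) \<partial>lborel)"
    proof (rule integral_compact_support)
      show "continuous_on UNIV (\<lambda>y. \<zeta> (y + t *\<^sub>R v))"
        by (intro continuous_on_compose2[OF that(3)] continuous_intros) auto
      show s: "support (\<lambda>y. \<zeta> (y + t *\<^sub>R v)) \<subseteq> cbox (-a) a" by (rule sub[OF that(1,2)])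
      show "compact (support (\<lambda>y. \<zeta> (y + t *\<^sub>R v)))"
        using compact_Int_closed[OF compact_cbox closed_support, of "-a" a "\<lambda>y. \<zeta> (y + t *\<^sub>R v)"] s
        by (simp add: Int_absorb1)
    qed
    then show ?thesis using integral_lborel_translate[OF that(3)] by simp
  qed
  have "((\<lambda>t. integral (cbox (-a) a) (\<lambda>y. 1 * \<eta> (y + t *\<^sub>R v))) has_real_derivative
      integral (cbox (-a) a) (\<lambda>y. 1 * frechet_derivative \<eta> (at (y + 0 *\<^sub>R v)) v)) (at 0)"
    using tf by (intro leibniz_line) (auto simp: test_function_def)
  then have "integral (cbox (-a) a) (\<lambda>y. 1 * frechet_derivative \<eta> (at (y + 0 *\<^sub>R v)) v) = 0"
    by (rule DERIV_local_const[where d=1])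
       (use eq[of _ \<eta>] eq[of 0 \<eta>] test_function_continuous[OF tf] in auto)
  moreover have "support (\<lambda>y. frechet_derivative \<eta> (at y) v) \<subseteq> support \<eta>"
    using test_function_frechet_derivative[of "support \<eta>" \<eta> v] assms by (auto simp: test_function_def)
  ultimately show ?thesis
    using eq[of 0 "\<lambda>y. frechet_derivative \<eta> (at y) v"]
      test_function_continuous[OF test_function_frechet_derivative[OF tf]] by simp
qed

text \<open>Testing against a bump \<open>\<eta>\<close> moved along a segment, \<open>\<Phi> t = \<integral> u(y) \<eta>(y - t v) dy\<close>
  has derivative \<open>\<integral> w(y) \<eta>(y - t v) dy\<close>; the mean value theorem then controls the increments
  of \<open>u\<close> itself, since the bump may be arbitrarily narrow.\<close>

lemma weak_derivative_increment:
  fixes u w :: "'a::euclidean_space \<Rightarrow> real"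
  assumes S: "open S" and u: "continuous_on S u" and w: "continuous_on S w"
    and weak: "\<And>\<eta>. test_function S \<eta> \<Longrightarrow>
      (\<integral>y. w y * \<eta> y \<partial>lborel) = - (\<integral>y. u y * frechet_derivative \<eta> (at y) v \<partial>lborel)"
    and R: "cball p R \<subseteq> cbox a b" "cbox a b \<subseteq> S" "norm v < R"
    and w_bound: "\<And>y. y \<in> cball p R \<Longrightarrow> \<bar>w y - m\<bar> \<le> \<epsilon>"
  shows "\<bar>u (p + v) - u p - m\<bar> \<le> \<epsilon>"
proof (rule field_le_epsilon)
  fix e :: real assume "0 < e"
  then have e: "0 < e / 2" by simp
  have cb: "cball p R \<subseteq> S" using R by blast
  have "p \<in> cball p R" "p + v \<in> cball p R"
    using R(3) norm_ge_zero[of v] by (simp_all add: dist_norm del: norm_ge_zero)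
  then have p: "p \<in> S" "p + v \<in> S" using cb by blast+
  obtain d1 where d1: "0 < d1" "cball p d1 \<subseteq> S" "\<And>z. z \<in> cball p d1 \<Longrightarrow> \<bar>u z - u p\<bar> \<le> e / 2"
    using continuous_bound_cball[OF S u p(1) e] by metis
  obtain d2 where d2: "0 < d2" "cball (p + v) d2 \<subseteq> S" "\<And>z. z \<in> cball (p + v) d2 \<Longrightarrow> \<bar>u z - u (p + v)\<bar> \<le> e / 2"
    using continuous_bound_cball[OF S u p(2) e] by metis
  \<comment> \<open>So narrow that \<open>u\<close> varies by at most \<open>e / 2\<close> around
    both end points, and that the bump, carried along the segment, never leaves
    \<open>cball p R\<close>, where \<open>w\<close> is controlled.\<close>
  define \<delta> where "\<delta> = min (min d1 d2) (R - norm v)"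
  have \<delta>: "0 < \<delta>" "\<delta> \<le> d1" "\<delta> \<le> d2" "\<delta> + norm v \<le> R" using d1(1) d2(1) R(3) by (auto simp: \<delta>_def)
  obtain \<eta> where \<eta>: "test_function UNIV \<eta>" "\<And>y. 0 \<le> \<eta> y" "support \<eta> \<subseteq> cball p \<delta>"
    "(\<integral>y. \<eta> y \<partial>lborel) = 1" using bump_function[OF \<delta>(1), of p] by metis
  have smooth: "C_inf_on UNIV \<eta>" using \<eta>(1) by (simp add: test_function_def)
  have d\<eta>: "(\<eta> has_derivative frechet_derivative \<eta> (at y)) (at y)" for y
    using C_inf_on_has_derivative[OF smooth] by simp
  define \<sigma> where "\<sigma> = (\<lambda>t y. \<eta> (y + t *\<^sub>R (- v)))"
  have \<sigma>_ball: "y \<in> cball (p + t *\<^sub>R v) \<delta>" if "\<sigma> t y \<noteq> 0" for t y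
  proof -
    have "y + t *\<^sub>R (- v) \<in> cball p \<delta>"
      using that \<eta>(3) support_eq_0[of "y + t *\<^sub>R (- v)" \<eta>] unfolding \<sigma>_def by blast
    then show ?thesis by (simp add: dist_norm algebra_simps)
  qed
  have in_R: "y \<in> cball p R" if "t \<in> {0..1}" "y \<in> cball (p + t *\<^sub>R v) \<delta>" for t y
  proof -
    have "dist p y \<le> dist p (p + t *\<^sub>R v) + dist (p + t *\<^sub>R v) y" by (rule dist_triangle)
    moreover have "dist p (p + t *\<^sub>R v) \<le> norm v" using that(1) by (simp add: dist_norm mult_left_le_one_le)
    ultimately show ?thesis using that(2) \<delta>(4) by simp
  qed
  have tf: "test_function S (\<sigma> t)" and sub: "support (\<sigma> t) \<subseteq> cball p R" if "t \<in> {0..1}" for t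
  proof -
    have "C_inf_on UNIV (\<eta> \<circ> (\<lambda>y. y + t *\<^sub>R (- v)))"
      by (intro C_inf_on_compose[OF _ _ smooth] C_inf_on_add C_inf_on_ident C_inf_on_const) auto
    also have "\<eta> \<circ> (\<lambda>y. y + t *\<^sub>R (- v)) = \<sigma> t" by (simp add: \<sigma>_def fun_eq_iff)
    finally have "C_inf_on UNIV (\<sigma> t)" .
    then show "test_function S (\<sigma> t)"
      by (rule test_functionI[OF _ compact_cball cb]) (use \<sigma>_ball in_R[OF that] in blast)
    show "support (\<sigma> t) \<subseteq> cball p R"
      by (rule support_subsetI[OF closed_cball]) (use \<sigma>_ball in_R[OF that] in blast)
  qed
  have int: "(\<integral>y. \<sigma> t y \<partial>lborel) = 1" for t
    using integral_lborel_translate[OF test_function_continuous[OF \<eta>(1)]] \<eta>(4) unfolding \<sigma>_def by metis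
  have d\<sigma>: "frechet_derivative (\<sigma> t) (at y) = frechet_derivative \<eta> (at (y + t *\<^sub>R (- v)))" for t y
  proof -
    have "((\<lambda>y. y + t *\<^sub>R (- v)) has_derivative (\<lambda>h. h)) (at y)"
      by (auto intro!: derivative_eq_intros)
    from diff_chain_at[OF this d\<eta>] show ?thesis
      by (intro frechet_derivative_at[symmetric]) (simp add: \<sigma>_def comp_def)
  qed
  define \<Phi> where "\<Phi> t = integral (cbox a b) (\<lambda>y. u y * \<sigma> t y)" for t
  have box: "integral (cbox a b) (\<lambda>y. f y * \<zeta> y) = (\<integral>y. f y * \<zeta> y \<partial>lborel)"
    if "continuous_on S f" "test_function S \<zeta>" "support \<zeta> \<subseteq> cball p R" for f \<zeta> :: "'a \<Rightarrow> real"
    using continuous_times_test[OF S that(1,2)] that(3) R(1)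
    by (intro integral_compact_support) auto
  have "(\<Phi> has_real_derivative (\<integral>y. w y * \<sigma> t y \<partial>lborel)) (at t)" if t: "t \<in> {0..1}" for t
  proof -
    have "(\<Phi> has_real_derivative integral (cbox a b) (\<lambda>y. u y * frechet_derivative \<eta> (at (y + t *\<^sub>R (- v))) (- v))) (at t)"
      unfolding \<Phi>_def \<sigma>_def by (rule leibniz_line[OF continuous_on_subset[OF u R(2)] smooth])
    also have "(\<lambda>y. u y * frechet_derivative \<eta> (at (y + t *\<^sub>R (- v))) (- v))
        = (\<lambda>y. - (u y * frechet_derivative (\<sigma> t) (at y) v))"
      unfolding d\<sigma> using linear_neg[OF has_derivative_linear[OF d\<eta>]] by simp
    also have "integral (cbox a b) \<dots> = - integral (cbox a b) (\<lambda>y. u y * frechet_derivative (\<sigma> t) (at y) v)"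
      by (rule integral_neg)
    also have "\<dots> = - (\<integral>y. u y * frechet_derivative (\<sigma> t) (at y) v \<partial>lborel)"
      using test_function_frechet_derivative[OF tf[OF t], of v]
        test_function_frechet_derivative[of "support (\<sigma> t)" "\<sigma> t" v] tf[OF t] sub[OF t]
      by (subst box[OF u]) (auto simp: test_function_def)
    also have "\<dots> = (\<integral>y. w y * \<sigma> t y \<partial>lborel)" using weak[OF tf[OF t]] by simp
    finally show ?thesis .
  qed
  then obtain \<tau> where \<tau>: "0 < \<tau>" "\<tau> < 1" "\<Phi> 1 - \<Phi> 0 = (1 - 0) * (\<integral>y. w y * \<sigma> \<tau> y \<partial>lborel)"
    using MVT2[of 0 1 \<Phi> "\<lambda>t. \<integral>y. w y * \<sigma> t y \<partial>lborel"] by auto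
  have approx: "\<bar>(\<integral>y. f y * \<sigma> t y \<partial>lborel) - c\<bar> \<le> \<epsilon>'"
    if "continuous_on S f" "t \<in> {0..1}" "\<And>y. y \<in> cball (p + t *\<^sub>R v) \<delta> \<Longrightarrow> \<bar>f y - c\<bar> \<le> \<epsilon>'" for f t c \<epsilon>'
    by (rule integral_bump_approx)
       (use that \<sigma>_ball int \<eta>(2) integrable_times_test_real[OF S that(1) tf[OF that(2)]]
          test_function_integrable[OF tf[OF that(2)]] in \<open>auto simp: \<sigma>_def\<close>)
  have \<Phi>: "\<Phi> t = (\<integral>y. u y * \<sigma> t y \<partial>lborel)" if "t \<in> {0..1}" for t
    unfolding \<Phi>_def using box[OF u tf[OF that] sub[OF that]] .
  have "\<bar>\<Phi> 1 - \<Phi> 0 - m\<bar> \<le> \<epsilon>"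
    unfolding \<tau>(3) using \<tau>(1,2) in_R[of \<tau>] w_bound by (simp, intro approx[OF w]) auto
  moreover have "\<bar>\<Phi> 0 - u p\<bar> \<le> e / 2"
    using d1(3) \<delta>(2) by (subst \<Phi>, simp, intro approx[OF u]) auto
  moreover have "\<bar>\<Phi> 1 - u (p + v)\<bar> \<le> e / 2"
    using d2(3) \<delta>(3) by (subst \<Phi>, simp, intro approx[OF u]) auto
  ultimately show "\<bar>u (p + v) - u p - m\<bar> \<le> \<epsilon> + e" by linarith
qed

text \<open>The increment estimate with \<open>m = w p \<bullet> v\<close> and \<epsilon> equal to
  \<open>e * norm v\<close> is precisely the remainder estimate in the definition of the derivative;
  continuity of \<open>w\<close> at \<open>p\<close> provides the radius on which \<open>w\<close>
  stays within \<open>e\<close> of \<open>w p\<close>.\<close>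

lemma weak_gradient_has_derivative:
  fixes u :: "'a::euclidean_space \<Rightarrow> real" and w :: "'a \<Rightarrow> 'a"
  assumes S: "open S" and u: "continuous_on S u" and w: "\<And>b. b \<in> Basis \<Longrightarrow> continuous_on S (\<lambda>y. w y \<bullet> b)"
    and weak: "\<And>\<eta> b. test_function S \<eta> \<Longrightarrow> b \<in> Basis \<Longrightarrow>
      (\<integral>y. (w y \<bullet> b) * \<eta> y \<partial>lborel) = - (\<integral>y. u y * frechet_derivative \<eta> (at y) b \<partial>lborel)"
    and p: "p \<in> S"
  shows "(u has_derivative (\<lambda>v. w p \<bullet> v)) (at p)"
proof -
  have expand: "w y \<bullet> v = (\<Sum>b\<in>Basis. (w y \<bullet> b) * (v \<bullet> b))" for y v
    by (rule euclidean_inner)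
  have cw: "continuous_on S (\<lambda>y. w y \<bullet> v)" for v
  proof -
    have "continuous_on S (\<lambda>y. \<Sum>b\<in>Basis. (w y \<bullet> b) * (v \<bullet> b))" by (intro continuous_intros w)
    then show ?thesis by (simp only: expand[symmetric])
  qed
  have cw': "continuous_on S w"
    using w by (subst continuous_on_componentwise) auto
  \<comment> \<open>The hypothesis covers basis directions, whereas the increment
    \<open>y - p\<close> points anywhere; both sides are linear in the direction.\<close>
  have weak': "(\<integral>y. (w y \<bullet> v) * \<eta> y \<partial>lborel) = - (\<integral>y. u y * frechet_derivative \<eta> (at y) v \<partial>lborel)"
    if \<eta>: "test_function S \<eta>" for \<eta> v
  proof -
    have l: "linear (frechet_derivative \<eta> (at y))" for y
      using C_inf_on_has_derivative[of UNIV \<eta> y] \<eta>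
      by (auto simp: test_function_def intro: has_derivative_linear)
    have d: "frechet_derivative \<eta> (at y) v = (\<Sum>b\<in>Basis. (v \<bullet> b) * frechet_derivative \<eta> (at y) b)" for y
      using linear_sum[OF l, of y "\<lambda>b. (v \<bullet> b) *\<^sub>R b" Basis] by (simp add: euclidean_representation linear_scale[OF l])
    have "(\<integral>y. (w y \<bullet> v) * \<eta> y \<partial>lborel) = (\<integral>y. (\<Sum>b\<in>Basis. (v \<bullet> b) * ((w y \<bullet> b) * \<eta> y)) \<partial>lborel)"
      by (intro Bochner_Integration.integral_cong refl, subst expand) (simp add: sum_distrib_left sum_distrib_right ac_simps)
    also have "\<dots> = (\<Sum>b\<in>Basis. (v \<bullet> b) * (\<integral>y. (w y \<bullet> b) * \<eta> y \<partial>lborel))"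
      using integrable_times_test_real[OF S w \<eta>] by (subst Bochner_Integration.integral_sum) auto
    also have "\<dots> = - (\<Sum>b\<in>Basis. (v \<bullet> b) * (\<integral>y. u y * frechet_derivative \<eta> (at y) b \<partial>lborel))"
      by (simp add: weak[OF \<eta>] sum_negf)
    also have "(\<Sum>b\<in>Basis. (v \<bullet> b) * (\<integral>y. u y * frechet_derivative \<eta> (at y) b \<partial>lborel))
        = (\<integral>y. (\<Sum>b\<in>Basis. (v \<bullet> b) * (u y * frechet_derivative \<eta> (at y) b)) \<partial>lborel)"
      using integrable_times_test_real[OF S u test_function_frechet_derivative[OF \<eta>]]
      by (subst Bochner_Integration.integral_sum) auto
    also have "\<dots> = (\<integral>y. u y * frechet_derivative \<eta> (at y) v \<partial>lborel)"
      by (simp add: d sum_distrib_left ac_simps)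
    finally show ?thesis .
  qed
  show ?thesis
    unfolding has_derivative_at_alt
  proof (intro conjI allI impI)
    show "bounded_linear (\<lambda>v. w p \<bullet> v)" by (rule bounded_linear_inner_right)
    fix e :: real assume e: "0 < e"
    obtain a b where ab: "cbox a b \<subseteq> S" "p \<in> box a b" using open_contains_cbox[OF S p] by metis
    obtain R1 where R1: "0 < R1" "cball p R1 \<subseteq> box a b"
      using ab(2) open_box open_contains_cball by metis
    have "isCont w p" using cw' S p by (simp add: continuous_on_eq_continuous_at)
    then obtain R2 where R2: "0 < R2" "\<And>z. dist z p < R2 \<Longrightarrow> dist (w z) (w p) < e"
      using e by (auto simp: continuous_at_eps_delta)
    define R where "R = min R1 (R2 / 2)"
    have R: "0 < R" "cball p R \<subseteq> cbox a b" using R1 R2 box_subset_cbox[of a b] by (auto simp: R_def subset_iff)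
    show "\<exists>d>0. \<forall>y. norm (y - p) < d \<longrightarrow> norm (u y - u p - w p \<bullet> (y - p)) \<le> e * norm (y - p)"
    proof (intro exI conjI allI impI)
      fix y assume "norm (y - p) < R"
      have "\<bar>u (p + (y - p)) - u p - w p \<bullet> (y - p)\<bar> \<le> e * norm (y - p)"
      proof (rule weak_derivative_increment[OF S u cw weak' R(2) ab(1) \<open>norm (y - p) < R\<close>])
        fix z assume "z \<in> cball p R"
        then have "dist z p < R2" using R2(1) by (simp add: R_def dist_commute)
        then have "norm (w z - w p) \<le> e" using R2(2) by (force simp: dist_norm)
        have "\<bar>w z \<bullet> (y - p) - w p \<bullet> (y - p)\<bar> \<le> norm (w z - w p) * norm (y - p)"
          by (metis Cauchy_Schwarz_ineq2 inner_diff_left)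
        also have "\<dots> \<le> e * norm (y - p)" using \<open>norm (w z - w p) \<le> e\<close> by (simp add: mult_right_mono)
        finally show "\<bar>w z \<bullet> (y - p) - w p \<bullet> (y - p)\<bar> \<le> e * norm (y - p)" .
      qed
      then show "norm (u y - u p - w p \<bullet> (y - p)) \<le> e * norm (y - p)" by simp
    qed (use R in auto)
  qed
qed

section \<open>Smooth functions and vector fields on manifolds\<close>

lemma smooth_on_mono: "smooth_on \<A> W f \<Longrightarrow> W' \<subseteq> W \<Longrightarrow> smooth_on \<A> W' f"
  unfolding smooth_on_def by (auto intro: C_inf_on_mono)

locale manifold =
  fixes \<A> :: "('m::{t2_space, second_countable_topology}, 'e::euclidean_space) chart set"
  assumes smooth_manifold: "smooth_manifold \<A>"
begin

lemma chart:
  assumes "c \<in> \<A>"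
  shows chart_dom_open: "open (fst c)" and chart_image_open: "open (chart_image c)"
    and chart_continuous: "continuous_on (fst c) (snd c)"
    and chart_inv_continuous: "continuous_on (chart_image c) (chart_inv c)"
    and chart_inv_chart: "x \<in> fst c \<Longrightarrow> chart_inv c (snd c x) = x"
    and chart_chart_inv: "y \<in> chart_image c \<Longrightarrow> snd c (chart_inv c y) = y"
    and chart_inv_in: "y \<in> chart_image c \<Longrightarrow> chart_inv c y \<in> fst c"
    and chart_in_image: "x \<in> fst c \<Longrightarrow> snd c x \<in> chart_image c"
proof -
  have "open (fst c)" "open (chart_image c)"
    and h: "homeomorphism (fst c) (chart_image c) (snd c) (chart_inv c)"
    using smooth_manifold assms by (auto simp: smooth_manifold_def)
  then show "open (fst c)" "open (chart_image c)" by auto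
  show "continuous_on (fst c) (snd c)" "continuous_on (chart_image c) (chart_inv c)"
    "x \<in> fst c \<Longrightarrow> chart_inv c (snd c x) = x" "y \<in> chart_image c \<Longrightarrow> snd c (chart_inv c y) = y"
    "y \<in> chart_image c \<Longrightarrow> chart_inv c y \<in> fst c" "x \<in> fst c \<Longrightarrow> snd c x \<in> chart_image c"
    using h by (auto simp: homeomorphism_def)
qed

lemma chart_cover: obtains c where "c \<in> \<A>" "x \<in> fst c"
  using smooth_manifold unfolding smooth_manifold_def by (metis UNIV_I UN_E)

lemma chart_image_Int:
  assumes "c \<in> \<A>"
  shows "snd c ` (fst c \<inter> W) = chart_image c \<inter> chart_inv c -` W"
  using chart[OF assms] by (force simp: chart_image_def)

lemma open_chart_image_Int:
  assumes "c \<in> \<A>" "open W"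
  shows "open (snd c ` (fst c \<inter> W))"
  unfolding chart_image_Int[OF assms(1)]
  by (rule continuous_open_preimage[OF chart_inv_continuous chart_image_open]) (use assms in auto)

lemma open_chart_preimage:
  assumes "c \<in> \<A>" "open T"
  shows "open (fst c \<inter> snd c -` T)"
  by (rule continuous_open_preimage[OF chart_continuous chart_dom_open]) (use assms in auto)

lemma transition_smooth:
  "c \<in> \<A> \<Longrightarrow> d \<in> \<A> \<Longrightarrow> C_inf_on (snd c ` (fst c \<inter> fst d)) (snd d \<circ> chart_inv c)"
  using smooth_manifold by (auto simp: smooth_manifold_def)

lemma smooth_on_chart:
  assumes "smooth_on \<A> W f" "c \<in> \<A>" "fst c \<subseteq> W"
  shows "C_inf_on (chart_image c) (f \<circ> chart_inv c)"
proof -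
  have "fst c \<inter> W = fst c" using assms(3) by blast
  with assms(1,2) show ?thesis by (metis chart_image_def smooth_on_def)
qed

lemma smooth_on_cong:
  assumes "open W" "\<And>x. x \<in> W \<Longrightarrow> f x = g x" "smooth_on \<A> W f"
  shows "smooth_on \<A> W g"
  unfolding smooth_on_def
proof
  fix c assume c: "c \<in> \<A>"
  have "C_inf_on (snd c ` (fst c \<inter> W)) (f \<circ> chart_inv c)" using assms(3) c by (simp add: smooth_on_def)
  moreover have "(f \<circ> chart_inv c) y = (g \<circ> chart_inv c) y" if "y \<in> snd c ` (fst c \<inter> W)" for y
    using that assms(2) by (simp add: chart_image_Int[OF c])
  ultimately show "C_inf_on (snd c ` (fst c \<inter> W)) (g \<circ> chart_inv c)"
    using C_inf_on_cong[OF open_chart_image_Int[OF c assms(1)], of "f \<circ> chart_inv c" "g \<circ> chart_inv c"] by blast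
qed

lemma smooth_on_const: "open W \<Longrightarrow> smooth_on \<A> W (\<lambda>x. k)"
  by (simp add: smooth_on_def comp_def C_inf_on_const open_chart_image_Int)

lemma smooth_on_add:
  "open W \<Longrightarrow> smooth_on \<A> W f \<Longrightarrow> smooth_on \<A> W g \<Longrightarrow> smooth_on \<A> W (\<lambda>x. f x + g x)"
  by (simp add: smooth_on_def comp_def C_inf_on_add open_chart_image_Int)

lemma smooth_on_mult:
  fixes f g :: "'m \<Rightarrow> real"
  shows "open W \<Longrightarrow> smooth_on \<A> W f \<Longrightarrow> smooth_on \<A> W g \<Longrightarrow> smooth_on \<A> W (\<lambda>x. f x * g x)"
  by (simp add: smooth_on_def comp_def C_inf_on_mult open_chart_image_Int)

lemma smooth_on_diff:
  "open W \<Longrightarrow> smooth_on \<A> W f \<Longrightarrow> smooth_on \<A> W g \<Longrightarrow> smooth_on \<A> W (\<lambda>x. f x - g x)"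
  by (simp add: smooth_on_def comp_def C_inf_on_diff open_chart_image_Int)

lemma smooth_on_bounded_linear:
  "open W \<Longrightarrow> bounded_linear L \<Longrightarrow> smooth_on \<A> W f \<Longrightarrow> smooth_on \<A> W (\<lambda>x. L (f x))"
  using C_inf_on_bounded_linear open_chart_image_Int unfolding smooth_on_def comp_def by blast

text \<open>Seen in another chart \<open>d\<close>, the function is \<open>F\<close> composed with a
  transition map. This is where the compatibility of charts is used.\<close>

lemma smooth_on_pullback:
  assumes c: "c \<in> \<A>" and T: "open T" and F: "C_inf_on T F"
  shows "smooth_on \<A> (fst c \<inter> snd c -` T) (F \<circ> snd c)"
  unfolding smooth_on_def
proof
  fix d assume d: "d \<in> \<A>"
  let ?W = "fst c \<inter> snd c -` T"
  have "C_inf_on (snd d ` (fst d \<inter> ?W)) (F \<circ> (snd c \<circ> chart_inv d))"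
  proof (rule C_inf_on_compose[OF open_chart_image_Int[OF d open_chart_preimage[OF c T]] T F])
    show "C_inf_on (snd d ` (fst d \<inter> ?W)) (snd c \<circ> chart_inv d)"
      by (rule C_inf_on_mono[OF transition_smooth[OF d c]]) blast
    show "(snd c \<circ> chart_inv d) ` snd d ` (fst d \<inter> ?W) \<subseteq> T"
      using chart_inv_chart[OF d] by auto
  qed
  then show "C_inf_on (snd d ` (fst d \<inter> ?W)) (F \<circ> snd c \<circ> chart_inv d)" by (simp add: comp_assoc)
qed

lemma smooth_on_pullback_dom:
  assumes c: "c \<in> \<A>" and F: "C_inf_on (chart_image c) F"
  shows "smooth_on \<A> (fst c) (F \<circ> snd c)"
proof -
  have "fst c \<inter> snd c -` chart_image c = fst c" using chart_in_image[OF c] by blast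
  then show ?thesis using smooth_on_pullback[OF c chart_image_open[OF c] F] by simp
qed

lemma smooth_on_coordinate:
  assumes "c \<in> \<A>" shows "smooth_on \<A> (fst c) (\<lambda>p. snd c p \<bullet> b)"
  using smooth_on_pullback_dom[OF assms, of "\<lambda>y. y \<bullet> b"] chart_image_open[OF assms]
  by (simp add: comp_def C_inf_on_inner_left C_inf_on_ident)

lemma smooth_nearI: "open W \<Longrightarrow> x \<in> W \<Longrightarrow> smooth_on \<A> W f \<Longrightarrow> smooth_near \<A> x f"
  by (auto simp: smooth_near_def)

lemma smooth_near_const: "smooth_near \<A> x (\<lambda>_. k)"
  using smooth_nearI[OF open_UNIV _ smooth_on_const] by blast

lemma smooth_near_common:
  assumes "smooth_near \<A> x f" "smooth_near \<A> x g"
  obtains W where "open W" "x \<in> W" "smooth_on \<A> W f" "smooth_on \<A> W g"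
proof -
  obtain U V where "open U" "x \<in> U" "smooth_on \<A> U f" "open V" "x \<in> V" "smooth_on \<A> V g"
    using assms by (auto simp: smooth_near_def)
  then show ?thesis
    using smooth_on_mono[of \<A> U f "U \<inter> V"] smooth_on_mono[of \<A> V g "U \<inter> V"] by (intro that[of "U \<inter> V"]) auto
qed

lemma smooth_near_add: "smooth_near \<A> x f \<Longrightarrow> smooth_near \<A> x g \<Longrightarrow> smooth_near \<A> x (\<lambda>y. f y + g y)"
  by (erule smooth_near_common) (auto intro: smooth_nearI smooth_on_add)

lemma smooth_near_mult:
  fixes f g :: "'m \<Rightarrow> real"
  shows "smooth_near \<A> x f \<Longrightarrow> smooth_near \<A> x g \<Longrightarrow> smooth_near \<A> x (\<lambda>y. f y * g y)"
  by (erule smooth_near_common) (auto intro: smooth_nearI smooth_on_mult)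

lemma smooth_near_sum:
  assumes "\<And>i. i \<in> I \<Longrightarrow> smooth_near \<A> x (f i)"
  shows "smooth_near \<A> x (\<lambda>y. \<Sum>i\<in>I. f i y)"
  using assms by (induction I rule: infinite_finite_induct) (auto intro: smooth_near_const smooth_near_add)

section \<open>Tangent vectors as derivations, and their coordinates\<close>

context
  fixes x :: 'm and v :: "'m tvec"
  assumes v: "v \<in> tangent_space \<A> x"
begin

lemma tangent_add: "smooth_near \<A> x f \<Longrightarrow> smooth_near \<A> x g \<Longrightarrow> v (\<lambda>y. f y + g y) = v f + v g"
  and tangent_mult: "smooth_near \<A> x f \<Longrightarrow> smooth_near \<A> x g \<Longrightarrow> v (\<lambda>y. f y * g y) = f x * v g + g x * v f"
  and tangent_scale: "smooth_near \<A> x f \<Longrightarrow> v (\<lambda>y. k * f y) = k * v f"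
  and tangent_not_smooth: "\<not> smooth_near \<A> x f \<Longrightarrow> v f = 0"
  using v by (auto simp: tangent_space_def)

lemma tangent_const: "v (\<lambda>_. k) = 0"
proof -
  have "v (\<lambda>y. 1 * 1) = 1 * v (\<lambda>_. 1) + 1 * v (\<lambda>_. 1)"
    by (rule tangent_mult) (auto intro: smooth_near_const)
  then have "v (\<lambda>_. 1) = 0" by simp
  then show ?thesis using tangent_scale[OF smooth_near_const, of k 1] by simp
qed

lemma tangent_sum:
  assumes "\<And>i. i \<in> I \<Longrightarrow> smooth_near \<A> x (f i)"
  shows "v (\<lambda>y. \<Sum>i\<in>I. f i y) = (\<Sum>i\<in>I. v (f i))"
  using assms
proof (induction I rule: infinite_finite_induct)
  case (insert i I)
  then have "v (\<lambda>y. f i y + (\<Sum>i\<in>I. f i y)) = v (f i) + v (\<lambda>y. \<Sum>i\<in>I. f i y)"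
    by (intro tangent_add smooth_near_sum) auto
  with insert show ?case by simp
qed (simp_all add: tangent_const)

text \<open>A function \<open>D\<close> vanishing on a neighbourhood \<open>W\<close> equals \<open>D\<close> times the indicator of \<open>- W\<close>,
  and both factors vanish at \<open>x\<close>.\<close>

lemma tangent_local:
  assumes "open W" "x \<in> W" "\<And>y. y \<in> W \<Longrightarrow> f y = g y"
  shows "v f = v g"
proof (cases "smooth_near \<A> x f")
  case True
  then obtain U where U: "open U" "x \<in> U" "smooth_on \<A> U f" by (auto simp: smooth_near_def)
  have f: "smooth_on \<A> (U \<inter> W) f" by (rule smooth_on_mono[OF U(3)]) auto
  have g: "smooth_on \<A> (U \<inter> W) g"
    by (rule smooth_on_cong[OF _ _ f]) (use assms U in auto)
  define D where "D = (\<lambda>y. f y - g y)"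
  define ind :: "'m \<Rightarrow> real" where "ind y = (if y \<in> W then 0 else 1)" for y
  \<comment> \<open>The indicator may jump at the boundary of \<open>W\<close>, but it is zero on
    \<open>W\<close> and hence smooth near \<open>x\<close>, so the Leibniz rule applies to
    it.\<close>
  have z: "smooth_near \<A> x h" if "\<And>y. y \<in> W \<Longrightarrow> h y = 0" for h :: "'m \<Rightarrow> real"
    using smooth_nearI[OF assms(1,2) smooth_on_cong[OF assms(1) _ smooth_on_const[OF assms(1), of "0::real"], of h]] that
    by simp
  have "v (\<lambda>y. D y * ind y) = D x * v ind + ind x * v D"
    by (rule tangent_mult) (auto intro!: z simp: D_def ind_def assms(3))
  also have "(\<lambda>y. D y * ind y) = D" using assms(3) by (auto simp: D_def ind_def)
  finally have "v D = 0" using assms(2,3) by (simp add: D_def ind_def)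
  moreover have "v (\<lambda>y. g y + D y) = v g + v D"
  proof (rule tangent_add)
    show "smooth_near \<A> x g" by (rule smooth_nearI[OF _ _ g]) (use assms U in auto)
    show "smooth_near \<A> x D" by (rule z) (simp add: D_def assms(3))
  qed
  ultimately show ?thesis by (simp add: D_def)
next
  case False
  have "\<not> smooth_near \<A> x g"
  proof
    assume "smooth_near \<A> x g"
    then obtain U where U: "open U" "x \<in> U" "smooth_on \<A> U g" by (auto simp: smooth_near_def)
    have g: "smooth_on \<A> (U \<inter> W) g" by (rule smooth_on_mono[OF U(3)]) auto
    have "smooth_on \<A> (U \<inter> W) f"
      by (rule smooth_on_cong[OF _ _ g]) (use assms U in auto)
    then show False using False U assms by (auto intro: smooth_nearI[of "U \<inter> W"])
  qed
  with False show ?thesis by (simp add: tangent_not_smooth)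
qed

text \<open>Near \<open>x\<close>, Hadamard's lemma writes \<open>f\<close> as a constant plus
  products of the centred coordinates with smooth functions \<open>G b\<close>. The Leibniz rule at
  \<open>x\<close> keeps only the terms in which \<open>v\<close> hits the coordinate, because the
  coordinate factor vanishes there, and \<open>G b\<close> at the centre is the partial
  derivative.\<close>

lemma tangent_in_chart:
  assumes c: "c \<in> \<A>" "x \<in> fst c" and f: "smooth_near \<A> x f"
  shows "v f = (\<Sum>b\<in>Basis. v (\<lambda>p. snd c p \<bullet> b) * frechet_derivative (f \<circ> chart_inv c) (at (snd c x)) b)"
proof -
  let ?F = "f \<circ> chart_inv c" and ?p = "snd c x"
  obtain W where W: "open W" "x \<in> W" "smooth_on \<A> W f" using f by (auto simp: smooth_near_def)
  have "?p \<in> snd c ` (fst c \<inter> W)" using W c by blast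
  then obtain \<rho> where \<rho>: "0 < \<rho>" "ball ?p \<rho> \<subseteq> snd c ` (fst c \<inter> W)"
    using open_chart_image_Int[OF c(1) W(1)] open_contains_ball by metis
  have "C_inf_on (ball ?p \<rho>) ?F"
    using W(3) c(1) by (auto simp: smooth_on_def intro: C_inf_on_mono[OF _ \<rho>(2)])
  from hadamard[OF this \<rho>(1)] obtain G where
    G: "\<And>b. C_inf_on (ball ?p \<rho>) (G b)" "\<And>b. G b ?p = frechet_derivative ?F (at ?p) b"
    and exp: "\<And>y. y \<in> ball ?p \<rho> \<Longrightarrow> ?F y = ?F ?p + (\<Sum>b\<in>Basis. ((y - ?p) \<bullet> b) * G b y)" by blast
  let ?V = "fst c \<inter> snd c -` ball ?p \<rho>"
  have V: "open ?V" "x \<in> ?V" using open_chart_preimage[OF c(1)] c \<rho>(1) by auto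
  have s1: "smooth_near \<A> x (G b \<circ> snd c)" for b
    by (rule smooth_nearI[OF V smooth_on_pullback[OF c(1) open_ball G(1)]])
  have s2: "smooth_near \<A> x (\<lambda>p. snd c p \<bullet> b)" for b
    by (rule smooth_nearI[OF chart_dom_open[OF c(1)] c(2) smooth_on_coordinate[OF c(1)]])
  have s3: "smooth_near \<A> x (\<lambda>p. snd c p \<bullet> b + - (?p \<bullet> b))" for b
    by (intro smooth_near_add s2 smooth_near_const)
  have summand: "v (\<lambda>q. (snd c q \<bullet> b + - (?p \<bullet> b)) * (G b \<circ> snd c) q)
      = v (\<lambda>p. snd c p \<bullet> b) * frechet_derivative ?F (at ?p) b" for b
  proof -
    have "v (\<lambda>q. (snd c q \<bullet> b + - (?p \<bullet> b)) * (G b \<circ> snd c) q)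
      = (G b \<circ> snd c) x * v (\<lambda>q. snd c q \<bullet> b + - (?p \<bullet> b))"
      by (subst tangent_mult[OF s3 s1]) simp
    also have "v (\<lambda>q. snd c q \<bullet> b + - (?p \<bullet> b)) = v (\<lambda>p. snd c p \<bullet> b)"
      by (subst tangent_add[OF s2 smooth_near_const]) (simp add: tangent_const)
    finally show ?thesis by (simp add: G(2))
  qed
  have "v f = v (\<lambda>q. f x + (\<Sum>b\<in>Basis. (snd c q \<bullet> b + - (?p \<bullet> b)) * (G b \<circ> snd c) q))"
  proof (rule tangent_local[OF V])
    fix q assume "q \<in> ?V"
    then have q: "q \<in> fst c" "snd c q \<in> ball ?p \<rho>" by auto
    show "f q = f x + (\<Sum>b\<in>Basis. (snd c q \<bullet> b + - (?p \<bullet> b)) * (G b \<circ> snd c) q)"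
      using exp[OF q(2)] chart_inv_chart[OF c(1) q(1)] chart_inv_chart[OF c(1,2)]
      by (simp add: inner_diff_left)
  qed
  also have "\<dots> = v (\<lambda>_. f x) + (\<Sum>b\<in>Basis. v (\<lambda>q. (snd c q \<bullet> b + - (?p \<bullet> b)) * (G b \<circ> snd c) q))"
    by (simp only: tangent_add[OF smooth_near_const smooth_near_sum] tangent_sum smooth_near_mult[OF s3 s1])
  finally show ?thesis by (simp only: summand tangent_const add_0)
qed

end

text \<open>The Hoermander condition yields fields with prescribed values in
  \<open>tangent_space\<close>; membership of the coordinate directions makes it possible to
  prescribe these.\<close>

lemma partial_in_tangent_space:
  assumes c: "c \<in> \<A>" "x \<in> fst c"
  shows "(\<lambda>f. if smooth_near \<A> x f then frechet_derivative (f \<circ> chart_inv c) (at (snd c x)) w else 0)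
    \<in> tangent_space \<A> x"
proof -
  let ?p = "snd c x"
  have D: "(f \<circ> chart_inv c has_derivative frechet_derivative (f \<circ> chart_inv c) (at ?p)) (at ?p)"
    if f: "smooth_near \<A> x f" for f :: "'m \<Rightarrow> real"
  proof -
    obtain W where W: "open W" "x \<in> W" "smooth_on \<A> W f" using f by (auto simp: smooth_near_def)
    then show ?thesis
      using c by (intro C_inf_on_has_derivative[of "snd c ` (fst c \<inter> W)"]) (auto simp: smooth_on_def)
  qed
  have x: "chart_inv c ?p = x" using c chart_inv_chart by blast
  {
    fix f g :: "'m \<Rightarrow> real" assume fg: "smooth_near \<A> x f" "smooth_near \<A> x g"
    have "((\<lambda>y. f y + g y) \<circ> chart_inv c has_derivative
      (\<lambda>w. frechet_derivative (f \<circ> chart_inv c) (at ?p) w + frechet_derivative (g \<circ> chart_inv c) (at ?p) w)) (at ?p)"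
      using has_derivative_add[OF D[OF fg(1)] D[OF fg(2)]] by (simp add: comp_def)
    from frechet_derivative_at[OF this, symmetric]
    have "frechet_derivative ((\<lambda>y. f y + g y) \<circ> chart_inv c) (at ?p) w
      = frechet_derivative (f \<circ> chart_inv c) (at ?p) w + frechet_derivative (g \<circ> chart_inv c) (at ?p) w" by (rule fun_cong)
    moreover
    have "((\<lambda>y. f y * g y) \<circ> chart_inv c has_derivative
      (\<lambda>w. f x * frechet_derivative (g \<circ> chart_inv c) (at ?p) w
         + frechet_derivative (f \<circ> chart_inv c) (at ?p) w * g x)) (at ?p)"
      using has_derivative_mult[OF D[OF fg(1)] D[OF fg(2)]] by (simp add: comp_def x)
    from frechet_derivative_at[OF this, symmetric]
    have "frechet_derivative ((\<lambda>y. f y * g y) \<circ> chart_inv c) (at ?p) w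
      = f x * frechet_derivative (g \<circ> chart_inv c) (at ?p) w + frechet_derivative (f \<circ> chart_inv c) (at ?p) w * g x"
      by (rule fun_cong)
    ultimately have "frechet_derivative ((\<lambda>y. f y + g y) \<circ> chart_inv c) (at ?p) w
      = frechet_derivative (f \<circ> chart_inv c) (at ?p) w + frechet_derivative (g \<circ> chart_inv c) (at ?p) w"
      "frechet_derivative ((\<lambda>y. f y * g y) \<circ> chart_inv c) (at ?p) w
      = f x * frechet_derivative (g \<circ> chart_inv c) (at ?p) w + g x * frechet_derivative (f \<circ> chart_inv c) (at ?p) w"
      by auto
  }
  note 1 = this
  have 2: "frechet_derivative ((\<lambda>y. k * f y) \<circ> chart_inv c) (at ?p) w
      = k * frechet_derivative (f \<circ> chart_inv c) (at ?p) w" if "smooth_near \<A> x f" for k and f :: "'m \<Rightarrow> real"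
  proof -
    have "((\<lambda>y. k * f y) \<circ> chart_inv c has_derivative
      (\<lambda>w. k * frechet_derivative (f \<circ> chart_inv c) (at ?p) w)) (at ?p)"
      using has_derivative_mult_right[OF D[OF that], of k] by (simp add: comp_def)
    from frechet_derivative_at[OF this, symmetric] show ?thesis by (rule fun_cong)
  qed
  have 3: "smooth_near \<A> x (\<lambda>y. k * f y)" if "smooth_near \<A> x f" for k and f :: "'m \<Rightarrow> real"
    by (rule smooth_near_mult[OF smooth_near_const that])
  show ?thesis unfolding tangent_space_def
    by (simp add: 1 2 3 smooth_near_add smooth_near_mult)
qed

section \<open>Smooth vector fields and their brackets\<close>

lemma smooth_vfield_tangent: "smooth_vfield \<A> Z \<Longrightarrow> Z x \<in> tangent_space \<A> x"
  by (simp add: smooth_vfield_def)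

lemma smooth_vfield_apply:
  "smooth_vfield \<A> Z \<Longrightarrow> open W \<Longrightarrow> smooth_on \<A> W f \<Longrightarrow> smooth_on \<A> W (vfield_apply Z f)"
  by (simp add: smooth_vfield_def)

lemma smooth_near_vfield_apply: "smooth_vfield \<A> Z \<Longrightarrow> smooth_near \<A> x f \<Longrightarrow> smooth_near \<A> x (vfield_apply Z f)"
  unfolding smooth_near_def using smooth_vfield_apply by blast

lemma smooth_vfield_zero: "smooth_vfield \<A> (\<lambda>x f. 0)"
  by (auto simp: smooth_vfield_def tangent_space_def vfield_apply_def smooth_on_const)

lemma smooth_vfield_add:
  assumes "smooth_vfield \<A> Y" "smooth_vfield \<A> Z"
  shows "smooth_vfield \<A> (\<lambda>x f. Y x f + Z x f)"
proof -
  note t = smooth_vfield_tangent[OF assms(1)] smooth_vfield_tangent[OF assms(2)]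
  have "(\<lambda>f. Y x f + Z x f) \<in> tangent_space \<A> x" for x
    using t(1)[of x] t(2)[of x] unfolding tangent_space_def by (simp add: algebra_simps)
  moreover have "smooth_on \<A> W (vfield_apply (\<lambda>x f. Y x f + Z x f) f)" if "open W" "smooth_on \<A> W f" for W f
    using smooth_on_add[OF that(1) smooth_vfield_apply[OF assms(1) that] smooth_vfield_apply[OF assms(2) that]]
    by (simp add: vfield_apply_def)
  ultimately show ?thesis by (simp add: smooth_vfield_def)
qed

lemma smooth_vfield_scale:
  assumes "smooth_vfield \<A> Z"
  shows "smooth_vfield \<A> (\<lambda>x f. k * Z x f)"
proof -
  have "(\<lambda>f. k * Z x f) \<in> tangent_space \<A> x" for x
    using smooth_vfield_tangent[OF assms, of x] unfolding tangent_space_def by (simp add: algebra_simps)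
  moreover have "smooth_on \<A> W (vfield_apply (\<lambda>x f. k * Z x f) f)" if "open W" "smooth_on \<A> W f" for W f
    using smooth_on_mult[OF that(1) smooth_on_const[OF that(1)] smooth_vfield_apply[OF assms that]]
    by (simp add: vfield_apply_def)
  ultimately show ?thesis by (simp add: smooth_vfield_def)
qed

text \<open>In \<open>Y (Z (f g))\<close> the mixed terms \<open>Y f * Z g + Z f * Y g\<close> are
  symmetric in the two fields, so they cancel in the commutator and the Leibniz rule survives. The
  algebraic rules for the inner field hold only where \<open>f\<close> and \<open>g\<close> are
  smooth, that is near \<open>x\<close>; \<open>tangent_local\<close> lets the outer field ignore
  the rest.\<close>

lemma smooth_vfield_bracket:
  assumes Y: "smooth_vfield \<A> Y" and Z: "smooth_vfield \<A> Z"
  shows "smooth_vfield \<A> (lie_bracket \<A> Y Z)"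
proof -
  have app: "U x (vfield_apply V (\<lambda>y. f y + g y)) = U x (vfield_apply V f) + U x (vfield_apply V g)"
     "U x (vfield_apply V (\<lambda>y. f y * g y))
      = f x * U x (vfield_apply V g) + V x g * U x f + (g x * U x (vfield_apply V f) + V x f * U x g)"
     "U x (vfield_apply V (\<lambda>y. k * f y)) = k * U x (vfield_apply V f)"
    if U: "smooth_vfield \<A> U" and V: "smooth_vfield \<A> V" and fg: "smooth_near \<A> x f" "smooth_near \<A> x g"
    for U V x f g k
  proof -
    obtain W where W: "open W" "x \<in> W" "smooth_on \<A> W f" "smooth_on \<A> W g"
      using smooth_near_common[OF fg] by metis
    have n: "smooth_near \<A> y f" "smooth_near \<A> y g" if "y \<in> W" for y
      using W that by (auto intro: smooth_nearI)
    note VT = smooth_vfield_tangent[OF V] and UT = smooth_vfield_tangent[OF U, of x]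
    have nV: "smooth_near \<A> x (vfield_apply V f)" "smooth_near \<A> x (vfield_apply V g)"
      using smooth_near_vfield_apply[OF V] fg by auto
    have "U x (vfield_apply V (\<lambda>y. f y + g y)) = U x (\<lambda>y. vfield_apply V f y + vfield_apply V g y)"
      by (rule tangent_local[OF UT W(1,2)]) (simp add: vfield_apply_def tangent_add[OF VT n])
    then show "U x (vfield_apply V (\<lambda>y. f y + g y)) = U x (vfield_apply V f) + U x (vfield_apply V g)"
      by (simp add: tangent_add[OF UT nV])
    have "U x (vfield_apply V (\<lambda>y. f y * g y))
        = U x (\<lambda>y. f y * vfield_apply V g y + g y * vfield_apply V f y)"
      by (rule tangent_local[OF UT W(1,2)]) (simp add: vfield_apply_def tangent_mult[OF VT n])
    then show "U x (vfield_apply V (\<lambda>y. f y * g y))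
      = f x * U x (vfield_apply V g) + V x g * U x f + (g x * U x (vfield_apply V f) + V x f * U x g)"
      using fg nV by (simp add: tangent_add[OF UT] tangent_mult[OF UT] smooth_near_mult vfield_apply_def)
    have "U x (vfield_apply V (\<lambda>y. k * f y)) = U x (\<lambda>y. k * vfield_apply V f y)"
      by (rule tangent_local[OF UT W(1,2)]) (simp add: vfield_apply_def tangent_scale[OF VT n(1)])
    then show "U x (vfield_apply V (\<lambda>y. k * f y)) = k * U x (vfield_apply V f)"
      by (simp add: tangent_scale[OF UT nV(1)])
  qed
  have "lie_bracket \<A> Y Z x \<in> tangent_space \<A> x" for x
  proof -
    have k: "smooth_near \<A> x (\<lambda>y. k * f y)" if "smooth_near \<A> x f" for k and f :: "'m \<Rightarrow> real"
      by (rule smooth_near_mult[OF smooth_near_const that])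
    show ?thesis
      unfolding tangent_space_def lie_bracket_def
      by (auto simp: app[OF Y Z] app[OF Z Y] smooth_near_add smooth_near_mult k algebra_simps)
  qed
  moreover have "smooth_on \<A> W (vfield_apply (lie_bracket \<A> Y Z) f)" if W: "open W" "smooth_on \<A> W f" for W f
  proof (rule smooth_on_cong[OF W(1)])
    show "smooth_on \<A> W (\<lambda>x. vfield_apply Y (vfield_apply Z f) x - vfield_apply Z (vfield_apply Y f) x)"
      using W by (intro smooth_on_diff smooth_vfield_apply Y Z)
    show "vfield_apply Y (vfield_apply Z f) x - vfield_apply Z (vfield_apply Y f) x = vfield_apply (lie_bracket \<A> Y Z) f x"
      if "x \<in> W" for x
      using smooth_nearI[OF W(1) that W(2)] by (simp add: vfield_apply_def lie_bracket_def)
  qed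
  ultimately show ?thesis by (simp add: smooth_vfield_def)
qed

lemma smooth_vfield_lie_generated:
  assumes "Z \<in> lie_generated \<A> \<X>" "\<And>X. X \<in> \<X> \<Longrightarrow> smooth_vfield \<A> X"
  shows "smooth_vfield \<A> Z"
  using assms(1)
  by induction (auto intro: assms(2) smooth_vfield_zero smooth_vfield_add smooth_vfield_scale smooth_vfield_bracket)

section \<open>Transposes and integration by parts in a chart\<close>

lemma coefficient_smooth:
  assumes "smooth_vfield \<A> Z" "c \<in> \<A>"
  shows "C_inf_on (chart_image c) (\<lambda>y. Z (chart_inv c y) (\<lambda>p. snd c p \<bullet> b))"
  using smooth_on_chart[OF smooth_vfield_apply[OF assms(1) chart_dom_open[OF assms(2)] smooth_on_coordinate[OF assms(2)]] assms(2)]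
  by (simp add: comp_def vfield_apply_def)

lemma test_function_transpose:
  assumes Z: "smooth_vfield \<A> Z" and c: "c \<in> \<A>" and \<eta>: "test_function (chart_image c) \<eta>"
  shows "test_function (chart_image c) (transpose_in_chart c Z \<eta>)"
  unfolding transpose_in_chart_def
  by (intro test_function_minus test_function_sum test_function_frechet_derivative
      test_function_mult chart_image_open coefficient_smooth c Z \<eta>)

text \<open>\<open>(Z f) \<eta> - f Z\<^sup>t\<eta>\<close> is the divergence of \<open>f \<eta> Z\<close>.\<close>

lemma integral_vfield_apply:
  assumes Z: "smooth_vfield \<A> Z" and c: "c \<in> \<A>" and f: "smooth_on \<A> (fst c) f"
    and \<eta>: "test_function (chart_image c) \<eta>"
  shows "(\<integral>y. vfield_apply Z f (chart_inv c y) * \<eta> y \<partial>lborel)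
    = (\<integral>y. f (chart_inv c y) * transpose_in_chart c Z \<eta> y \<partial>lborel)"
proof -
  let ?S = "chart_image c" and ?F = "f \<circ> chart_inv c"
  let ?a = "\<lambda>b y. Z (chart_inv c y) (\<lambda>p. snd c p \<bullet> b)"
  let ?h = "\<lambda>b y. ?a b y * \<eta> y"
  note S = chart_image_open[OF c]
  have F: "C_inf_on ?S ?F" by (rule smooth_on_chart[OF f c order_refl])
  have Zf: "C_inf_on ?S (vfield_apply Z f \<circ> chart_inv c)"
    by (rule smooth_on_chart[OF smooth_vfield_apply[OF Z chart_dom_open[OF c] f] c order_refl])
  have h: "test_function ?S (?h b)" for b
    by (rule test_function_mult[OF S coefficient_smooth[OF Z c] \<eta>])
  have Fh: "test_function ?S (\<lambda>y. ?F y * ?h b y)" for b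
    by (rule test_function_mult[OF S F h])
  \<comment> \<open>On the chart image this is the product rule for \<open>?F y * ?h b y\<close>,
    the terms that differentiate \<open>?F\<close> adding up to \<open>Z f\<close> by
    \<open>tangent_in_chart\<close>. Off the image every term vanishes together with a test
    function.\<close>
  have pw: "vfield_apply Z f (chart_inv c y) * \<eta> y - f (chart_inv c y) * transpose_in_chart c Z \<eta> y
      = (\<Sum>b\<in>Basis. frechet_derivative (\<lambda>y. ?F y * ?h b y) (at y) b)" for y
  proof (cases "y \<in> ?S")
    case True
    have dF: "(?F has_derivative frechet_derivative ?F (at y)) (at y)"
      by (rule C_inf_on_has_derivative[OF F True])
    have dh: "(?h b has_derivative frechet_derivative (?h b) (at y)) (at y)" for b
      using h[of b] C_inf_on_has_derivative[of UNIV "?h b" y] by (simp add: test_function_def)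
    have "frechet_derivative (\<lambda>y. ?F y * ?h b y) (at y)
        = (\<lambda>v. ?F y * frechet_derivative (?h b) (at y) v + frechet_derivative ?F (at y) v * ?h b y)" for b
      by (rule frechet_derivative_at[symmetric], rule has_derivative_mult[OF dF dh])
    then have "(\<Sum>b\<in>Basis. frechet_derivative (\<lambda>y. ?F y * ?h b y) (at y) b)
        = (\<Sum>b\<in>Basis. ?F y * frechet_derivative (?h b) (at y) b + frechet_derivative ?F (at y) b * ?h b y)"
      by simp
    also have "\<dots> = ?F y * (\<Sum>b\<in>Basis. frechet_derivative (?h b) (at y) b)
        + (\<Sum>b\<in>Basis. ?a b y * frechet_derivative ?F (at y) b) * \<eta> y"
      by (simp add: sum.distrib sum_distrib_left sum_distrib_right ac_simps)
    also have "(\<Sum>b\<in>Basis. ?a b y * frechet_derivative ?F (at y) b) = Z (chart_inv c y) f"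
      using tangent_in_chart[OF smooth_vfield_tangent[OF Z] c chart_inv_in[OF c True]
          smooth_nearI[OF chart_dom_open[OF c] chart_inv_in[OF c True] f]] chart_chart_inv[OF c True]
      by simp
    finally show ?thesis by (simp add: transpose_in_chart_def vfield_apply_def)
  next
    case False
    have "frechet_derivative (\<lambda>y. ?F y * ?h b y) (at y) b = 0" for b
      by (rule test_function_eq_0[OF test_function_frechet_derivative[OF Fh] False])
    then show ?thesis
      using False test_function_eq_0[OF \<eta>] test_function_eq_0[OF test_function_transpose[OF Z c \<eta>]] by simp
  qed
  have i1: "integrable lborel (\<lambda>y. vfield_apply Z f (chart_inv c y) * \<eta> y)"
    using integrable_times_test_real[OF S C_inf_on_continuous[OF Zf] \<eta>] by simp
  have i2: "integrable lborel (\<lambda>y. f (chart_inv c y) * transpose_in_chart c Z \<eta> y)"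
    using integrable_times_test_real[OF S C_inf_on_continuous[OF F] test_function_transpose[OF Z c \<eta>]] by simp
  have "(\<integral>y. vfield_apply Z f (chart_inv c y) * \<eta> y \<partial>lborel) - (\<integral>y. f (chart_inv c y) * transpose_in_chart c Z \<eta> y \<partial>lborel)
      = (\<integral>y. (\<Sum>b\<in>Basis. frechet_derivative (\<lambda>y. ?F y * ?h b y) (at y) b) \<partial>lborel)"
    by (subst Bochner_Integration.integral_diff[OF i1 i2, symmetric]) (simp only: pw)
  also have "\<dots> = (\<Sum>b\<in>Basis. (\<integral>y. frechet_derivative (\<lambda>y. ?F y * ?h b y) (at y) b \<partial>lborel))"
    by (rule Bochner_Integration.integral_sum) (rule test_function_integrable[OF test_function_frechet_derivative[OF Fh]])
  also have "\<dots> = 0" by (simp only: integral_test_derivative_eq_0[OF Fh] sum.neutral_const)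
  finally show ?thesis by simp
qed

text \<open>Duality: both sides have the same integrals against every test function, by
  integration by parts. This avoids any symmetry of second derivatives.\<close>

lemma transpose_bracket:
  assumes Y: "smooth_vfield \<A> Y" and Z: "smooth_vfield \<A> Z" and c: "c \<in> \<A>"
    and \<eta>: "test_function (chart_image c) \<eta>"
  shows "transpose_in_chart c (lie_bracket \<A> Y Z) \<eta> y
    = transpose_in_chart c Z (transpose_in_chart c Y \<eta>) y - transpose_in_chart c Y (transpose_in_chart c Z \<eta>) y"
proof -
  let ?S = "chart_image c" and ?B = "lie_bracket \<A> Y Z"
  let ?T = "transpose_in_chart c"
  note B = smooth_vfield_bracket[OF Y Z] and S = chart_image_open[OF c]
  note tf = test_function_transpose[OF _ c]
  let ?D = "\<lambda>y. ?T ?B \<eta> y - (?T Z (?T Y \<eta>) y - ?T Y (?T Z \<eta>) y)"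
  note t = tf[OF B \<eta>] tf[OF Z tf[OF Y \<eta>]] tf[OF Y tf[OF Z \<eta>]]
  have cD: "continuous_on ?S ?D"
    using t[THEN test_function_continuous] by (auto intro!: continuous_intros elim: continuous_on_subset)
  have orth: "(\<integral>y. ?D y * \<zeta> y \<partial>lborel) = 0" if \<zeta>: "test_function ?S \<zeta>" for \<zeta>
  proof -
    have \<zeta>S: "C_inf_on ?S \<zeta>" using \<zeta> C_inf_on_mono by (auto simp: test_function_def)
    \<comment> \<open>The second test function is carried to the manifold so that fields can act on
      it; \<open>integral_vfield_apply\<close> asks for smoothness on the chart domain only.\<close>
    define f where "f = \<zeta> \<circ> snd c"
    have f: "smooth_on \<A> (fst c) f" unfolding f_def by (rule smooth_on_pullback_dom[OF c \<zeta>S])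
    have fS: "f (chart_inv c y) = \<zeta> y" if "y \<in> ?S" for y
      using chart_chart_inv[OF c that] by (simp add: f_def)
    have fh: "(\<integral>y. f (chart_inv c y) * h y \<partial>lborel) = (\<integral>y. \<zeta> y * h y \<partial>lborel)" if "test_function ?S h" for h
      by (rule Bochner_Integration.integral_cong) (use fS test_function_eq_0[OF that] in force)+
    note sY = smooth_vfield_apply[OF Y chart_dom_open[OF c] f] and sZ = smooth_vfield_apply[OF Z chart_dom_open[OF c] f]
    have i: "integrable lborel (\<lambda>y. g (chart_inv c y) * \<eta> y)" if "smooth_on \<A> (fst c) g" for g :: "'m \<Rightarrow> real"
      using integrable_times_test_real[OF S C_inf_on_continuous[OF smooth_on_chart[OF that c order_refl]] \<eta>] by simp
    note sYZ = smooth_vfield_apply[OF Y chart_dom_open[OF c] sZ] and sZY = smooth_vfield_apply[OF Z chart_dom_open[OF c] sY]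
    have "(\<integral>y. \<zeta> y * ?T ?B \<eta> y \<partial>lborel) = (\<integral>y. vfield_apply ?B f (chart_inv c y) * \<eta> y \<partial>lborel)"
      by (simp add: integral_vfield_apply[OF B c f \<eta>] fh[OF tf[OF B \<eta>]])
    also have "\<dots> = (\<integral>y. vfield_apply Y (vfield_apply Z f) (chart_inv c y) * \<eta> y
        - vfield_apply Z (vfield_apply Y f) (chart_inv c y) * \<eta> y \<partial>lborel)"
    proof (rule Bochner_Integration.integral_cong[OF refl])
      fix y
      show "vfield_apply ?B f (chart_inv c y) * \<eta> y = vfield_apply Y (vfield_apply Z f) (chart_inv c y) * \<eta> y
        - vfield_apply Z (vfield_apply Y f) (chart_inv c y) * \<eta> y"
      proof (cases "y \<in> ?S")
        case True
        then show ?thesis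
          using smooth_nearI[OF chart_dom_open[OF c] chart_inv_in[OF c True] f]
          by (simp add: vfield_apply_def lie_bracket_def algebra_simps)
      qed (simp add: test_function_eq_0[OF \<eta>])
    qed
    \<comment> \<open>Transposition reverses the order: \<open>Y (Z f)\<close> against
      \<open>\<eta>\<close> becomes \<open>Z f\<close> against \<open>?T Y \<eta>\<close>, then
      \<open>f\<close> against \<open>?T Z (?T Y \<eta>)\<close>.\<close>
    also have "\<dots> = (\<integral>y. \<zeta> y * ?T Z (?T Y \<eta>) y \<partial>lborel) - (\<integral>y. \<zeta> y * ?T Y (?T Z \<eta>) y \<partial>lborel)"
      unfolding Bochner_Integration.integral_diff[OF i[OF sYZ] i[OF sZY]]
        integral_vfield_apply[OF Y c sZ \<eta>] integral_vfield_apply[OF Z c sY \<eta>]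
        integral_vfield_apply[OF Z c f tf[OF Y \<eta>]] integral_vfield_apply[OF Y c f tf[OF Z \<eta>]]
        fh[OF t(2)] fh[OF t(3)] by (rule refl)
    finally have eq: "(\<integral>y. \<zeta> y * ?T ?B \<eta> y \<partial>lborel)
        = (\<integral>y. \<zeta> y * ?T Z (?T Y \<eta>) y \<partial>lborel) - (\<integral>y. \<zeta> y * ?T Y (?T Z \<eta>) y \<partial>lborel)" .
    have "integrable lborel (\<lambda>y. \<zeta> y * h y)" if "test_function ?S h" for h
      by (rule integrable_times_test_real[OF S C_inf_on_continuous[OF \<zeta>S] that])
    note int = this[OF t(1)] this[OF t(2)] this[OF t(3)]
    have "(\<integral>y. ?D y * \<zeta> y \<partial>lborel) = (\<integral>y. \<zeta> y * ?T ?B \<eta> y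
        - (\<zeta> y * ?T Z (?T Y \<eta>) y - \<zeta> y * ?T Y (?T Z \<eta>) y) \<partial>lborel)"
      by (simp add: algebra_simps)
    also have "\<dots> = (\<integral>y. \<zeta> y * ?T ?B \<eta> y \<partial>lborel)
        - ((\<integral>y. \<zeta> y * ?T Z (?T Y \<eta>) y \<partial>lborel) - (\<integral>y. \<zeta> y * ?T Y (?T Z \<eta>) y \<partial>lborel))"
      using int by simp
    finally show ?thesis using eq by simp
  qed
  show ?thesis
  proof (cases "y \<in> ?S")
    case True
    from fundamental_lemma[OF S cD orth True] show ?thesis by simp
  next
    case False
    then show ?thesis using t[THEN test_function_eq_0] by simp
  qed
qed

end

section \<open>Smooth frames\<close>

lemma linear_combination: "linear (\<lambda>z. \<Sum>\<beta>\<in>Basis. (z \<bullet> \<beta>) *\<^sub>R a \<beta>)"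
  by (intro linear_compose_sum ballI linearI) (simp_all add: inner_add_left scaleR_add_left)

text \<open>A lower bound gives injectivity, and an injective endomorphism in finite dimension is
  invertible. Nondegeneracy of a frame is expressed by such a bound instead of a determinant
  because, uniform in the base point, it also controls how solutions of the linear system
  vary.\<close>

lemma coercive_isomorphism:
  fixes a :: "'e::euclidean_space \<Rightarrow> 'e"
  assumes "\<And>z. norm z \<le> 2 * norm (\<Sum>\<beta>\<in>Basis. (z \<bullet> \<beta>) *\<^sub>R a \<beta>)"
  obtains g where "linear g" "\<And>z. (\<Sum>\<beta>\<in>Basis. (g z \<bullet> \<beta>) *\<^sub>R a \<beta>) = z"
proof -
  have "inj (\<lambda>z. \<Sum>\<beta>\<in>Basis. (z \<bullet> \<beta>) *\<^sub>R a \<beta>)"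
    unfolding linear_injective_0[OF linear_combination]
  proof (intro allI impI)
    fix z assume "(\<Sum>\<beta>\<in>Basis. (z \<bullet> \<beta>) *\<^sub>R a \<beta>) = 0"
    with assms[of z] show "z = 0" by simp
  qed
  from linear_injective_isomorphism[OF linear_combination this refl] obtain g where
    "linear g" "\<forall>z. (\<Sum>\<beta>\<in>Basis. (g z \<bullet> \<beta>) *\<^sub>R a \<beta>) = z" by (elim exE conjE)
  then show ?thesis using that[of g] by simp
qed

text \<open>With \<open>L\<^sub>y z = \<Sum>\<^sub>\<beta> z\<^sub>\<beta> a\<^sub>\<beta>(y)\<close>, a solution of \<open>L\<^sub>y w(y) = q(y)\<close> satisfies
  \<open>L\<^sub>y (w(y) - w(p)) = q(y) - L\<^sub>y w(p)\<close>, whose right-hand side is differentiable at \<open>p\<close>.\<close>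

lemma linear_system_has_derivative:
  fixes a :: "'e::euclidean_space \<Rightarrow> 'e \<Rightarrow> 'e" and w q :: "'e \<Rightarrow> 'e"
  assumes N: "open N" "p \<in> N"
    and da: "\<And>\<beta>. \<beta> \<in> Basis \<Longrightarrow> (a \<beta> has_derivative a' \<beta>) (at p)"
    and dq: "(q has_derivative q') (at p)"
    and coercive: "\<And>y z. y \<in> N \<Longrightarrow> norm z \<le> 2 * norm (\<Sum>\<beta>\<in>Basis. (z \<bullet> \<beta>) *\<^sub>R a \<beta> y)"
    and eq: "\<And>y. y \<in> N \<Longrightarrow> (\<Sum>\<beta>\<in>Basis. (w y \<bullet> \<beta>) *\<^sub>R a \<beta> y) = q y"
  obtains D where "(w has_derivative D) (at p)"
    and "\<And>v. (\<Sum>\<beta>\<in>Basis. (D v \<bullet> \<beta>) *\<^sub>R a \<beta> p) = q' v - (\<Sum>\<beta>\<in>Basis. (w p \<bullet> \<beta>) *\<^sub>R a' \<beta> v)"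
proof -
  define L where "L y z = (\<Sum>\<beta>\<in>Basis. (z \<bullet> \<beta>) *\<^sub>R a \<beta> y)" for y z
  have L: "linear (L y)" for y unfolding L_def by (rule linear_combination)
  define r where "r y = q y - L y (w p)" for y
  define r' where "r' v = q' v - (\<Sum>\<beta>\<in>Basis. (w p \<bullet> \<beta>) *\<^sub>R a' \<beta> v)" for v
  have dr: "(r has_derivative r') (at p)"
    unfolding r_def r'_def L_def
    by (intro has_derivative_diff dq has_derivative_sum has_derivative_scaleR_right da)
  obtain g where g: "linear g" "\<And>z. L p (g z) = z"
    by (rule coercive_isomorphism[OF coercive[OF N(2)]]) (simp add: L_def)
  define D where "D v = g (r' v)" for v
  have LD: "L p (D v) = r' v" for v by (simp add: D_def g)
  have linD: "linear D"
    unfolding D_def using linear_compose[OF has_derivative_linear[OF dr] g(1)] by (simp add: comp_def)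
  then have blD: "bounded_linear D" by (simp add: linear_conv_bounded_linear)
  obtain K where K: "\<And>v. norm (D v) \<le> K * norm v" using bounded_linear.bounded[OF blD] by (metis mult.commute)
  have rp: "r p = 0" using eq[OF N(2)] by (simp add: r_def L_def)
  let ?s = "\<lambda>h. \<Sum>\<beta>\<in>Basis. norm (a \<beta> (p + h) - a \<beta> p)"
  \<comment> \<open>Applied to \<open>w (p + h) - w p - D h\<close>, the map
    \<open>L (p + h)\<close> yields the first-order remainder of \<open>r\<close> minus the change
    of \<open>L\<close> between \<open>p\<close> and \<open>p + h\<close>, evaluated at
    \<open>D h\<close>. Coercivity turns the bound on this image into a bound on the vector.\<close>
  have est: "norm (w (p + h) - w p - D h) \<le> 2 * (norm (r (p + h) - r p - r' h) + K * norm h * ?s h)"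
    if "p + h \<in> N" for h
  proof -
    let ?d = "w (p + h) - w p - D h"
    have "L (p + h) ?d = L (p + h) (w (p + h)) - L (p + h) (w p) - L (p + h) (D h)"
      by (simp add: linear_diff[OF L])
    also have "L (p + h) (w (p + h)) = q (p + h)" using eq[OF that] by (simp add: L_def)
    finally have Ld: "L (p + h) ?d = (r (p + h) - r p - r' h) - (L (p + h) (D h) - L p (D h))"
      by (simp add: r_def[of "p + h"] rp LD)
    have "L (p + h) (D h) - L p (D h) = (\<Sum>\<beta>\<in>Basis. (D h \<bullet> \<beta>) *\<^sub>R (a \<beta> (p + h) - a \<beta> p))"
      by (simp add: L_def sum_subtractf scaleR_diff_right)
    also have "norm \<dots> \<le> (\<Sum>\<beta>\<in>Basis. norm ((D h \<bullet> \<beta>) *\<^sub>R (a \<beta> (p + h) - a \<beta> p)))" by (rule norm_sum)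
    also have "\<dots> \<le> (\<Sum>\<beta>\<in>Basis. (K * norm h) * norm (a \<beta> (p + h) - a \<beta> p))"
    proof (rule sum_mono)
      fix \<beta> :: 'e assume "\<beta> \<in> Basis"
      then have "\<bar>D h \<bullet> \<beta>\<bar> \<le> K * norm h" using Basis_le_norm K order_trans by metis
      then show "norm ((D h \<bullet> \<beta>) *\<^sub>R (a \<beta> (p + h) - a \<beta> p)) \<le> K * norm h * norm (a \<beta> (p + h) - a \<beta> p)"
        by (simp add: mult_right_mono)
    qed
    finally have "norm (L (p + h) (D h) - L p (D h)) \<le> K * norm h * ?s h" by (simp add: sum_distrib_left)
    then have "norm (L (p + h) ?d) \<le> norm (r (p + h) - r p - r' h) + K * norm h * ?s h"
      unfolding Ld by (rule order_trans[OF norm_triangle_ineq4 add_left_mono])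
    then have "2 * norm (L (p + h) ?d) \<le> 2 * (norm (r (p + h) - r p - r' h) + K * norm h * ?s h)"
      by (rule mult_left_mono) simp
    with coercive[OF that, of ?d] show ?thesis unfolding L_def[symmetric] by (rule order_trans)
  qed
  have "(\<lambda>h. norm (w (p + h) - w p - D h) / norm h) \<midarrow>0\<rightarrow> 0"
  proof (rule tendsto_sandwich[OF _ _ tendsto_const])
    have "open ((\<lambda>h. p + h) -` N)" using N(1) by (intro open_vimage continuous_intros)
    then have "\<forall>\<^sub>F h in at 0. p + h \<in> N"
      using N(2) by (auto simp: eventually_at_topological intro!: exI[of _ "(\<lambda>h. p + h) -` N"])
    then show "\<forall>\<^sub>F h in at 0. norm (w (p + h) - w p - D h) / norm h
        \<le> 2 * (norm (r (p + h) - r p - r' h) / norm h + K * ?s h)"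
      using eventually_neq_at_within[of 0 0 UNIV]
    proof eventually_elim
      case (elim h)
      then have "norm (w (p + h) - w p - D h) / norm h
          \<le> 2 * (norm (r (p + h) - r p - r' h) + K * norm h * ?s h) / norm h"
        by (intro divide_right_mono est) auto
      with elim show ?case by (simp add: field_simps)
    qed
    have "(\<lambda>h. norm (r (p + h) - r p - r' h) / norm h) \<midarrow>0\<rightarrow> 0"
      using dr by (simp add: has_derivative_at)
    moreover have "?s \<midarrow>0\<rightarrow> (\<Sum>\<beta>\<in>(Basis :: 'e set). 0)"
    proof (rule tendsto_sum)
      fix \<beta> :: 'e assume "\<beta> \<in> Basis"
      then have "isCont (a \<beta>) p" using da has_derivative_continuous by blast
      then have "(\<lambda>h. a \<beta> (p + h)) \<midarrow>0\<rightarrow> a \<beta> p" by (simp add: isCont_iff)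
      then show "(\<lambda>h. norm (a \<beta> (p + h) - a \<beta> p)) \<midarrow>0\<rightarrow> 0"
        using LIM_zero tendsto_norm_zero by blast
    qed
    ultimately have "(\<lambda>h. 2 * (norm (r (p + h) - r p - r' h) / norm h + K * ?s h)) \<midarrow>0\<rightarrow> 2 * (0 + K * (\<Sum>\<beta>\<in>(Basis :: 'e set). 0))"
      by (intro tendsto_mult tendsto_add tendsto_const)
    then show "(\<lambda>h. 2 * (norm (r (p + h) - r p - r' h) / norm h + K * ?s h)) \<midarrow>0\<rightarrow> 0" by simp
  qed simp
  then have "(w has_derivative D) (at p)" using blD by (simp add: has_derivative_at)
  then show ?thesis using that LD unfolding L_def r'_def by blast
qed

text \<open>Differentiating the system shows that \<open>D y v\<close> solves one with the same
  matrix, whose right-hand side involves the derivative of \<open>q\<close> and \<open>w\<close>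
  itself. This right-hand side has one class less than \<open>q\<close>, so induction on
  \<open>k\<close> applies and no formula for the inverse matrix is required.\<close>

lemma linear_system_C_k:
  fixes a :: "'e::euclidean_space \<Rightarrow> 'e \<Rightarrow> 'e" and w q :: "'e \<Rightarrow> 'e"
  assumes N: "open N" and a: "\<And>\<beta>. \<beta> \<in> Basis \<Longrightarrow> C_inf_on N (a \<beta>)"
    and coercive: "\<And>y z. y \<in> N \<Longrightarrow> norm z \<le> 2 * norm (\<Sum>\<beta>\<in>Basis. (z \<bullet> \<beta>) *\<^sub>R a \<beta> y)"
    and "\<And>y. y \<in> N \<Longrightarrow> (\<Sum>\<beta>\<in>Basis. (w y \<bullet> \<beta>) *\<^sub>R a \<beta> y) = q y"
    and "C_k_on (Suc k) N q"
  shows "C_k_on (Suc k) N w"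
  using assms(4,5)
proof (induction k arbitrary: w q)
  have step: "\<exists>D. \<forall>y\<in>N. (w has_derivative D y) (at y) \<and> (\<forall>v. (\<Sum>\<beta>\<in>Basis. (D y v \<bullet> \<beta>) *\<^sub>R a \<beta> y)
      = frechet_derivative q (at y) v - (\<Sum>\<beta>\<in>Basis. (w y \<bullet> \<beta>) *\<^sub>R frechet_derivative (a \<beta>) (at y) v))"
    if eq: "\<And>y. y \<in> N \<Longrightarrow> (\<Sum>\<beta>\<in>Basis. (w y \<bullet> \<beta>) *\<^sub>R a \<beta> y) = q y" and q: "C_k_on (Suc k) N q" for w q k
  proof (rule bchoice, rule ballI)
    fix y assume y: "y \<in> N"
    have "(q has_derivative frechet_derivative q (at y)) (at y)"
      using q y by (simp add: frechet_derivative_works)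
    note * = linear_system_has_derivative[OF N y C_inf_on_has_derivative[OF a y] this coercive eq]
    show "\<exists>D. (w has_derivative D) (at y) \<and> (\<forall>v. (\<Sum>\<beta>\<in>Basis. (D v \<bullet> \<beta>) *\<^sub>R a \<beta> y)
      = frechet_derivative q (at y) v - (\<Sum>\<beta>\<in>Basis. (w y \<bullet> \<beta>) *\<^sub>R frechet_derivative (a \<beta>) (at y) v))"
      by (rule *) (assumption | rule exI conjI allI)+
  qed
  have rhs: "C_k_on k N (\<lambda>y. frechet_derivative q (at y) v
      - (\<Sum>\<beta>\<in>Basis. (w y \<bullet> \<beta>) *\<^sub>R frechet_derivative (a \<beta>) (at y) v))"
    if "C_k_on k N w" "C_k_on (Suc k) N q" for w q k v
  proof -
    have "C_k_on k N (\<lambda>y. \<Sum>\<beta>\<in>Basis. (w y \<bullet> \<beta>) *\<^sub>R frechet_derivative (a \<beta>) (at y) v)"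
      using C_inf_on_frechet_derivative[OF a]
      by (intro C_k_on_sum C_k_on_scaleR N C_k_on_bounded_linear[OF N bounded_linear_inner_left that(1)])
         (auto simp: C_inf_on_def)
    from C_k_on_bounded_linear[OF N bounded_linear_minus[OF bounded_linear_ident] this]
    show ?thesis using C_k_on_add[OF N, of k "\<lambda>y. frechet_derivative q (at y) v"] that(2) by fastforce
  qed
  {
    case 0
    from step[OF 0] obtain D where D': "\<forall>y\<in>N. (w has_derivative D y) (at y) \<and>
      (\<forall>v. (\<Sum>\<beta>\<in>Basis. (D y v \<bullet> \<beta>) *\<^sub>R a \<beta> y)
        = frechet_derivative q (at y) v - (\<Sum>\<beta>\<in>Basis. (w y \<bullet> \<beta>) *\<^sub>R frechet_derivative (a \<beta>) (at y) v))"
      by (rule exE)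
    note D = D'[THEN bspec, THEN conjunct1] D'[THEN bspec, THEN conjunct2, THEN spec]
    have w0: "C_k_on 0 N w"
      using D(1) by (auto intro!: continuous_at_imp_continuous_on has_derivative_continuous)
    \<comment> \<open>At the bottom of the induction the new right-hand side is only continuous.
      Instead, \<open>D z v - D y v\<close> solves the system at \<open>z\<close> with right-hand
      side \<open>?e z\<close>, which tends to 0 as \<open>z\<close> tends to \<open>y\<close>, and
      coercivity passes this on to the solution.\<close>
    have cont: "continuous_on N (\<lambda>y. D y v)" for v
      unfolding continuous_on_eq_continuous_at[OF N]
    proof
      fix y assume y: "y \<in> N"
      let ?R = "\<lambda>y. frechet_derivative q (at y) v - (\<Sum>\<beta>\<in>Basis. (w y \<bullet> \<beta>) *\<^sub>R frechet_derivative (a \<beta>) (at y) v)"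
      let ?e = "\<lambda>z. ?R z - (\<Sum>\<beta>\<in>Basis. (D y v \<bullet> \<beta>) *\<^sub>R a \<beta> z)"
      have R: "continuous_on N ?R" using rhs[OF w0 0(2)] by simp
      have "continuous_on N (\<lambda>z. \<Sum>\<beta>\<in>Basis. (D y v \<bullet> \<beta>) *\<^sub>R a \<beta> z)"
        by (intro continuous_intros C_inf_on_continuous a)
      from continuous_on_mult_left[OF continuous_on_norm[OF continuous_on_diff[OF R this]]]
      have "continuous_on N (\<lambda>z. 2 * norm (?e z))" .
      then have "isCont (\<lambda>z. 2 * norm (?e z)) y" using N y by (simp add: continuous_on_eq_continuous_at)
      moreover have "?e y = 0" using D(2)[OF y, of v] by simp
      ultimately have lim: "((\<lambda>z. 2 * norm (?e z)) \<longlongrightarrow> 0) (at y)" by (simp only: isCont_def norm_zero mult_zero_right)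
      have "\<forall>\<^sub>F z in at y. norm (D z v - D y v) \<le> 2 * norm (?e z)"
        unfolding eventually_at_topological
      proof (intro exI conjI ballI impI)
        fix z assume "z \<in> N"
        have "(\<Sum>\<beta>\<in>Basis. ((D z v - D y v) \<bullet> \<beta>) *\<^sub>R a \<beta> z) = ?e z"
          using D(2)[OF \<open>z \<in> N\<close>, of v] by (simp add: inner_diff_left scaleR_diff_left sum_subtractf)
        then show "norm (D z v - D y v) \<le> 2 * norm (?e z)"
          using coercive[OF \<open>z \<in> N\<close>, of "D z v - D y v"] by simp
      qed (use N y in auto)
      from Lim_null_comparison[OF this lim] show "isCont (\<lambda>y. D y v) y"
        by (simp add: isCont_def LIM_zero_iff)
    qed
    show ?case by (rule C_k_on_SucI[OF N D(1)]) (simp_all add: cont)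
  next
    case (Suc k)
    have q: "C_k_on (Suc k) N q" by (rule C_k_on_SucD[OF Suc.prems(2)])
    have w: "C_k_on (Suc k) N w" by (rule Suc.IH[OF Suc.prems(1) q])
    from step[OF Suc.prems] obtain D where D': "\<forall>y\<in>N. (w has_derivative D y) (at y) \<and>
      (\<forall>v. (\<Sum>\<beta>\<in>Basis. (D y v \<bullet> \<beta>) *\<^sub>R a \<beta> y)
        = frechet_derivative q (at y) v - (\<Sum>\<beta>\<in>Basis. (w y \<bullet> \<beta>) *\<^sub>R frechet_derivative (a \<beta>) (at y) v))"
      by (rule exE)
    note D = D'[THEN bspec, THEN conjunct1] D'[THEN bspec, THEN conjunct2, THEN spec]
    show ?case
      by (rule C_k_on_SucI[OF N D(1)], assumption) (rule Suc.IH[OF D(2) rhs[OF w Suc.prems(2)]])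
  }
qed

text \<open>Where the distances \<open>norm (\<beta> - a \<beta> y)\<close> sum to less than 1/2,
  the frame map moves \<open>z\<close> by at most half of its norm, which is coercivity with the
  constant 2. The vectors \<open>\<gamma> b y\<close> contain the coefficients that express the
  direction \<open>b\<close> in the frame at \<open>y\<close>.\<close>

lemma smooth_dual_frame:
  fixes a :: "'e::euclidean_space \<Rightarrow> 'e \<Rightarrow> 'e"
  assumes S: "open S" "p \<in> S" and a: "\<And>\<beta>. \<beta> \<in> Basis \<Longrightarrow> C_inf_on S (a \<beta>)"
    and ap: "\<And>\<beta>. \<beta> \<in> Basis \<Longrightarrow> a \<beta> p = \<beta>"
  obtains N \<gamma> where "open N" "p \<in> N" "N \<subseteq> S" "\<And>b. C_inf_on N (\<gamma> b)"
    and "\<And>b y. y \<in> N \<Longrightarrow> (\<Sum>\<beta>\<in>Basis. (\<gamma> b y \<bullet> \<beta>) *\<^sub>R a \<beta> y) = b"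
proof -
  define s where "s y = (\<Sum>\<beta>\<in>Basis. norm (\<beta> - a \<beta> y))" for y
  have cs: "continuous_on S s"
    unfolding s_def by (intro continuous_intros C_inf_on_continuous a)
  define N where "N = S \<inter> s -` {..<1 / 2}"
  have N: "open N" unfolding N_def by (rule continuous_open_preimage[OF cs S(1)]) simp
  have pN: "p \<in> N" using S(2) ap by (simp add: N_def s_def)
  have coercive: "norm z \<le> 2 * norm (\<Sum>\<beta>\<in>Basis. (z \<bullet> \<beta>) *\<^sub>R a \<beta> y)" if "y \<in> N" for y z
  proof -
    let ?L = "\<Sum>\<beta>\<in>Basis. (z \<bullet> \<beta>) *\<^sub>R a \<beta> y"
    have "z - ?L = (\<Sum>\<beta>\<in>Basis. (z \<bullet> \<beta>) *\<^sub>R \<beta>) - ?L" by (simp only: euclidean_representation)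
    also have "\<dots> = (\<Sum>\<beta>\<in>Basis. (z \<bullet> \<beta>) *\<^sub>R (\<beta> - a \<beta> y))"
      by (simp add: sum_subtractf scaleR_diff_right del: euclidean_representation)
    also have "norm \<dots> \<le> (\<Sum>\<beta>\<in>Basis. norm z * norm (\<beta> - a \<beta> y))"
      by (intro order_trans[OF norm_sum] sum_mono) (simp add: Basis_le_norm mult_right_mono)
    also have "\<dots> = norm z * s y" by (simp add: s_def sum_distrib_left)
    also have "\<dots> \<le> norm z * (1 / 2)" using that by (intro mult_left_mono) (auto simp: N_def)
    finally have "norm (z - ?L) \<le> norm z / 2" by simp
    moreover have "norm z \<le> norm (z - ?L) + norm ?L" using norm_triangle_ineq[of "z - ?L" ?L] by simp
    ultimately show ?thesis by linarith
  qed
  \<comment> \<open>The solution is picked pointwise, without regard to smoothness;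
    \<open>linear_system_C_k\<close> applies to every solution, so regularity comes
    afterwards.\<close>
  define \<gamma> where "\<gamma> b y = (SOME z. (\<Sum>\<beta>\<in>Basis. (z \<bullet> \<beta>) *\<^sub>R a \<beta> y) = b)" for b y
  have \<gamma>: "(\<Sum>\<beta>\<in>Basis. (\<gamma> b y \<bullet> \<beta>) *\<^sub>R a \<beta> y) = b" if y: "y \<in> N" for b y
  proof -
    obtain g where "\<And>z. (\<Sum>\<beta>\<in>Basis. (g z \<bullet> \<beta>) *\<^sub>R a \<beta> y) = z"
      by (rule coercive_isomorphism[of "\<lambda>\<beta>. a \<beta> y"]) (use coercive[OF y] in auto)
    then show ?thesis unfolding \<gamma>_def by (rule someI)
  qed
  have aN: "C_inf_on N (a \<beta>)" if "\<beta> \<in> Basis" for \<beta>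
    by (rule C_inf_on_mono[OF a[OF that]]) (simp add: N_def)
  have "C_k_on k N (\<gamma> b)" for k b
    by (rule C_k_on_SucD, rule linear_system_C_k[OF N aN coercive \<gamma> C_k_on_const[OF N]])
  then have "C_inf_on N (\<gamma> b)" for b by (simp add: C_inf_on_def)
  then show ?thesis using that[OF N pN _ _ \<gamma>] by (auto simp: N_def)
qed

section \<open>Regularity of functions with continuous weak derivatives\<close>

lemma frechet_derivative_test_sum:
  assumes "\<And>i. i \<in> I \<Longrightarrow> test_function S (f i)"
  shows "frechet_derivative (\<lambda>y. \<Sum>i\<in>I. f i y) (at y) v = (\<Sum>i\<in>I. frechet_derivative (f i) (at y) v)"
proof -
  have "((\<lambda>y. \<Sum>i\<in>I. f i y) has_derivative (\<lambda>v. \<Sum>i\<in>I. frechet_derivative (f i) (at y) v)) (at y)"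
    using assms by (intro has_derivative_sum C_inf_on_has_derivative[of UNIV]) (auto simp: test_function_def)
  from frechet_derivative_at[OF this, symmetric] show ?thesis by (rule fun_cong)
qed

lemma frechet_derivative_test_scale:
  assumes "test_function S f"
  shows "frechet_derivative (\<lambda>y. k * f y) (at y) v = k * frechet_derivative f (at y) v"
proof -
  have "((\<lambda>y. k * f y) has_derivative (\<lambda>v. k * frechet_derivative f (at y) v)) (at y)"
    using assms by (intro has_derivative_mult_right C_inf_on_has_derivative[of UNIV]) (auto simp: test_function_def)
  from frechet_derivative_at[OF this, symmetric] show ?thesis by (rule fun_cong)
qed

lemma frechet_derivative_test_add:
  assumes "test_function S f" "test_function S g"
  shows "frechet_derivative (\<lambda>y. f y + g y) (at y) v
    = frechet_derivative f (at y) v + frechet_derivative g (at y) v"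
proof -
  have "((\<lambda>y. f y + g y) has_derivative (\<lambda>v. frechet_derivative f (at y) v + frechet_derivative g (at y) v)) (at y)"
    using assms by (intro has_derivative_add C_inf_on_has_derivative[of UNIV]) (auto simp: test_function_def)
  from frechet_derivative_at[OF this, symmetric] show ?thesis by (rule fun_cong)
qed

text \<open>The equation \<open>Z u = w\<close> in the sense of distributions inside one chart.
  Continuity is built in: it makes all integrals against test functions exist and lets equal
  integrals imply equal values. Complex functions are treated through their real and imaginary
  parts.\<close>

definition weak_apply :: "('m, 'e::euclidean_space) chart \<Rightarrow> 'm vfield \<Rightarrow> ('e \<Rightarrow> real) \<Rightarrow> ('e \<Rightarrow> real) \<Rightarrow> bool" where
  "weak_apply c Z u w \<longleftrightarrow> continuous_on (chart_image c) u \<and> continuous_on (chart_image c) w \<and>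
     (\<forall>\<eta>. test_function (chart_image c) \<eta> \<longrightarrow>
        (\<integral>y. w y * \<eta> y \<partial>lborel) = (\<integral>y. u y * transpose_in_chart c Z \<eta> y \<partial>lborel))"

context manifold
begin

context
  fixes c assumes c: "c \<in> \<A>"
begin

lemma integrable_test_chart:
  "continuous_on (chart_image c) u \<Longrightarrow> test_function (chart_image c) \<eta> \<Longrightarrow> integrable lborel (\<lambda>y. u y * \<eta> y)"
  for u :: "'e \<Rightarrow> real"
  by (rule integrable_times_test_real[OF chart_image_open[OF c]])

lemma weak_apply_zero_field:
  assumes "continuous_on (chart_image c) u"
  shows "weak_apply c (\<lambda>x f. 0) u (\<lambda>_. 0)"
  using assms by (simp add: weak_apply_def transpose_in_chart_def)

lemma weak_apply_add_field:
  assumes Y: "smooth_vfield \<A> Y" and Z: "smooth_vfield \<A> Z"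
    and "weak_apply c Y u w" "weak_apply c Z u w'"
  shows "weak_apply c (\<lambda>x f. Y x f + Z x f) u (\<lambda>y. w y + w' y)"
proof -
  have "(\<integral>y. (w y + w' y) * \<eta> y \<partial>lborel) = (\<integral>y. u y * transpose_in_chart c (\<lambda>x f. Y x f + Z x f) \<eta> y \<partial>lborel)"
    if \<eta>: "test_function (chart_image c) \<eta>" for \<eta>
  proof -
    have t: "test_function (chart_image c) (\<lambda>y. U (chart_inv c y) (\<lambda>p. snd c p \<bullet> b) * \<eta> y)"
      if "smooth_vfield \<A> U" for U b
      using that by (intro test_function_mult chart_image_open coefficient_smooth c \<eta>)
    have "transpose_in_chart c (\<lambda>x f. Y x f + Z x f) \<eta> y
        = transpose_in_chart c Y \<eta> y + transpose_in_chart c Z \<eta> y" for y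
      by (simp add: transpose_in_chart_def distrib_right frechet_derivative_test_add[OF t[OF Y] t[OF Z]] sum.distrib)
    moreover have "continuous_on (chart_image c) u" "continuous_on (chart_image c) w" "continuous_on (chart_image c) w'"
      using assms by (auto simp: weak_apply_def)
    ultimately show ?thesis
      using assms \<eta> test_function_transpose[OF Y c \<eta>] test_function_transpose[OF Z c \<eta>]
      by (simp add: weak_apply_def distrib_right distrib_left integrable_test_chart)
  qed
  with assms(3,4) show ?thesis by (auto simp: weak_apply_def intro: continuous_intros)
qed

lemma weak_apply_scale_field:
  assumes Z: "smooth_vfield \<A> Z" and "weak_apply c Z u w"
  shows "weak_apply c (\<lambda>x f. k * Z x f) u (\<lambda>y. k * w y)"
proof -
  have "transpose_in_chart c (\<lambda>x f. k * Z x f) \<eta> y = k * transpose_in_chart c Z \<eta> y"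
    if \<eta>: "test_function (chart_image c) \<eta>" for \<eta> y
  proof -
    have t: "test_function (chart_image c) (\<lambda>y. Z (chart_inv c y) (\<lambda>p. snd c p \<bullet> b) * \<eta> y)" for b
      by (intro test_function_mult chart_image_open coefficient_smooth c \<eta> Z)
    show ?thesis
      by (simp add: transpose_in_chart_def mult.assoc frechet_derivative_test_scale[OF t] sum_distrib_left)
  qed
  then show ?thesis using assms(2)
    by (auto simp: weak_apply_def mult.assoc mult.left_commute[of _ k] intro: continuous_intros)
qed

text \<open>Both second weak derivatives are moved onto the test function, where
  \<open>transpose_bracket\<close> provides the commutator identity; \<open>u\<close> itself is
  never differentiated classically.\<close>

lemma weak_apply_bracket:
  assumes Y: "smooth_vfield \<A> Y" and Z: "smooth_vfield \<A> Z"
    and Zu: "weak_apply c Z u p" and YZu: "weak_apply c Y p q"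
    and Yu: "weak_apply c Y u p'" and ZYu: "weak_apply c Z p' q'"
  shows "weak_apply c (lie_bracket \<A> Y Z) u (\<lambda>y. q y - q' y)"
proof -
  have cont: "continuous_on (chart_image c) u" "continuous_on (chart_image c) q" "continuous_on (chart_image c) q'"
    using assms by (auto simp: weak_apply_def)
  have "(\<integral>y. (q y - q' y) * \<eta> y \<partial>lborel) = (\<integral>y. u y * transpose_in_chart c (lie_bracket \<A> Y Z) \<eta> y \<partial>lborel)"
    if \<eta>: "test_function (chart_image c) \<eta>" for \<eta>
  proof -
    note tY = test_function_transpose[OF Y c] and tZ = test_function_transpose[OF Z c]
    have "(\<integral>y. (q y - q' y) * \<eta> y \<partial>lborel) = (\<integral>y. q y * \<eta> y \<partial>lborel) - (\<integral>y. q' y * \<eta> y \<partial>lborel)"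
      using cont \<eta> by (simp add: left_diff_distrib integrable_test_chart)
    also have "\<dots> = (\<integral>y. u y * transpose_in_chart c Z (transpose_in_chart c Y \<eta>) y \<partial>lborel)
        - (\<integral>y. u y * transpose_in_chart c Y (transpose_in_chart c Z \<eta>) y \<partial>lborel)"
      using assms \<eta> tY[OF \<eta>] tZ[OF \<eta>] by (simp add: weak_apply_def)
    also have "\<dots> = (\<integral>y. u y * transpose_in_chart c (lie_bracket \<A> Y Z) \<eta> y \<partial>lborel)"
      using cont(1) tZ[OF tY[OF \<eta>]] tY[OF tZ[OF \<eta>]]
      by (simp add: transpose_bracket[OF Y Z c \<eta>] right_diff_distrib integrable_test_chart)
    finally show ?thesis .
  qed
  with cont show ?thesis by (auto simp: weak_apply_def intro: continuous_intros)
qed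

section \<open>Spaces of continuous functions stable under weak derivatives\<close>

context
  fixes V :: "('e \<Rightarrow> real) set" and \<X> :: "'m vfield set"
  assumes V_cont: "\<And>u. u \<in> V \<Longrightarrow> continuous_on (chart_image c) u"
    and V_zero: "(\<lambda>_. 0) \<in> V"
    and V_add: "\<And>u w. u \<in> V \<Longrightarrow> w \<in> V \<Longrightarrow> (\<lambda>y. u y + w y) \<in> V"
    and V_scale: "\<And>k u. u \<in> V \<Longrightarrow> (\<lambda>y. k * u y) \<in> V"
    and V_closed: "\<And>Z u. Z \<in> \<X> \<Longrightarrow> u \<in> V \<Longrightarrow> \<exists>w\<in>V. weak_apply c Z u w"
    and X_smooth: "\<And>Z. Z \<in> \<X> \<Longrightarrow> smooth_vfield \<A> Z"
begin

text \<open>A bracket needs second derivatives of \<open>u\<close>. They exist because the first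
  ones lie in \<open>V\<close> again, which is why the induction leaves \<open>u\<close> arbitrary
  and returns a member of \<open>V\<close>.\<close>

lemma weak_apply_lie_generated:
  assumes "Z \<in> lie_generated \<A> \<X>" "u \<in> V"
  shows "\<exists>w\<in>V. weak_apply c Z u w"
  using assms
proof (induction arbitrary: u)
  case (gen Z)
  then show ?case by (rule V_closed)
next
  case zero
  then show ?case using weak_apply_zero_field V_cont V_zero by blast
next
  case (add Y Z)
  then show ?case
    using weak_apply_add_field[OF smooth_vfield_lie_generated[OF add.hyps(1) X_smooth] smooth_vfield_lie_generated[OF add.hyps(2) X_smooth]] V_add
    by meson
next
  case (scale Z k)
  then show ?case
    using weak_apply_scale_field[OF smooth_vfield_lie_generated[OF scale.hyps X_smooth]] V_scale by meson
next
  case (bracket Y Z)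
  obtain p where p: "p \<in> V" "weak_apply c Z u p" using bracket by blast
  obtain q where q: "q \<in> V" "weak_apply c Y p q" using bracket p by blast
  obtain p' where p': "p' \<in> V" "weak_apply c Y u p'" using bracket by blast
  obtain q' where q': "q' \<in> V" "weak_apply c Z p' q'" using bracket p' by blast
  have "(\<lambda>y. q y - q' y) \<in> V" using V_add[OF q(1) V_scale[OF q'(1), of "-1"]] by simp
  then show ?case
    using weak_apply_bracket[OF smooth_vfield_lie_generated[OF bracket.hyps(1) X_smooth]
        smooth_vfield_lie_generated[OF bracket.hyps(2) X_smooth] p(2) q(2) p'(2) q'(2)] by blast
qed

context
  assumes spanning: "\<And>x. {Z x | Z. Z \<in> lie_generated \<A> \<X>} = tangent_space \<A> x"
begin

text \<open>Generated fields equal to the coordinate directions at \<open>p\<close> form a frame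
  near \<open>p\<close>, and \<gamma> expresses the direction \<open>b\<close> in it. A weak
  derivative is multiplied by the coefficients of \<gamma> by multiplying the test function instead,
  so the weak gradient is a continuous combination of the \<open>w \<beta>\<close>, and
  \<open>weak_gradient_has_derivative\<close> makes it a classical one.\<close>

lemma weak_apply_smooth_frame:
  assumes p: "p \<in> chart_image c"
  obtains N and \<gamma> :: "'e \<Rightarrow> 'e \<Rightarrow> 'e"
  where "open N" "p \<in> N" "N \<subseteq> chart_image c" "\<And>b. C_inf_on N (\<gamma> b)"
    and "\<And>u. u \<in> V \<Longrightarrow> \<exists>w. (\<forall>\<beta>\<in>Basis. w \<beta> \<in> V) \<and>
       (\<forall>y\<in>N. (u has_derivative (\<lambda>v. \<Sum>b\<in>Basis. (\<Sum>\<beta>\<in>Basis. (\<gamma> b y \<bullet> \<beta>) * w \<beta> y) * (v \<bullet> b))) (at y))"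
proof -
  let ?S = "chart_image c" and ?x = "chart_inv c p"
  note S = chart_image_open[OF c]
  have x: "?x \<in> fst c" "snd c ?x = p" using chart_inv_in[OF c p] chart_chart_inv[OF c p] by auto
  \<comment> \<open>The coordinate direction in the normal form of \<open>tangent_space\<close>,
    zero on functions not smooth near the point, so that it can be equal to the value of a
    field.\<close>
  define pd where "pd \<beta> = (\<lambda>f :: 'm \<Rightarrow> real. if smooth_near \<A> ?x f then frechet_derivative (f \<circ> chart_inv c) (at (snd c ?x)) \<beta> else 0)" for \<beta>
  have "\<forall>\<beta>. \<exists>Z. Z \<in> lie_generated \<A> \<X> \<and> Z ?x = pd \<beta>"
  proof
    fix \<beta>
    have "pd \<beta> \<in> {Z ?x | Z. Z \<in> lie_generated \<A> \<X>}"
      unfolding spanning pd_def by (rule partial_in_tangent_space[OF c x(1)])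
    then show "\<exists>Z. Z \<in> lie_generated \<A> \<X> \<and> Z ?x = pd \<beta>" by auto
  qed
  from choice[OF this] obtain Z where
    "\<forall>\<beta>. Z \<beta> \<in> lie_generated \<A> \<X> \<and> Z \<beta> ?x = pd \<beta>" by (rule exE)
  then have Z: "\<And>\<beta>. Z \<beta> \<in> lie_generated \<A> \<X>" "\<And>\<beta>. Z \<beta> ?x = pd \<beta>" by simp_all
  have Zs: "smooth_vfield \<A> (Z \<beta>)" for \<beta> by (rule smooth_vfield_lie_generated[OF Z(1) X_smooth])
  define co where "co \<beta> b y = Z \<beta> (chart_inv c y) (\<lambda>p. snd c p \<bullet> b)" for \<beta> b y
  have co: "C_inf_on ?S (co \<beta> b)" for \<beta> b unfolding co_def by (rule coefficient_smooth[OF Zs c])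
  define a where "a \<beta> y = (\<Sum>b\<in>Basis. co \<beta> b y *\<^sub>R b)" for \<beta> y
  have a: "C_inf_on ?S (a \<beta>)" for \<beta>
    unfolding a_def by (intro C_inf_on_sum C_inf_on_scaleR S co C_inf_on_const)
  have ap: "a \<beta> p = \<beta>" for \<beta>
  proof -
    have "co \<beta> b p = \<beta> \<bullet> b" for b
    proof -
      have "((\<lambda>y. y \<bullet> b) has_derivative (\<lambda>v. v \<bullet> b)) (at p)"
        by (rule bounded_linear_imp_has_derivative[OF bounded_linear_inner_left])
      then have "((\<lambda>p. snd c p \<bullet> b) \<circ> chart_inv c has_derivative (\<lambda>v. v \<bullet> b)) (at p)"
        by (rule has_derivative_transform_within_open[OF _ S p]) (simp add: chart_chart_inv[OF c])
      from frechet_derivative_at[OF this]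
      have "frechet_derivative ((\<lambda>p. snd c p \<bullet> b) \<circ> chart_inv c) (at p) = (\<lambda>v. v \<bullet> b)" ..
      then show ?thesis
        using smooth_nearI[OF chart_dom_open[OF c] x(1) smooth_on_coordinate[OF c]]
        unfolding co_def Z(2) pd_def x(2) by simp
    qed
    then show ?thesis by (simp add: a_def euclidean_representation)
  qed
  obtain N \<gamma> where N: "open N" "p \<in> N" "N \<subseteq> ?S" "\<And>b. C_inf_on N (\<gamma> b)"
    and \<gamma>: "\<And>b y. y \<in> N \<Longrightarrow> (\<Sum>\<beta>\<in>Basis. (\<gamma> b y \<bullet> \<beta>) *\<^sub>R a \<beta> y) = b"
    using smooth_dual_frame[OF S p a ap] by metis
  show ?thesis
  proof (rule that[OF N])
    fix u assume u: "u \<in> V"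
    obtain w where w: "\<And>\<beta>. w \<beta> \<in> V" "\<And>\<beta>. weak_apply c (Z \<beta>) u (w \<beta>)"
      using weak_apply_lie_generated[OF Z(1) u] by metis
    have cw: "continuous_on N (w \<beta>)" for \<beta>
      using V_cont[OF w(1)] N(3) continuous_on_subset by blast
    have cu: "continuous_on N u" using V_cont[OF u] N(3) continuous_on_subset by blast
    define grad where "grad y = (\<Sum>b\<in>Basis. (\<Sum>\<beta>\<in>Basis. (\<gamma> b y \<bullet> \<beta>) * w \<beta> y) *\<^sub>R b)" for y
    have grad: "grad y \<bullet> b = (\<Sum>\<beta>\<in>Basis. (\<gamma> b y \<bullet> \<beta>) * w \<beta> y)" if "b \<in> Basis" for b y
      using that by (simp add: grad_def)
    have "(u has_derivative (\<lambda>v. grad y \<bullet> v)) (at y)" if "y \<in> N" for y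
    proof (rule weak_gradient_has_derivative[OF N(1) cu _ _ that])
      fix b :: 'e assume b: "b \<in> Basis"
      show "continuous_on N (\<lambda>y. grad y \<bullet> b)"
        unfolding grad[OF b] by (intro continuous_intros C_inf_on_continuous N(4) cw)
      fix \<eta> assume \<eta>: "test_function N \<eta>"
      have \<gamma>s: "C_inf_on N (\<lambda>y. \<gamma> b y \<bullet> \<beta>)" for \<beta> by (rule C_inf_on_inner_left[OF N(1) N(4)])
      \<comment> \<open>Although \<gamma> is smooth on \<open>N\<close> only, this is a test
        function on the whole chart image, since the support of \<eta> lies in
        \<open>N\<close>.\<close>
      define \<zeta> where "\<zeta> \<beta> y = (\<gamma> b y \<bullet> \<beta>) * \<eta> y" for \<beta> y
      have \<zeta>: "test_function ?S (\<zeta> \<beta>)" for \<beta>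
        unfolding \<zeta>_def by (rule test_function_mono[OF test_function_mult[OF N(1) \<gamma>s \<eta>] N(3)])
      have co\<zeta>: "test_function ?S (\<lambda>y. co \<beta> b' y * \<zeta> \<beta> y)" for \<beta> b'
        by (rule test_function_mult[OF S co \<zeta>])
      \<comment> \<open>The frame identity for \<open>\<gamma> b y\<close>, read in the coordinate
        \<open>b'\<close> and multiplied by \<eta>. Because of it the frame coefficients disappear
        under the derivative, and the transposes add up to minus the derivative of \<eta> along
        \<open>b\<close>.\<close>
      have sum\<zeta>: "(\<Sum>\<beta>\<in>Basis. co \<beta> b' y * \<zeta> \<beta> y) = (b \<bullet> b') * \<eta> y" if "b' \<in> Basis" for b' y
      proof (cases "y \<in> N")
        case True
        have "b \<bullet> b' = (\<Sum>\<beta>\<in>Basis. (\<gamma> b y \<bullet> \<beta>) *\<^sub>R a \<beta> y) \<bullet> b'" by (simp only: \<gamma>[OF True])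
        also have "\<dots> = (\<Sum>\<beta>\<in>Basis. (\<gamma> b y \<bullet> \<beta>) * co \<beta> b' y)"
        proof -
          have "a \<beta> y \<bullet> b' = co \<beta> b' y" for \<beta> using that by (simp add: a_def)
          then show ?thesis by (simp add: inner_sum_left)
        qed
        finally show ?thesis by (simp add: \<zeta>_def sum_distrib_left sum_distrib_right ac_simps)
      qed (simp add: \<zeta>_def test_function_eq_0[OF \<eta>])
      have tr: "(\<Sum>\<beta>\<in>Basis. transpose_in_chart c (Z \<beta>) (\<zeta> \<beta>) y) = - frechet_derivative \<eta> (at y) b" for y
      proof -
        have "(\<Sum>\<beta>\<in>Basis. transpose_in_chart c (Z \<beta>) (\<zeta> \<beta>) y)
            = - (\<Sum>\<beta>\<in>Basis. \<Sum>b'\<in>Basis. frechet_derivative (\<lambda>y. co \<beta> b' y * \<zeta> \<beta> y) (at y) b')"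
          by (simp add: transpose_in_chart_def co_def sum_negf)
        also have "\<dots> = - (\<Sum>b'\<in>Basis. \<Sum>\<beta>\<in>Basis. frechet_derivative (\<lambda>y. co \<beta> b' y * \<zeta> \<beta> y) (at y) b')"
          by (subst sum.swap) (rule refl)
        also have "\<dots> = - (\<Sum>b'\<in>Basis. frechet_derivative (\<lambda>y. (b \<bullet> b') * \<eta> y) (at y) b')"
          by (simp add: frechet_derivative_test_sum[OF co\<zeta>, symmetric] sum\<zeta>)
        also have "\<dots> = - (\<Sum>b'\<in>Basis. (b \<bullet> b') * frechet_derivative \<eta> (at y) b')"
          by (simp add: frechet_derivative_test_scale[OF \<eta>])
        also have "(\<Sum>b'\<in>Basis. (b \<bullet> b') * frechet_derivative \<eta> (at y) b') = frechet_derivative \<eta> (at y) b"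
          using b by (simp add: inner_Basis if_distrib[where f="\<lambda>t. t * _"] sum.delta cong: if_cong)
        finally show ?thesis .
      qed
      have "(\<integral>y. (grad y \<bullet> b) * \<eta> y \<partial>lborel) = (\<integral>y. (\<Sum>\<beta>\<in>Basis. w \<beta> y * \<zeta> \<beta> y) \<partial>lborel)"
        by (simp add: grad[OF b] \<zeta>_def sum_distrib_left sum_distrib_right ac_simps)
      also have "\<dots> = (\<Sum>\<beta>\<in>Basis. \<integral>y. w \<beta> y * \<zeta> \<beta> y \<partial>lborel)"
        by (rule Bochner_Integration.integral_sum) (rule integrable_test_chart[OF V_cont[OF w(1)] \<zeta>])
      also have "\<dots> = (\<Sum>\<beta>\<in>Basis. \<integral>y. u y * transpose_in_chart c (Z \<beta>) (\<zeta> \<beta>) y \<partial>lborel)"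
        using w(2) \<zeta> by (simp add: weak_apply_def)
      also have "\<dots> = (\<integral>y. (\<Sum>\<beta>\<in>Basis. u y * transpose_in_chart c (Z \<beta>) (\<zeta> \<beta>) y) \<partial>lborel)"
        by (rule Bochner_Integration.integral_sum[symmetric])
           (rule integrable_test_chart[OF V_cont[OF u] test_function_transpose[OF Zs c \<zeta>]])
      also have "\<dots> = - (\<integral>y. u y * frechet_derivative \<eta> (at y) b \<partial>lborel)"
        by (simp add: sum_distrib_left[symmetric] tr)
      finally show "(\<integral>y. (grad y \<bullet> b) * \<eta> y \<partial>lborel) = - (\<integral>y. u y * frechet_derivative \<eta> (at y) b \<partial>lborel)" .
    qed
    moreover have "grad y \<bullet> v = (\<Sum>b\<in>Basis. (\<Sum>\<beta>\<in>Basis. (\<gamma> b y \<bullet> \<beta>) * w \<beta> y) * (v \<bullet> b))" for y v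
      unfolding grad_def inner_sum_left inner_scaleR_left by (simp only: inner_commute[of v])
    ultimately show "\<exists>w. (\<forall>\<beta>\<in>Basis. w \<beta> \<in> V) \<and>
       (\<forall>y\<in>N. (u has_derivative (\<lambda>v. \<Sum>b\<in>Basis. (\<Sum>\<beta>\<in>Basis. (\<gamma> b y \<bullet> \<beta>) * w \<beta> y) * (v \<bullet> b))) (at y))"
      using w(1) by (intro exI[of _ w]) simp
  qed
qed

text \<open>The induction on \<open>k\<close> runs over all members of \<open>V\<close> at once: the
  derivative of one member involves others, multiplied by smooth coefficients, so class
  \<open>k\<close> for all of them gives class \<open>Suc k\<close> for each.\<close>

lemma weak_apply_imp_C_inf:
  assumes "u \<in> V"
  shows "C_inf_on (chart_image c) u"
  unfolding C_inf_on_def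
proof
  fix k show "C_k_on k (chart_image c) u"
    using assms
  proof (induction k arbitrary: u)
    case 0
    then show ?case by (simp add: V_cont)
  next
    case (Suc k)
    show ?case
    proof (rule C_k_on_local)
      fix p assume "p \<in> chart_image c"
      obtain N and \<gamma> :: "'e \<Rightarrow> 'e \<Rightarrow> 'e"
        where N: "open N" "p \<in> N" "N \<subseteq> chart_image c" "\<And>b. C_inf_on N (\<gamma> b)"
        and ex: "\<And>u. u \<in> V \<Longrightarrow> \<exists>w. (\<forall>\<beta>\<in>Basis. w \<beta> \<in> V) \<and>
         (\<forall>y\<in>N. (u has_derivative (\<lambda>v. \<Sum>b\<in>Basis. (\<Sum>\<beta>\<in>Basis. (\<gamma> b y \<bullet> \<beta>) * w \<beta> y) * (v \<bullet> b))) (at y))"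
        by (rule weak_apply_smooth_frame[OF \<open>p \<in> chart_image c\<close>]) blast
      obtain w where w: "\<And>\<beta>. \<beta> \<in> Basis \<Longrightarrow> w \<beta> \<in> V"
        and du: "\<And>y. y \<in> N \<Longrightarrow> (u has_derivative (\<lambda>v. \<Sum>b\<in>Basis. (\<Sum>\<beta>\<in>Basis. (\<gamma> b y \<bullet> \<beta>) * w \<beta> y) * (v \<bullet> b))) (at y)"
        using ex[OF Suc.prems] by blast
      have "C_k_on k N (\<lambda>y. \<Sum>b\<in>Basis. (\<Sum>\<beta>\<in>Basis. (\<gamma> b y \<bullet> \<beta>) *\<^sub>R w \<beta> y) *\<^sub>R (v \<bullet> b))" for v
      proof (intro C_k_on_sum C_k_on_scaleR N(1) C_k_on_const)
        fix b \<beta> :: 'e assume "\<beta> \<in> Basis"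
        then show "C_k_on k N (w \<beta>)" using C_k_on_mono[OF Suc.IH[OF w] N(3)] by blast
        show "C_k_on k N (\<lambda>y. \<gamma> b y \<bullet> \<beta>)"
          using C_inf_on_inner_left[OF N(1) N(4)] by (auto simp: C_inf_on_def)
      qed
      then have "C_k_on (Suc k) N u"
        by (intro C_k_on_SucI[OF N(1) du]) simp_all
      with N show "\<exists>T. open T \<and> p \<in> T \<and> C_k_on (Suc k) T u" by blast
    qed
  qed
qed

end
end
end
end

section \<open>Iterated derivatives of smooth functions\<close>

lemma integral_test_Re_Im:
  fixes u :: "'e::euclidean_space \<Rightarrow> complex"
  assumes "open S" "continuous_on S u" "test_function S \<eta>"
  shows "Re (\<integral>y. u y * of_real (\<eta> y) \<partial>lborel) = (\<integral>y. Re (u y) * \<eta> y \<partial>lborel)"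
    and "Im (\<integral>y. u y * of_real (\<eta> y) \<partial>lborel) = (\<integral>y. Im (u y) * \<eta> y \<partial>lborel)"
  using integral_Re[OF integrable_times_test[OF assms]] integral_Im[OF integrable_times_test[OF assms]]
  by simp_all

section \<open>Factorials of concatenated tuples\<close>

lemma fact_add_le: "fact (m + n) \<le> (2 ^ (m + n) * (fact m * fact n) :: real)"
proof -
  have "fact (m + n) = real ((m + n) choose m) * (fact m * fact n)"
    using binomial_fact_lemma[of m "m + n"] by (metis add_diff_cancel_left' le_add1 mult.commute of_nat_fact of_nat_mult)
  also have "\<dots> \<le> 2 ^ (m + n) * (fact m * fact n)"
  proof (rule mult_right_mono)
    have "real ((m + n) choose m) \<le> real (2 ^ (m + n))" by (rule of_nat_mono[OF binomial_le_pow2])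
    then show "real ((m + n) choose m) \<le> 2 ^ (m + n)" by simp
  qed simp
  finally show ?thesis .
qed

lemma tuple_fact_pos: "0 < tuple_fact r I"
  unfolding tuple_fact_def by (intro prod_pos) simp

text \<open>For each index the quotient of factorials is a binomial coefficient, at most 2 to the
  number of its occurrences. As all entries lie in \<open>{1..r}\<close>, these numbers add up to
  the length.\<close>

lemma tuple_fact_append_le:
  assumes "set (J @ I) \<subseteq> {1..r}"
  shows "tuple_fact r (J @ I) \<le> 2 ^ length (J @ I) * (tuple_fact r J * tuple_fact r I)"
proof -
  have "tuple_fact r (J @ I) \<le> (\<Prod>j=1..r. 2 ^ count_list (J @ I) j * (fact (count_list J j) * fact (count_list I j)))"
    unfolding tuple_fact_def by (intro prod_mono) (auto simp: fact_add_le)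
  also have "\<dots> = 2 ^ (\<Sum>j=1..r. count_list (J @ I) j) * (tuple_fact r J * tuple_fact r I)"
    by (simp only: prod.distrib power_sum tuple_fact_def)
  also have "(\<Sum>j=1..r. count_list (J @ I) j) = length (J @ I)"
    by (rule sum_count_set[OF assms]) simp
  finally show ?thesis .
qed

text \<open>At the price of the larger radius \<open>A * 2 powr s\<close> the Gevrey weight becomes
  submultiplicative, which separates the additional derivatives \<open>J\<close> of the Sobolev
  embedding from the derivative \<open>I\<close> to be estimated.\<close>

lemma gevrey_weight_append:
  assumes "set (J @ I) \<subseteq> {1..r}" "0 \<le> s" "0 \<le> A"
  shows "A ^ length (J @ I) * tuple_fact r (J @ I) powr s
    \<le> ((A * 2 powr s) ^ length J * tuple_fact r J powr s) * ((A * 2 powr s) ^ length I * tuple_fact r I powr s)"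
proof -
  have "tuple_fact r (J @ I) powr s \<le> (2 ^ length (J @ I) * (tuple_fact r J * tuple_fact r I)) powr s"
    using tuple_fact_append_le[OF assms(1)] tuple_fact_pos[of r "J @ I"] assms(2) by (intro powr_mono2) auto
  also have "\<dots> = (2 ^ length (J @ I)) powr s * (tuple_fact r J powr s * tuple_fact r I powr s)"
    using tuple_fact_pos[of r J] tuple_fact_pos[of r I] by (simp only: powr_mult)
  also have "(2 ^ length (J @ I) :: real) powr s = (2 powr s) ^ length (J @ I)"
    by (simp add: powr_realpow[symmetric] powr_powr mult.commute)
  finally have "A ^ length (J @ I) * tuple_fact r (J @ I) powr s
      \<le> A ^ length (J @ I) * ((2 powr s) ^ length (J @ I) * (tuple_fact r J powr s * tuple_fact r I powr s))"
    using assms(3) by (intro mult_left_mono) auto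
  also have "\<dots> = ((A * 2 powr s) ^ length J * tuple_fact r J powr s) * ((A * 2 powr s) ^ length I * tuple_fact r I powr s)"
    by (simp add: power_add power_mult_distrib)
  finally show ?thesis .
qed

section \<open>Classical derivatives as distributional derivatives\<close>

context manifold
begin

lemma smooth_on_continuous:
  assumes "smooth_on \<A> UNIV f"
  shows "continuous_on UNIV f"
proof (rule continuous_at_imp_continuous_on, rule ballI)
  fix x
  obtain c where c: "c \<in> \<A>" "x \<in> fst c" by (rule chart_cover)
  have "continuous_on (fst c) ((f \<circ> chart_inv c) \<circ> snd c)"
    using C_inf_on_continuous[OF smooth_on_chart[OF assms c(1) subset_UNIV]]
    unfolding chart_image_def by (rule continuous_on_compose[OF chart_continuous[OF c(1)]])
  then have "continuous_on (fst c) f"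
    by (rule continuous_on_eq) (simp add: chart_inv_chart[OF c(1)])
  then show "isCont f x" using c chart_dom_open by (simp add: continuous_on_eq_continuous_at)
qed

lemma smooth_on_capply:
  assumes X: "smooth_vfield \<A> Z" and W: "open W" and f: "smooth_on \<A> W f"
  shows "smooth_on \<A> W (capply Z f)"
proof -
  have s: "smooth_on \<A> W (vfield_apply Z (Re \<circ> f))" "smooth_on \<A> W (vfield_apply Z (Im \<circ> f))"
    using smooth_on_bounded_linear[OF W bounded_linear_Re f] smooth_on_bounded_linear[OF W bounded_linear_Im f]
    by (auto intro!: smooth_vfield_apply X W simp: comp_def)
  have "smooth_on \<A> W (\<lambda>x. of_real (vfield_apply Z (Re \<circ> f) x) + vfield_apply Z (Im \<circ> f) x *\<^sub>R \<i>)"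
    by (rule smooth_on_add[OF W smooth_on_bounded_linear[OF W bounded_linear_of_real s(1)]
          smooth_on_bounded_linear[OF W bounded_linear_scaleR_left s(2)]])
  also have "(\<lambda>x. of_real (vfield_apply Z (Re \<circ> f) x) + vfield_apply Z (Im \<circ> f) x *\<^sub>R \<i>) = capply Z f"
    by (auto simp: capply_def complex_eq_iff)
  finally show ?thesis .
qed

lemma capply_local:
  assumes X: "smooth_vfield \<A> Z" and W: "open W" "x \<in> W" and "\<And>y. y \<in> W \<Longrightarrow> f y = 0"
  shows "capply Z f x = 0"
proof -
  have "Z x (h \<circ> f) = 0" if "h 0 = 0" for h
    using tangent_local[OF smooth_vfield_tangent[OF X] W, of "h \<circ> f" "\<lambda>_. 0"] assms(4) that
      tangent_const[OF smooth_vfield_tangent[OF X]] by simp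
  then show ?thesis by (simp add: capply_def vfield_apply_def complex_eq_iff)
qed

lemma integral_capply:
  assumes Z: "smooth_vfield \<A> Z" and c: "c \<in> \<A>" and f: "smooth_on \<A> UNIV f"
    and \<eta>: "test_function (chart_image c) \<eta>"
  shows "(\<integral>y. capply Z f (chart_inv c y) * of_real (\<eta> y) \<partial>lborel)
    = (\<integral>y. f (chart_inv c y) * of_real (transpose_in_chart c Z \<eta> y) \<partial>lborel)"
proof -
  have cont: "continuous_on (chart_image c) (\<lambda>y. g (chart_inv c y))" if "smooth_on \<A> UNIV g" for g :: "'m \<Rightarrow> complex"
    using C_inf_on_continuous[OF smooth_on_chart[OF that c subset_UNIV]] by (simp add: comp_def)
  note ri = integral_test_Re_Im[OF chart_image_open[OF c] cont]
  have s: "smooth_on \<A> (fst c) (Re \<circ> f)" "smooth_on \<A> (fst c) (Im \<circ> f)"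
    using smooth_on_bounded_linear[OF chart_dom_open[OF c] bounded_linear_Re smooth_on_mono[OF f subset_UNIV]]
      smooth_on_bounded_linear[OF chart_dom_open[OF c] bounded_linear_Im smooth_on_mono[OF f subset_UNIV]]
    by (simp_all add: comp_def)
  show ?thesis
    using integral_vfield_apply[OF Z c s(1) \<eta>] integral_vfield_apply[OF Z c s(2) \<eta>]
    by (intro complex_eqI)
       (simp_all only: ri[OF smooth_on_capply[OF Z open_UNIV f] \<eta>] ri[OF f test_function_transpose[OF Z c \<eta>]],
        simp_all add: capply_def)
qed

lemma locally_integrable_continuous:
  assumes "continuous_on UNIV f"
  shows "locally_integrable \<A> f"
  unfolding locally_integrable_def
proof (intro ballI allI impI)
  fix c K assume c: "c \<in> \<A>" and K: "compact K \<and> K \<subseteq> chart_image c"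
  have "continuous_on K (chart_inv c)" using chart_inv_continuous[OF c] K continuous_on_subset by blast
  then have "continuous_on K (f \<circ> chart_inv c)"
    using assms continuous_on_compose continuous_on_subset by blast
  then show "set_integrable lborel K (f \<circ> chart_inv c)"
    unfolding set_integrable_def using K by (intro borel_integrable_compact) auto
qed

context
  fixes X :: "nat \<Rightarrow> 'm vfield" and r :: nat
  assumes X: "\<And>i. i \<in> {1..r} \<Longrightarrow> smooth_vfield \<A> (X i)"
begin

lemma smooth_on_iter_deriv:
  "set I \<subseteq> {1..r} \<Longrightarrow> smooth_on \<A> UNIV f \<Longrightarrow> smooth_on \<A> UNIV (iter_deriv X I f)"
  by (induction I) (auto simp: iter_deriv_def intro!: smooth_on_capply X)

text \<open>Fields act locally. With \<open>W\<close> the complement of the support, this confines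
  all derivatives to one and the same compact set.\<close>

lemma iter_deriv_eq_0:
  assumes "open W" "\<And>y. y \<in> W \<Longrightarrow> f y = 0" "set I \<subseteq> {1..r}" "x \<in> W"
  shows "iter_deriv X I f x = 0"
  using assms(3,4)
proof (induction I arbitrary: x)
  case Nil
  then show ?case by (simp add: iter_deriv_def assms(2))
next
  case (Cons i I)
  then have "capply (X i) (iter_deriv X I f) x = 0"
    by (intro capply_local[OF X assms(1)]) auto
  then show ?case by (simp add: iter_deriv_def)
qed

lemma test_function_fold_transpose:
  "c \<in> \<A> \<Longrightarrow> set I \<subseteq> {1..r} \<Longrightarrow> test_function (chart_image c) \<eta> \<Longrightarrow>
    test_function (chart_image c) (fold (\<lambda>i. transpose_in_chart c (X i)) I \<eta>)"
proof (induction I arbitrary: \<eta>)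
  case (Cons i I)
  then have "test_function (chart_image c) (transpose_in_chart c (X i) \<eta>)"
    by (intro test_function_transpose X) auto
  with Cons show ?case by simp
qed simp

text \<open>The head of \<open>I\<close> is the outermost field in \<open>iter_deriv\<close> and the
  first transpose that \<open>fold\<close> applies, so one integration by parts removes it from both
  sides. The test function changes on the way and must be left arbitrary.\<close>

lemma distr_deriv_iter_deriv:
  assumes f: "smooth_on \<A> UNIV f" and I: "set I \<subseteq> {1..r}"
  shows "distr_deriv \<A> X I f (iter_deriv X I f)"
proof -
  have "(\<integral>y. iter_deriv X I f (chart_inv c y) * of_real (\<eta> y) \<partial>lborel)
      = (\<integral>y. f (chart_inv c y) * of_real (fold (\<lambda>i. transpose_in_chart c (X i)) I \<eta> y) \<partial>lborel)"
    if c: "c \<in> \<A>" and "test_function (chart_image c) \<eta>" for c \<eta>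
    using I that(2)
  proof (induction I arbitrary: \<eta>)
    case Nil
    then show ?case by (simp add: iter_deriv_def)
  next
    case (Cons i I)
    have Xi: "smooth_vfield \<A> (X i)" using Cons.prems by (intro X) auto
    have "(\<integral>y. iter_deriv X (i # I) f (chart_inv c y) * of_real (\<eta> y) \<partial>lborel)
        = (\<integral>y. capply (X i) (iter_deriv X I f) (chart_inv c y) * of_real (\<eta> y) \<partial>lborel)"
      by (simp add: iter_deriv_def)
    also have "\<dots> = (\<integral>y. iter_deriv X I f (chart_inv c y) * of_real (transpose_in_chart c (X i) \<eta> y) \<partial>lborel)"
      using Cons.prems by (intro integral_capply Xi c smooth_on_iter_deriv f) auto
    finally show ?case
      using Cons.IH[OF _ test_function_transpose[OF Xi c Cons.prems(2)]] Cons.prems(1) by simp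
  qed
  then show ?thesis
    using locally_integrable_continuous[OF smooth_on_continuous[OF f]]
      locally_integrable_continuous[OF smooth_on_continuous[OF smooth_on_iter_deriv[OF I f]]]
    by (simp add: distr_deriv_def)
qed

end
end

text \<open>The square of the modulus is dominated by \<open>B\<^sup>2\<close> times the indicator
  of \<open>K\<close>, and the measure is finite on compact sets. The factor depends on
  \<open>K\<close> only, hence it is the same for all derivatives of a given function.\<close>

lemma in_L2_continuous_bounded:
  assumes \<mu>: "regular_borel \<mu>" and g: "continuous_on UNIV g" and K: "compact K" "\<And>x. x \<notin> K \<Longrightarrow> g x = 0"
    and B: "0 \<le> B" "\<And>x. cmod (g x) \<le> B"
  shows "in_L2 \<mu> g" and "L2_norm \<mu> g \<le> B * sqrt (measure \<mu> K)"
proof -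
  have sets: "sets \<mu> = sets borel" using \<mu> by (simp add: regular_borel_def)
  have fin: "emeasure \<mu> K < \<infinity>" using \<mu> K by (simp add: regular_borel_def)
  have KM: "K \<in> sets \<mu>" using borel_closed[OF compact_imp_closed[OF K(1)]] sets by simp
  have meas: "g \<in> borel_measurable \<mu>"
    using borel_measurable_continuous_onI[OF g] measurable_cong_sets[OF sets refl] by blast
  have ind: "integrable \<mu> (\<lambda>x. B\<^sup>2 * indicator K x :: real)"
    using KM fin by (intro integrable_mult_right integrable_real_indicator)
  have le: "(cmod (g x))\<^sup>2 \<le> B\<^sup>2 * indicator K x" for x
    using K(2)[of x] B(2)[of x] by (auto simp: indicator_def intro: power_mono)
  have int: "integrable \<mu> (\<lambda>x. (cmod (g x))\<^sup>2)"
    by (rule Bochner_Integration.integrable_bound[OF ind]) (use meas le in auto)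
  with meas show "in_L2 \<mu> g" by (simp add: in_L2_def)
  have "(\<integral>x. (cmod (g x))\<^sup>2 \<partial>\<mu>) \<le> (\<integral>x. B\<^sup>2 * indicator K x \<partial>\<mu>)"
    by (rule integral_mono[OF int ind le])
  also have "\<dots> = B\<^sup>2 * measure \<mu> K" using KM by simp
  finally show "L2_norm \<mu> g \<le> B * sqrt (measure \<mu> K)"
    unfolding L2_norm_def using B(1) real_sqrt_le_mono by (fastforce simp: real_sqrt_mult)
qed

lemma tuples_iff: "I \<in> tuples r a \<longleftrightarrow> length I = a \<and> set I \<subseteq> {1..r}"
  by (simp add: tuples_def)

lemma (in manifold) gevrey_Linf_subset_L2:
  assumes \<mu>: "regular_borel \<mu>" and X: "\<And>i. i \<in> {1..r} \<Longrightarrow> smooth_vfield \<A> (X i)"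
  shows "gevrey_Linf \<A> r X s \<subseteq> gevrey_L2 \<A> \<mu> r X s"
proof
  fix \<phi> assume "\<phi> \<in> gevrey_Linf \<A> r X s"
  then obtain A C where \<phi>: "smooth_on \<A> UNIV \<phi>" "compact (support \<phi>)" and AC: "0 < A" "0 < C"
    and bound: "\<And>a I x. I \<in> tuples r a \<Longrightarrow> cmod (iter_deriv X I \<phi> x) \<le> C * A ^ a * tuple_fact r I powr s"
    unfolding gevrey_Linf_def by blast
  let ?K = "support \<phi>"
  \<comment> \<open>The summand 1 keeps the constant positive even if the support is a null
    set.\<close>
  define C' where "C' = C * (sqrt (measure \<mu> ?K) + 1)"
  have C': "0 < C'" using AC by (simp add: C'_def add_nonneg_pos)
  have est: "in_L2 \<mu> (iter_deriv X I \<phi>) \<and> L2_norm \<mu> (iter_deriv X I \<phi>) \<le> C' * A ^ a * tuple_fact r I powr s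
      \<and> distr_deriv \<A> X I \<phi> (iter_deriv X I \<phi>)" if I: "I \<in> tuples r a" for a I
  proof -
    have sI: "set I \<subseteq> {1..r}" using I by (simp add: tuples_iff)
    let ?B = "C * A ^ a * tuple_fact r I powr s"
    have B: "0 \<le> ?B" using AC by simp
    have z: "iter_deriv X I \<phi> x = 0" if "x \<notin> ?K" for x
      by (rule iter_deriv_eq_0[OF X, where W="- ?K"]) (use that sI closed_support[of \<phi>] support_eq_0[of _ \<phi>] in auto)
    note L = in_L2_continuous_bounded[OF \<mu> smooth_on_continuous[OF smooth_on_iter_deriv[OF X sI \<phi>(1)]] \<phi>(2) z B bound[OF I]]
    have "?B * sqrt (measure \<mu> ?K) \<le> ?B * (sqrt (measure \<mu> ?K) + 1)"
      using B by (intro mult_left_mono) auto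
    also have "\<dots> = C' * A ^ a * tuple_fact r I powr s" by (simp add: C'_def)
    finally show ?thesis using L distr_deriv_iter_deriv[OF X \<phi>(1) sI] by auto
  qed
  have "iter_deriv X [] \<phi> = \<phi>" by (simp add: iter_deriv_def)
  with est AC C' show "\<phi> \<in> gevrey_L2 \<A> \<mu> r X s"
    unfolding gevrey_L2_def by (intro CollectI exI[of _ "\<lambda>I. iter_deriv X I \<phi>"]) blast
qed

section \<open>Functions in the \<open>L\<^sup>2\<close> Gevrey space\<close>

lemma (in manifold) weak_apply_add:
  assumes c: "c \<in> \<A>" and Z: "smooth_vfield \<A> Z" and "weak_apply c Z u w" "weak_apply c Z u' w'"
  shows "weak_apply c Z (\<lambda>y. u y + u' y) (\<lambda>y. w y + w' y)"
proof -
  have "continuous_on (chart_image c) u" "continuous_on (chart_image c) w"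
    "continuous_on (chart_image c) u'" "continuous_on (chart_image c) w'"
    using assms by (auto simp: weak_apply_def)
  then show ?thesis
    using assms test_function_transpose[OF Z c]
    by (simp add: weak_apply_def distrib_right integrable_test_chart[OF c] continuous_on_add)
qed

lemma weak_apply_scale: "weak_apply c Z u w \<Longrightarrow> weak_apply c Z (\<lambda>y. k * u y) (\<lambda>y. k * w y)"
  by (simp add: weak_apply_def mult.assoc continuous_on_mult_left)

text \<open>The functions \<open>u\<close> having all iterated weak derivatives \<open>w I\<close> form a vector space
  stable under the fields \<open>X i\<close>, hence under the Lie algebra that they generate.\<close>

lemma (in manifold) weak_family_C_inf:
  assumes c: "c \<in> \<A>" and H: "hoermander_system \<A> r X"
    and cont: "\<And>I. set I \<subseteq> {1..r} \<Longrightarrow> continuous_on (chart_image c) (w I)"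
    and weak: "\<And>i I. i \<in> {1..r} \<Longrightarrow> set I \<subseteq> {1..r} \<Longrightarrow> weak_apply c (X i) (w I) (w (i # I))"
    and I: "set I \<subseteq> {1..r}"
  shows "C_inf_on (chart_image c) (w I)"
proof -
  have X: "smooth_vfield \<A> (X i)" if "i \<in> {1..r}" for i
    using H that by (simp add: hoermander_system_def)
  define fam where "fam w \<longleftrightarrow> (\<forall>I. set I \<subseteq> {1..r} \<longrightarrow> continuous_on (chart_image c) (w I) \<and>
    (\<forall>i\<in>{1..r}. weak_apply c (X i) (w I) (w (i # I))))" for w
  define V where "V = {w [] | w. fam w}"
  \<comment> \<open>Differentiation prepends indices, so appending a fixed \<open>I\<close> on the
    right makes \<open>w I\<close> the root of a family of the same kind.\<close>
  have fam_shift: "fam (\<lambda>J. w (J @ I))" if "fam w" "set I \<subseteq> {1..r}" for w I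
    using that by (simp add: fam_def)
  have fw: "fam w" using cont weak by (simp add: fam_def)
  have "w ([] @ I) \<in> V" unfolding V_def using fam_shift[OF fw I] by (intro CollectI exI[of _ "\<lambda>J. w (J @ I)"]) simp
  then have "w I \<in> V" by simp
  then show ?thesis
  proof (rule weak_apply_imp_C_inf[OF c, rotated -1])
    fix u assume "u \<in> V"
    then show "continuous_on (chart_image c) u" by (auto simp: V_def fam_def)
  next
    have "fam (\<lambda>_ _. 0)" by (simp add: fam_def weak_apply_def)
    then show "(\<lambda>_. 0) \<in> V" unfolding V_def by (intro CollectI exI[of _ "\<lambda>_ _. 0"]) simp
  next
    fix u u' assume "u \<in> V" "u' \<in> V"
    then obtain w w' where *: "fam w" "u = w []" "fam w'" "u' = w' []" unfolding V_def by blast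
    have "fam (\<lambda>I y. w I y + w' I y)"
      using *(1,3) weak_apply_add[OF c X] by (simp add: fam_def continuous_on_add)
    then show "(\<lambda>y. u y + u' y) \<in> V"
      unfolding V_def by (intro CollectI exI[of _ "\<lambda>I y. w I y + w' I y"]) (simp add: *)
  next
    fix k u assume "u \<in> V"
    then obtain w where *: "fam w" "u = w []" unfolding V_def by blast
    have "fam (\<lambda>I y. k * w I y)"
      using *(1) by (simp add: fam_def continuous_on_mult_left weak_apply_scale)
    then show "(\<lambda>y. k * u y) \<in> V"
      unfolding V_def by (intro CollectI exI[of _ "\<lambda>I y. k * w I y"]) (simp add: *)
  next
    fix Z u assume "Z \<in> X ` {1..r}" "u \<in> V"
    then obtain i w where *: "i \<in> {1..r}" "Z = X i" "fam w" "u = w []" unfolding V_def by blast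
    have "fam (\<lambda>J. w (J @ [i]))" using *(1) by (intro fam_shift[OF *(3)]) simp
    then have "w ([] @ [i]) \<in> V" unfolding V_def by (intro CollectI exI[of _ "\<lambda>J. w (J @ [i])"]) simp
    moreover have "weak_apply c Z u (w ([] @ [i]))" using * by (simp add: fam_def)
    ultimately show "\<exists>w\<in>V. weak_apply c Z u w" by blast
  next
    show "smooth_vfield \<A> Z" if "Z \<in> X ` {1..r}" for Z using that X by blast
    show "{Z x | Z. Z \<in> lie_generated \<A> (X ` {1..r})} = tangent_space \<A> x" for x
      using H by (simp add: hoermander_system_def)
  qed
qed

text \<open>The Lebesgue half of \<open>ae_on_manifold\<close> makes the integrands agree almost
  everywhere. Measurability of \<open>g\<close> in the chart is available on compact sets, through
  local integrability, hence the detour over the indicator of the support of \<eta>.\<close>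

lemma integral_ae_on_manifold:
  assumes "c \<in> \<A>" "locally_integrable \<A> g" "continuous_on UNIV h" "ae_on_manifold \<A> \<mu> (\<lambda>x. g x = h x)"
    and \<eta>: "test_function (chart_image c) \<eta>" and c: "open (chart_image c)" "continuous_on (chart_image c) (chart_inv c)"
  shows "(\<integral>y. g (chart_inv c y) * of_real (\<eta> y) \<partial>lborel) = (\<integral>y. h (chart_inv c y) * of_real (\<eta> y) \<partial>lborel)"
proof (rule Bochner_Integration.integral_cong_AE)
  have "compact (support \<eta>)" "support \<eta> \<subseteq> chart_image c" using \<eta> by (auto simp: test_function_def)
  then have "set_integrable lborel (support \<eta>) (g \<circ> chart_inv c)"
    using assms(1,2) by (simp add: locally_integrable_def)
  then have m: "(\<lambda>y. indicator (support \<eta>) y *\<^sub>R g (chart_inv c y)) \<in> borel_measurable lborel"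
    by (simp add: set_integrable_def borel_measurable_integrable)
  have "(\<lambda>y. complex_of_real (\<eta> y)) \<in> borel_measurable lborel"
    using borel_measurable_continuous_onI[OF test_function_continuous[OF \<eta>]] by simp
  from borel_measurable_times[OF m this]
  have "(\<lambda>y. indicator (support \<eta>) y *\<^sub>R g (chart_inv c y) * of_real (\<eta> y)) \<in> borel_measurable lborel" .
  also have "(\<lambda>y. indicator (support \<eta>) y *\<^sub>R g (chart_inv c y) * of_real (\<eta> y)) = (\<lambda>y. g (chart_inv c y) * of_real (\<eta> y))"
    by (auto simp: indicator_def support_eq_0)
  finally show "(\<lambda>y. g (chart_inv c y) * of_real (\<eta> y)) \<in> borel_measurable lborel" .
  have "continuous_on (chart_image c) (\<lambda>y. h (chart_inv c y))"
    by (rule continuous_on_compose2[OF assms(3) c(2)]) simp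
  then show "(\<lambda>y. h (chart_inv c y) * of_real (\<eta> y)) \<in> borel_measurable lborel"
    using integrable_times_test[OF c(1) _ \<eta>] borel_measurable_integrable by blast
  have "AE y in lborel. y \<in> chart_image c \<longrightarrow> g (chart_inv c y) = h (chart_inv c y)"
    using assms(1,4) by (simp add: ae_on_manifold_def)
  then show "AE y in lborel. g (chart_inv c y) * of_real (\<eta> y) = h (chart_inv c y) * of_real (\<eta> y)"
    by (rule AE_mp) (use test_function_eq_0[OF \<eta>] in \<open>auto intro!: AE_I2\<close>)
qed

text \<open>In a chart around \<open>x\<close>, the real and imaginary parts integrate to 0 against
  every test function supported in the image of \<open>W\<close>, so
  \<open>fundamental_lemma\<close> makes them vanish at every point there.\<close>

lemma (in manifold) continuous_ae_0_imp_0: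
  assumes f: "continuous_on UNIV f" and W: "open W" "x \<in> W"
    and ae: "\<And>c. c \<in> \<A> \<Longrightarrow> AE y in lborel. y \<in> chart_image c \<longrightarrow> chart_inv c y \<in> W \<longrightarrow> f (chart_inv c y) = (0::complex)"
  shows "f x = 0"
proof -
  obtain c where c: "c \<in> \<A>" "x \<in> fst c" by (rule chart_cover)
  let ?S = "snd c ` (fst c \<inter> W)"
  note S = open_chart_image_Int[OF c(1) W(1)]
  have sub: "?S \<subseteq> chart_image c" by (auto simp: chart_image_def)
  have inS: "y \<in> chart_image c \<and> chart_inv c y \<in> W" if "y \<in> ?S" for y
    using that by (simp add: chart_image_Int[OF c(1)])
  have cont: "continuous_on ?S (\<lambda>y. f (chart_inv c y))"
    by (rule continuous_on_compose2[OF f continuous_on_subset[OF chart_inv_continuous[OF c(1)] sub]]) simp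
  have "L (f (chart_inv c y)) = 0" if L: "continuous_on UNIV L" "L 0 = 0" and y: "y \<in> ?S" for L :: "complex \<Rightarrow> real" and y
  proof (rule fundamental_lemma[OF S _ _ y])
    show "continuous_on ?S (\<lambda>y. L (f (chart_inv c y)))"
      by (rule continuous_on_compose2[OF L(1) cont]) simp
    fix \<eta> assume \<eta>: "test_function ?S \<eta>"
    show "(\<integral>y. L (f (chart_inv c y)) * \<eta> y \<partial>lborel) = 0"
    proof (rule integral_eq_zero_AE)
      show "AE y in lborel. L (f (chart_inv c y)) * \<eta> y = 0"
        using ae[OF c(1)] by (rule AE_mp) (use test_function_eq_0[OF \<eta>] inS L(2) in \<open>fastforce intro!: AE_I2\<close>)
    qed
  qed
  from this[of Re] this[of Im] have "f (chart_inv c y) = 0" if "y \<in> ?S" for y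
    using that continuous_on_Re[of UNIV "\<lambda>z. z"] continuous_on_Im[of UNIV "\<lambda>z. z"]
    by (simp add: complex_eq_iff del: image_iff)
  from this[of "snd c x"] show ?thesis using c W(2) chart_inv_chart[OF c] by simp
qed

lemma fold_transpose_append:
  "fold (\<lambda>i. transpose_in_chart c (X i)) (J @ I) \<eta> = fold (\<lambda>i. transpose_in_chart c (X i)) I (fold (\<lambda>i. transpose_in_chart c (X i)) J \<eta>)"
  by simp

text \<open>The representative is \<open>h []\<close>, where \<open>h I\<close> is the continuous
  version of the derivative \<open>g I\<close> produced by the embedding. The point is to show that
  the classical derivatives of \<open>h []\<close> are the functions \<open>h I\<close>; the
  embedding then bounds these pointwise by the norms of \<open>g (J @ I)\<close> with
  \<open>J\<close> of length at most \<open>k\<close>.\<close>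

lemma (in manifold) gevrey_L2_representative:
  assumes H: "hoermander_system \<A> r X" and s: "0 < s"
    and sob: "sobolev_embedding \<A> \<mu> r X k" and \<phi>: "\<phi> \<in> gevrey_L2 \<A> \<mu> r X s"
  obtains \<psi> where "smooth_on \<A> UNIV \<psi>" "ae_on_manifold \<A> \<mu> (\<lambda>x. \<phi> x = \<psi> x)"
    and "\<exists>A>0. \<exists>C>0. \<forall>a. \<forall>I\<in>tuples r a. \<forall>x. cmod (iter_deriv X I \<psi> x) \<le> C * A ^ a * tuple_fact r I powr s"
proof -
  have X: "smooth_vfield \<A> (X i)" if "i \<in> {1..r}" for i
    using H that by (simp add: hoermander_system_def)
  obtain g A C where g0: "g [] = \<phi>" and AC: "0 < A" "0 < C"
    and g: "\<And>a I. I \<in> tuples r a \<Longrightarrow> in_L2 \<mu> (g I) \<and> distr_deriv \<A> X I \<phi> (g I)"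
    and g_bound: "\<And>a I. I \<in> tuples r a \<Longrightarrow> L2_norm \<mu> (g I) \<le> C * A ^ a * tuple_fact r I powr s"
    using \<phi> unfolding gevrey_L2_def by blast
  obtain D where D: "0 < D" and sobolev: "\<And>f g. g [] = f \<Longrightarrow>
        (\<forall>a\<le>k. \<forall>I\<in>tuples r a. in_L2 \<mu> (g I) \<and> distr_deriv \<A> X I f (g I)) \<Longrightarrow>
        (\<exists>h. continuous_on UNIV h \<and> bounded (range h) \<and> ae_on_manifold \<A> \<mu> (\<lambda>x. f x = h x) \<and>
           (SUP x. cmod (h x)) \<le> D * (\<Sum>a\<le>k. \<Sum>I\<in>tuples r a. L2_norm \<mu> (g I)))"
    using sob unfolding sobolev_embedding_def by blast
  have tup: "J @ I \<in> tuples r (length J + length I)" if "set I \<subseteq> {1..r}" "set J \<subseteq> {1..r}" for I J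
    using that by (simp add: tuples_iff)
  have tupI: "I \<in> tuples r (length I)" if "set I \<subseteq> {1..r}" for I using that by (simp add: tuples_iff)
  let ?T = "\<lambda>c I. fold (\<lambda>i. transpose_in_chart c (X i)) I"
  \<comment> \<open>Both are derivatives of \<phi>. For \<open>J @ I\<close> the transposes of
    \<open>J\<close> act first; what they produce is again a test function, against which
    \<open>g I\<close> can be tested.\<close>
  have dg: "distr_deriv \<A> X J (g I) (g (J @ I))" if IJ: "set I \<subseteq> {1..r}" "set J \<subseteq> {1..r}" for I J
    unfolding distr_deriv_def
  proof (intro conjI ballI allI impI)
    have d: "distr_deriv \<A> X I \<phi> (g I)" "distr_deriv \<A> X (J @ I) \<phi> (g (J @ I))"
      using g[OF tupI[OF IJ(1)]] g[OF tup[OF IJ]] by auto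
    then show "locally_integrable \<A> (g I)" "locally_integrable \<A> (g (J @ I))"
      by (auto simp: distr_deriv_def)
    fix c \<eta> assume c: "c \<in> \<A>" and \<eta>: "test_function (chart_image c) \<eta>"
    have "(\<integral>y. g (J @ I) (chart_inv c y) * of_real (\<eta> y) \<partial>lborel) = (\<integral>y. \<phi> (chart_inv c y) * of_real (?T c (J @ I) \<eta> y) \<partial>lborel)"
      using d(2) c \<eta> by (simp only: distr_deriv_def)
    also have "\<dots> = (\<integral>y. g I (chart_inv c y) * of_real (?T c J \<eta> y) \<partial>lborel)"
      using d(1) c test_function_fold_transpose[OF X c IJ(2) \<eta>] by (simp only: distr_deriv_def fold_transpose_append)
    finally show "(\<integral>y. g (J @ I) (chart_inv c y) * of_real (\<eta> y) \<partial>lborel) = (\<integral>y. g I (chart_inv c y) * of_real (?T c J \<eta> y) \<partial>lborel)" .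
  qed
  have "\<forall>I. \<exists>h. set I \<subseteq> {1..r} \<longrightarrow> continuous_on UNIV h \<and> bounded (range h) \<and> ae_on_manifold \<A> \<mu> (\<lambda>x. g I x = h x) \<and>
           (SUP x. cmod (h x)) \<le> D * (\<Sum>a\<le>k. \<Sum>J\<in>tuples r a. L2_norm \<mu> (g (J @ I)))"
  proof
    fix I
    show "\<exists>h. set I \<subseteq> {1..r} \<longrightarrow> continuous_on UNIV h \<and> bounded (range h) \<and> ae_on_manifold \<A> \<mu> (\<lambda>x. g I x = h x) \<and>
           (SUP x. cmod (h x)) \<le> D * (\<Sum>a\<le>k. \<Sum>J\<in>tuples r a. L2_norm \<mu> (g (J @ I)))"
    proof (cases "set I \<subseteq> {1..r}")
      case True
      have "in_L2 \<mu> (g (J @ I)) \<and> distr_deriv \<A> X J (g I) (g (J @ I))" if "J \<in> tuples r a" for J a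
        using that g[OF tup[OF True]] dg[OF True] by (simp add: tuples_iff)
      then show ?thesis
        using sobolev[of "\<lambda>J. g (J @ I)" "g I"] by auto
    qed simp
  qed
  from choice[OF this] obtain h where h': "\<forall>I. set I \<subseteq> {1..r} \<longrightarrow> continuous_on UNIV (h I) \<and> bounded (range (h I)) \<and>
        ae_on_manifold \<A> \<mu> (\<lambda>x. g I x = h I x) \<and>
        (SUP x. cmod (h I x)) \<le> D * (\<Sum>a\<le>k. \<Sum>J\<in>tuples r a. L2_norm \<mu> (g (J @ I)))" by (rule exE)
  then have h: "continuous_on UNIV (h I)" "bounded (range (h I))" "ae_on_manifold \<A> \<mu> (\<lambda>x. g I x = h I x)"
      "(SUP x. cmod (h I x)) \<le> D * (\<Sum>a\<le>k. \<Sum>J\<in>tuples r a. L2_norm \<mu> (g (J @ I)))"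
    if "set I \<subseteq> {1..r}" for I using that by blast+
  have hc: "continuous_on (chart_image c) (\<lambda>y. h I (chart_inv c y))" if "c \<in> \<A>" "set I \<subseteq> {1..r}" for c I
    by (rule continuous_on_compose2[OF h(1)[OF that(2)] chart_inv_continuous[OF that(1)]]) simp
  have hX: "(\<integral>y. h (i # I) (chart_inv c y) * of_real (\<eta> y) \<partial>lborel)
      = (\<integral>y. h I (chart_inv c y) * of_real (transpose_in_chart c (X i) \<eta> y) \<partial>lborel)"
    if c: "c \<in> \<A>" and i: "i \<in> {1..r}" and I: "set I \<subseteq> {1..r}" and \<eta>: "test_function (chart_image c) \<eta>" for c i I \<eta>
  proof -
    have d: "distr_deriv \<A> X [i] (g I) (g (i # I))" using dg[OF I, of "[i]"] i by simp
    have iI: "set (i # I) \<subseteq> {1..r}" using i I by simp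
    have li: "locally_integrable \<A> (g I)" "locally_integrable \<A> (g (i # I))" using d by (auto simp: distr_deriv_def)
    note ae = integral_ae_on_manifold[OF c _ h(1) h(3) _ chart_image_open[OF c] chart_inv_continuous[OF c]]
    show ?thesis
      using d c \<eta> ae[OF li(2) iI iI \<eta>] ae[OF li(1) I I test_function_transpose[OF X[OF i] c \<eta>]]
      by (simp add: distr_deriv_def)
  qed
  have weak: "weak_apply c (X i) (\<lambda>y. Re (h I (chart_inv c y))) (\<lambda>y. Re (h (i # I) (chart_inv c y)))"
    "weak_apply c (X i) (\<lambda>y. Im (h I (chart_inv c y))) (\<lambda>y. Im (h (i # I) (chart_inv c y)))"
    if c: "c \<in> \<A>" and i: "i \<in> {1..r}" and I: "set I \<subseteq> {1..r}" for c i I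
  proof -
    have iI: "set (i # I) \<subseteq> {1..r}" using i I by simp
    note ri = integral_test_Re_Im[OF chart_image_open[OF c] hc[OF c]]
    have "(\<integral>y. Re (h (i # I) (chart_inv c y)) * \<eta> y \<partial>lborel)
        = (\<integral>y. Re (h I (chart_inv c y)) * transpose_in_chart c (X i) \<eta> y \<partial>lborel)"
      "(\<integral>y. Im (h (i # I) (chart_inv c y)) * \<eta> y \<partial>lborel)
        = (\<integral>y. Im (h I (chart_inv c y)) * transpose_in_chart c (X i) \<eta> y \<partial>lborel)"
      if \<eta>: "test_function (chart_image c) \<eta>" for \<eta>
      unfolding ri[OF iI \<eta>, symmetric] ri[OF I test_function_transpose[OF X[OF i] c \<eta>], symmetric]
        hX[OF c i I \<eta>] by (rule refl)+
    then show "weak_apply c (X i) (\<lambda>y. Re (h I (chart_inv c y))) (\<lambda>y. Re (h (i # I) (chart_inv c y)))"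
      "weak_apply c (X i) (\<lambda>y. Im (h I (chart_inv c y))) (\<lambda>y. Im (h (i # I) (chart_inv c y)))"
      using continuous_on_Re[OF hc[OF c I]] continuous_on_Im[OF hc[OF c I]]
        continuous_on_Re[OF hc[OF c iI]] continuous_on_Im[OF hc[OF c iI]]
      by (simp_all add: weak_apply_def)
  qed
  have smooth: "smooth_on \<A> UNIV (h I)" if I: "set I \<subseteq> {1..r}" for I
    unfolding smooth_on_def
  proof
    fix c assume c: "c \<in> \<A>"
    note S = chart_image_open[OF c]
    have "C_inf_on (chart_image c) (\<lambda>y. Re (h I (chart_inv c y)))"
      by (rule weak_family_C_inf[OF c H, where w="\<lambda>I y. Re (h I (chart_inv c y))"])
         (use continuous_on_Re[OF hc[OF c]] weak(1)[OF c] I in auto)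
    moreover have "C_inf_on (chart_image c) (\<lambda>y. Im (h I (chart_inv c y)))"
      by (rule weak_family_C_inf[OF c H, where w="\<lambda>I y. Im (h I (chart_inv c y))"])
         (use continuous_on_Im[OF hc[OF c]] weak(2)[OF c] I in auto)
    ultimately have "C_inf_on (chart_image c) (\<lambda>y. of_real (Re (h I (chart_inv c y))) + Im (h I (chart_inv c y)) *\<^sub>R \<i>)"
      by (intro C_inf_on_add[OF S C_inf_on_bounded_linear[OF S bounded_linear_of_real]
            C_inf_on_bounded_linear[OF S bounded_linear_scaleR_left]])
    also have "(\<lambda>y. of_real (Re (h I (chart_inv c y))) + Im (h I (chart_inv c y)) *\<^sub>R \<i>) = h I \<circ> chart_inv c"
      by (auto simp: complex_eq_iff)
    finally show "C_inf_on (snd c ` (fst c \<inter> UNIV)) (h I \<circ> chart_inv c)" by (simp add: chart_image_def comp_def)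
  qed
  \<comment> \<open>As \<open>h I\<close> is already known to be smooth, integration by parts makes
    its classical derivative a weak one. Two continuous weak derivatives of the same function
    coincide.\<close>
  have capply_h: "capply (X i) (h I) = h (i # I)" if i: "i \<in> {1..r}" and I: "set I \<subseteq> {1..r}" for i I
  proof
    fix x
    obtain c where c: "c \<in> \<A>" "x \<in> fst c" by (rule chart_cover)
    note S = chart_image_open[OF c(1)]
    have iI: "set (i # I) \<subseteq> {1..r}" using i I by simp
    have eq: "vfield_apply (X i) (\<lambda>x. L (h I x)) x = L (h (i # I) x)"
      if L: "bounded_linear L" and weak: "weak_apply c (X i) (\<lambda>y. L (h I (chart_inv c y))) (\<lambda>y. L (h (i # I) (chart_inv c y)))"
      for L :: "complex \<Rightarrow> real"
    proof -
      have f: "smooth_on \<A> (fst c) (\<lambda>x. L (h I x))"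
        by (rule smooth_on_bounded_linear[OF chart_dom_open[OF c(1)] L smooth_on_mono[OF smooth[OF I] subset_UNIV]])
      have cf: "continuous_on (chart_image c) (vfield_apply (X i) (\<lambda>x. L (h I x)) \<circ> chart_inv c)"
        by (rule C_inf_on_continuous[OF smooth_on_chart[OF smooth_vfield_apply[OF X[OF i] chart_dom_open[OF c(1)] f] c(1) order_refl]])
      have cw: "continuous_on (chart_image c) (\<lambda>y. L (h (i # I) (chart_inv c y)))"
        using weak by (simp add: weak_apply_def)
      have "vfield_apply (X i) (\<lambda>x. L (h I x)) (chart_inv c (snd c x)) - L (h (i # I) (chart_inv c (snd c x))) = 0"
      proof (rule fundamental_lemma[OF S _ _ chart_in_image[OF c]])
        show "continuous_on (chart_image c) (\<lambda>y. vfield_apply (X i) (\<lambda>x. L (h I x)) (chart_inv c y) - L (h (i # I) (chart_inv c y)))"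
          using cf cw by (auto simp: comp_def intro: continuous_on_diff)
        fix \<eta> assume \<eta>: "test_function (chart_image c) \<eta>"
        have "(\<integral>y. vfield_apply (X i) (\<lambda>x. L (h I x)) (chart_inv c y) * \<eta> y \<partial>lborel)
            = (\<integral>y. L (h (i # I) (chart_inv c y)) * \<eta> y \<partial>lborel)"
          using integral_vfield_apply[OF X[OF i] c(1) f \<eta>] weak \<eta> by (simp add: weak_apply_def)
        then show "(\<integral>y. (vfield_apply (X i) (\<lambda>x. L (h I x)) (chart_inv c y) - L (h (i # I) (chart_inv c y))) * \<eta> y \<partial>lborel) = 0"
          using integrable_test_chart[OF c(1) cf \<eta>] integrable_test_chart[OF c(1) cw \<eta>]
          by (simp add: left_diff_distrib)
      qed
      then show ?thesis by (simp add: chart_inv_chart[OF c])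
    qed
    show "capply (X i) (h I) x = h (i # I) x"
      using eq[OF bounded_linear_Re weak(1)[OF c(1) i I]] eq[OF bounded_linear_Im weak(2)[OF c(1) i I]]
      by (simp add: capply_def comp_def complex_eq_iff)
  qed
  have iter: "iter_deriv X I (h []) = h I" if "set I \<subseteq> {1..r}" for I
    using that
  proof (induction I)
    case (Cons i I)
    then show ?case using capply_h[of i I] by (simp add: iter_deriv_def)
  qed (simp add: iter_deriv_def)
  define B where "B = A * 2 powr s"
  have B: "0 < B" using AC by (simp add: B_def)
  \<comment> \<open>The total weight of the additional derivatives \<open>J\<close>: a finite sum
    that depends neither on \<open>I\<close> nor on the point, so it goes into the constant. The
    final constant contains \<open>K + 1\<close>, whose positivity needs only
    \<open>0 \<le> K\<close>.\<close>
  define K where "K = (\<Sum>a\<le>k. \<Sum>J\<in>tuples r a. B ^ a * tuple_fact r J powr s)"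
  have K: "0 \<le> K" unfolding K_def using B by (intro sum_nonneg) simp
  have bound: "cmod (iter_deriv X I (h []) x) \<le> (D * C * (K + 1)) * B ^ a * tuple_fact r I powr s"
    if I: "I \<in> tuples r a" for a I x
  proof -
    have sI: "set I \<subseteq> {1..r}" and lI: "length I = a" using I by (auto simp: tuples_iff)
    let ?w = "B ^ a * tuple_fact r I powr s"
    have w: "0 \<le> ?w" using B by simp
    \<comment> \<open>A real supremum dominates the values only over a set that is bounded above;
      this is where the boundedness asserted by the embedding is used.\<close>
    have "bdd_above (range (\<lambda>x. cmod (h I x)))"
      using h(2)[OF sI] by (auto simp: bounded_iff bdd_above_def)
    then have "cmod (h I x) \<le> (SUP x. cmod (h I x))" by (rule cSUP_upper[OF UNIV_I])
    also have "\<dots> \<le> D * (\<Sum>a\<le>k. \<Sum>J\<in>tuples r a. L2_norm \<mu> (g (J @ I)))" by (rule h(4)[OF sI])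
    also have "\<dots> \<le> D * (\<Sum>a\<le>k. \<Sum>J\<in>tuples r a. C * (B ^ a * tuple_fact r J powr s * ?w))"
    proof (intro mult_left_mono sum_mono)
      fix b J assume J: "J \<in> tuples r b"
      then have sJ: "set J \<subseteq> {1..r}" and lJ: "length J = b" by (auto simp: tuples_iff)
      have "L2_norm \<mu> (g (J @ I)) \<le> C * (A ^ length (J @ I) * tuple_fact r (J @ I) powr s)"
        using g_bound[OF tup[OF sI sJ]] by (simp add: mult.assoc)
      also have "\<dots> \<le> C * ((B ^ length J * tuple_fact r J powr s) * (B ^ length I * tuple_fact r I powr s))"
        unfolding B_def using AC s sI sJ by (intro mult_left_mono gevrey_weight_append) auto
      finally show "L2_norm \<mu> (g (J @ I)) \<le> C * (B ^ b * tuple_fact r J powr s * ?w)" by (simp only: lI lJ)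
    qed (use D in auto)
    also have "\<dots> = D * C * K * ?w"
      by (simp add: K_def sum_distrib_left sum_distrib_right mult.assoc)
    also have "\<dots> \<le> D * C * (K + 1) * ?w"
      using D AC w by (intro mult_right_mono mult_left_mono) auto
    finally show ?thesis by (simp add: iter[OF sI] mult.assoc)
  qed
  show ?thesis
  proof (rule that)
    show "smooth_on \<A> UNIV (h [])" by (rule smooth) simp
    show "ae_on_manifold \<A> \<mu> (\<lambda>x. \<phi> x = h [] x)" using h(3)[of "[]"] g0 by simp
    have "0 < D * C * (K + 1)" using D AC K by simp
    with B bound show "\<exists>A>0. \<exists>C>0. \<forall>a. \<forall>I\<in>tuples r a. \<forall>x. cmod (iter_deriv X I (h []) x) \<le> C * A ^ a * tuple_fact r I powr s"
      by blast
  qed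
qed

text \<open>Around a point outside the right-hand side \<phi>, and with it \<psi>, vanishes almost
  everywhere on an open set; continuity removes the exceptional set. Compactness thereby passes from
  the class of \<phi> to the representative.\<close>

lemma (in manifold) support_subset_ae_support:
  assumes \<psi>: "continuous_on UNIV \<psi>" and ae: "ae_on_manifold \<A> \<mu> (\<lambda>x. \<phi> x = \<psi> x)"
  shows "support \<psi> \<subseteq> ae_support \<A> \<mu> \<phi>"
proof (rule support_subsetI)
  show "closed (ae_support \<A> \<mu> \<phi>)" unfolding ae_support_def by (intro closed_Compl open_Union) auto
  fix x assume "x \<notin> ae_support \<A> \<mu> \<phi>"
  then obtain W where W: "open W" "x \<in> W" "ae_on_manifold \<A> \<mu> (\<lambda>x. x \<in> W \<longrightarrow> \<phi> x = 0)"
    by (auto simp: ae_support_def)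
  show "\<psi> x = 0"
  proof (rule continuous_ae_0_imp_0[OF \<psi> W(1,2)])
    fix c assume "c \<in> \<A>"
    then have "AE y in lborel. y \<in> chart_image c \<longrightarrow> \<phi> (chart_inv c y) = \<psi> (chart_inv c y)"
      "AE y in lborel. y \<in> chart_image c \<longrightarrow> chart_inv c y \<in> W \<longrightarrow> \<phi> (chart_inv c y) = 0"
      using ae W(3) by (auto simp: ae_on_manifold_def)
    then show "AE y in lborel. y \<in> chart_image c \<longrightarrow> chart_inv c y \<in> W \<longrightarrow> \<psi> (chart_inv c y) = 0"
      by eventually_elim auto
  qed
qed

theorem proposition2p7:
  fixes \<A> :: "('m::{t2_space, second_countable_topology}, 'e::euclidean_space) chart set"
    and \<mu> :: "'m measure" and r :: nat and X :: "nat \<Rightarrow> 'm vfield" and s :: real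
  assumes "smooth_manifold \<A>"
    and "regular_borel \<mu>"
    and "hoermander_system \<A> r X"
    and "s > 0"
  shows "gevrey_Linf \<A> r X s \<subseteq> gevrey_L2 \<A> \<mu> r X s \<and>
    ((\<exists>k\<ge>1. sobolev_embedding \<A> \<mu> r X k) \<longrightarrow>
       (\<forall>\<phi> \<in> gevrey_L2 \<A> \<mu> r X s.
          \<exists>\<psi>. smooth_on \<A> UNIV \<psi> \<and> ae_on_manifold \<A> \<mu> (\<lambda>x. \<phi> x = \<psi> x) \<and>
              (compact (ae_support \<A> \<mu> \<phi>) \<longrightarrow> \<psi> \<in> gevrey_Linf \<A> r X s)))"
proof (intro conjI impI ballI)
  interpret manifold \<A> by unfold_locales (rule assms(1))
  show "gevrey_Linf \<A> r X s \<subseteq> gevrey_L2 \<A> \<mu> r X s"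
    using assms(3) by (intro gevrey_Linf_subset_L2[OF assms(2)]) (simp add: hoermander_system_def)
  fix \<phi> assume "\<exists>k\<ge>1. sobolev_embedding \<A> \<mu> r X k" and \<phi>: "\<phi> \<in> gevrey_L2 \<A> \<mu> r X s"
  then obtain k where "sobolev_embedding \<A> \<mu> r X k" by blast
  from gevrey_L2_representative[OF assms(3,4) this \<phi>] obtain \<psi> where
    \<psi>: "smooth_on \<A> UNIV \<psi>" "ae_on_manifold \<A> \<mu> (\<lambda>x. \<phi> x = \<psi> x)"
    and bound: "\<exists>A>0. \<exists>C>0. \<forall>a. \<forall>I\<in>tuples r a. \<forall>x. cmod (iter_deriv X I \<psi> x) \<le> C * A ^ a * tuple_fact r I powr s"
    by blast
  \<comment> \<open>The pointwise bounds for \<psi> already hold on the whole manifold, so only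
    compactness of its support remains; the support is a closed subset of
    \<open>ae_support \<A> \<mu> \<phi>\<close>.\<close>
  have "\<psi> \<in> gevrey_Linf \<A> r X s" if "compact (ae_support \<A> \<mu> \<phi>)"
  proof -
    have "compact (support \<psi>)"
      using compact_Int_closed[OF that closed_support, of \<psi>]
        support_subset_ae_support[OF smooth_on_continuous[OF \<psi>(1)] \<psi>(2)] by (simp add: Int_absorb1)
    with \<psi>(1) bound show ?thesis by (simp add: gevrey_Linf_def)
  qed
  with \<psi> show "\<exists>\<psi>. smooth_on \<A> UNIV \<psi> \<and> ae_on_manifold \<A> \<mu> (\<lambda>x. \<phi> x = \<psi> x) \<and>
      (compact (ae_support \<A> \<mu> \<phi>) \<longrightarrow> \<psi> \<in> gevrey_Linf \<A> r X s)" by blast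
qed

end
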